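(* Let $R$ be a commutative Noetherian ring of prime characteristic $p$. Then tight closure commutes with localization in $R$ (i.e. for every ideal $I$ of $R$ and every multiplicative system $W\subseteq R$ one has $I^*R_W=(IR_W)^*$) in each of the following cases: (i) $\dim R<2$; (ii) $R$ is a two-dimensional local ring; (iii) $\dim R=2$ and either $R$ is a Nagata ring or $R$ possesses a $q'$-weak test element for some power $q'$ of $p$.
   Context: All rings are commutative Noetherian with identity of prime characteristic $p$; $q$ denotes a nonnegative power $p^e$ of $p$. $R^{\circ}$ is the set of elements of $R$ not in any minimal prime of $R$. For an ideal $I$, $I^{[q]}$ is the ideal generated by the $q$-th powers of elements of $I$. The tight closure $I^*$ of $I$ is the set of $x\in R$ for which there is $c\in R^{\circ}$ with $cx^q\in I^{[q]}$ for all $q\gg0$; for $R_W$ the tight closure $(IR_W)^*$ is taken in the ring $R_W$. For a power $q'$ of $p$, an element $c\in R^{\circ}$ is a $q'$-weak test element if for every ideal $I$ of $R$ and every $x\in I^*$ one has $cx^q\in I^{[q]}$ for all $q\ge q'$. *)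

theory Defs
  imports "HOL-Algebra.Algebra" "HOL-Library.Extended_Nat"
begin

definition char_p :: "('a, 'b) ring_scheme \<Rightarrow> nat \<Rightarrow> bool" where
  "char_p R p \<longleftrightarrow> Factorial_Ring.prime p \<and> add_pow R p \<one>\<^bsub>R\<^esub> = \<zero>\<^bsub>R\<^esub>"

definition minimal_prime :: "('a, 'b) ring_scheme \<Rightarrow> 'a set \<Rightarrow> bool" where
  "minimal_prime R P \<longleftrightarrow> primeideal P R \<and> (\<forall>Q. primeideal Q R \<and> Q \<subseteq> P \<longrightarrow> Q = P)"

definition ring_circ :: "('a, 'b) ring_scheme \<Rightarrow> 'a set" where
  "ring_circ R = carrier R - \<Union>{P. minimal_prime R P}"

definition frob_ideal :: "('a, 'b) ring_scheme \<Rightarrow> nat \<Rightarrow> 'a set \<Rightarrow> 'a set" where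
  "frob_ideal R q I = genideal R ((\<lambda>x. x [^]\<^bsub>R\<^esub> q) ` I)"

definition tight_closure :: "('a, 'b) ring_scheme \<Rightarrow> nat \<Rightarrow> 'a set \<Rightarrow> 'a set" where
  "tight_closure R p I =
     {x \<in> carrier R. \<exists>c \<in> ring_circ R. \<exists>e0. \<forall>e \<ge> e0.
        c \<otimes>\<^bsub>R\<^esub> (x [^]\<^bsub>R\<^esub> (p ^ e)) \<in> frob_ideal R (p ^ e) I}"

definition weak_test_element :: "('a, 'b) ring_scheme \<Rightarrow> nat \<Rightarrow> nat \<Rightarrow> 'a \<Rightarrow> bool" where
  "weak_test_element R p q' c \<longleftrightarrow> c \<in> ring_circ R \<and>
     (\<forall>I. ideal I R \<longrightarrow> (\<forall>x \<in> tight_closure R p I. \<forall>e. p ^ e \<ge> q' \<longrightarrow>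
        c \<otimes>\<^bsub>R\<^esub> (x [^]\<^bsub>R\<^esub> (p ^ e)) \<in> frob_ideal R (p ^ e) I))"

definition mult_system :: "('a, 'b) ring_scheme \<Rightarrow> 'a set \<Rightarrow> bool" where
  "mult_system R W \<longleftrightarrow> W \<subseteq> carrier R \<and> \<one>\<^bsub>R\<^esub> \<in> W \<and> (\<forall>a \<in> W. \<forall>b \<in> W. a \<otimes>\<^bsub>R\<^esub> b \<in> W)"

definition loc_rel :: "('a, 'b) ring_scheme \<Rightarrow> 'a set \<Rightarrow> (('a \<times> 'a) \<times> ('a \<times> 'a)) set" where
  "loc_rel R W = {((r, s), (r', s')). r \<in> carrier R \<and> s \<in> W \<and> r' \<in> carrier R \<and> s' \<in> W \<and>
      (\<exists>u \<in> W. u \<otimes>\<^bsub>R\<^esub> ((r \<otimes>\<^bsub>R\<^esub> s') \<ominus>\<^bsub>R\<^esub> (r' \<otimes>\<^bsub>R\<^esub> s)) = \<zero>\<^bsub>R\<^esub>)}"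

definition loc_frac :: "('a, 'b) ring_scheme \<Rightarrow> 'a set \<Rightarrow> 'a \<Rightarrow> 'a \<Rightarrow> ('a \<times> 'a) set" where
  "loc_frac R W r s = loc_rel R W `` {(r, s)}"

definition localization :: "('a, 'b) ring_scheme \<Rightarrow> 'a set \<Rightarrow> ('a \<times> 'a) set ring" where
  "localization R W =
    \<lparr>carrier = (carrier R \<times> W) // loc_rel R W,
     monoid.mult = (\<lambda>A B. \<Union>{loc_frac R W (r \<otimes>\<^bsub>R\<^esub> r') (s \<otimes>\<^bsub>R\<^esub> s') | r s r' s'. (r, s) \<in> A \<and> (r', s') \<in> B}),
     monoid.one = loc_frac R W \<one>\<^bsub>R\<^esub> \<one>\<^bsub>R\<^esub>,
     ring.zero = loc_frac R W \<zero>\<^bsub>R\<^esub> \<one>\<^bsub>R\<^esub>,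
     ring.add = (\<lambda>A B. \<Union>{loc_frac R W ((r \<otimes>\<^bsub>R\<^esub> s') \<oplus>\<^bsub>R\<^esub> (r' \<otimes>\<^bsub>R\<^esub> s)) (s \<otimes>\<^bsub>R\<^esub> s') | r s r' s'. (r, s) \<in> A \<and> (r', s') \<in> B})\<rparr>"

definition loc_map :: "('a, 'b) ring_scheme \<Rightarrow> 'a set \<Rightarrow> 'a \<Rightarrow> ('a \<times> 'a) set" where
  "loc_map R W r = loc_frac R W r \<one>\<^bsub>R\<^esub>"

definition ext_ideal :: "('a, 'b) ring_scheme \<Rightarrow> 'a set \<Rightarrow> 'a set \<Rightarrow> ('a \<times> 'a) set set" where
  "ext_ideal R W J = genideal (localization R W) (loc_map R W ` J)"

definition prime_chain :: "('a, 'b) ring_scheme \<Rightarrow> nat \<Rightarrow> bool" where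
  "prime_chain R n \<longleftrightarrow> (\<exists>Ps :: nat \<Rightarrow> 'a set. (\<forall>i \<le> n. primeideal (Ps i) R) \<and> (\<forall>i < n. Ps i \<subset> Ps (Suc i)))"

definition krull_dim :: "('a, 'b) ring_scheme \<Rightarrow> enat" where
  "krull_dim R = (SUP n \<in> {n. prime_chain R n}. enat n)"

definition local_ring :: "('a, 'b) ring_scheme \<Rightarrow> bool" where
  "local_ring R \<longleftrightarrow> (\<exists>!M. maximalideal M R)"

definition integral_closure_in :: "('c, 'd) ring_scheme \<Rightarrow> 'c set \<Rightarrow> 'c set" where
  "integral_closure_in L S = {x \<in> carrier L. \<exists>(n::nat) (a::nat \<Rightarrow> 'c). (\<forall>i. a i \<in> S) \<and>
      (x [^]\<^bsub>L\<^esub> n) \<oplus>\<^bsub>L\<^esub> finsum L (\<lambda>i. a i \<otimes>\<^bsub>L\<^esub> (x [^]\<^bsub>L\<^esub> i)) {..<n} = \<zero>\<^bsub>L\<^esub>}"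

definition fin_gen_over :: "('c, 'd) ring_scheme \<Rightarrow> 'c set \<Rightarrow> 'c set \<Rightarrow> bool" where
  "fin_gen_over L S C \<longleftrightarrow> (\<exists>G. finite G \<and> G \<subseteq> C \<and>
      C = {finsum L (\<lambda>g. a g \<otimes>\<^bsub>L\<^esub> g) G | a. a \<in> G \<rightarrow> S})"

text \<open>Japanese (N-2) domain D: for every finite field extension L of the fraction field K
  of D, the integral closure of D in L is a finite D-module. Finite extensions of K are
  represented (up to isomorphism) by fields whose carrier lies in the type nat => K.\<close>
definition japanese :: "('a, 'b) ring_scheme \<Rightarrow> bool" where
  "japanese D \<longleftrightarrow>
    (\<forall>(L :: (nat \<Rightarrow> ('a \<times> 'a) set) ring) \<phi>.
       field L \<and> \<phi> \<in> ring_hom (localization D (carrier D - {\<zero>\<^bsub>D\<^esub>})) L \<and>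
       ring.finite_dimension L (\<phi> ` carrier (localization D (carrier D - {\<zero>\<^bsub>D\<^esub>}))) (carrier L) \<longrightarrow>
       fin_gen_over L ((\<phi> \<circ> loc_map D (carrier D - {\<zero>\<^bsub>D\<^esub>})) ` carrier D)
         (integral_closure_in L ((\<phi> \<circ> loc_map D (carrier D - {\<zero>\<^bsub>D\<^esub>})) ` carrier D)))"

definition nagata_ring :: "('a, 'b) ring_scheme \<Rightarrow> bool" where
  "nagata_ring R \<longleftrightarrow> noetherian_ring R \<and> (\<forall>P. primeideal P R \<longrightarrow> japanese (R Quot P))"

end

theory Submission
  imports Defs
begin

text \<open>
  Write q = p^e. Let x/1 be in the tight closure of I R_W, so that c w_q x^q is in I^[q] for large q,
  with w_q in W depending on q. Put b = (I* : x) and choose w in W with (b : w) maximal.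

  Suppose that every prime containing b and disjoint from W is maximal. Since (b : w) is W-saturated,
  every maximal ideal above it is then disjoint from W. Some d in R^o satisfies
  d (w x y)^q in I^[q] for all y in (b : w), because (b : w) is finitely generated; so
  (I^[q] : c d (w x)^q) contains w_q and all these y^q, hence lies in no maximal ideal. Therefore
  c d (w x)^q is in I^[q] and w x is in I*.

  The supposition holds because dim R is at most 2: a non-maximal prime Q disjoint from W has height at most 1, and
  some f outside Q satisfies f x in I*. This may be tested modulo each minimal prime P below Q. In the
  fraction field of R/P, finitely generated ideals become invertible over the integral closure of the
  local ring (R/P)_Q (Krull-Akizuki), and this forces x into the extension of I to a
  finite birational extension of R/P, after multiplication by some f outside Q.
\<close>

section \<open>Noetherian rings\<close>

text \<open>The difficulty with w_q is that tight closure permits one fixed multiplier, while no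
  fixed element of W need be a common multiple of all the w_q.

  At a non-maximal prime Q the integral closure of (R/P)_Q may fail to be a finite module, so it is
  never formed. It is replaced by almost integrality with explicit denominators: c (f s)^n lies in
  R/P for all n, with f outside Q. This condition already has the shape of the tight closure
  condition, and finitely many elements always admit a common c and f.

  Invertibility matters because it allows I to be cancelled. If 1 = sum h_i a_i with a_i generators
  of I and h_i in its fractional inverse, then x = sum (h_i x) a_i, and the tight closure condition
  on x makes every h_i x almost integral.

  A smaller obstacle is that c is the numerator of an element of the localization and may lie in
  minimal primes of R that meet W.\<close>

locale noetherian_cring = cring R + noetherian_ring R for R (structure)

lemma (in cring) cidealI:
  assumes "J \<subseteq> carrier R" "\<zero> \<in> J"
    and "\<And>a b. a \<in> J \<Longrightarrow> b \<in> J \<Longrightarrow> a \<oplus> b \<in> J"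
    and "\<And>r a. r \<in> carrier R \<Longrightarrow> a \<in> J \<Longrightarrow> r \<otimes> a \<in> J"
  shows "ideal J R"
proof (rule idealI)
  show "ring R" by (rule ring_axioms)
  show "subgroup J (add_monoid R)"
  proof (rule add.subgroupI)
    fix a assume "a \<in> J"
    then have "(\<ominus> \<one>) \<otimes> a \<in> J" using assms(4) by simp
    moreover have "(\<ominus> \<one>) \<otimes> a = \<ominus> a" using \<open>a \<in> J\<close> assms(1) by (auto simp: l_minus)
    ultimately show "\<ominus> a \<in> J" by simp
  qed (use assms in auto)
next
  fix a x assume "a \<in> J" "x \<in> carrier R"
  then show "x \<otimes> a \<in> J" "a \<otimes> x \<in> J"
    using assms(1) assms(4)[of x a] m_comm[of a x] by auto
qed

lemma (in ideal) minus_mem: "a \<in> I \<Longrightarrow> b \<in> I \<Longrightarrow> a \<ominus> b \<in> I"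
  by (simp add: a_minus_def)

definition colon :: "('a, 'b) ring_scheme \<Rightarrow> 'a set \<Rightarrow> 'a \<Rightarrow> 'a set" where
  "colon R J x = {r \<in> carrier R. r \<otimes>\<^bsub>R\<^esub> x \<in> J}"

definition adjoin :: "('a, 'b) ring_scheme \<Rightarrow> 'a set \<Rightarrow> 'a \<Rightarrow> 'a set" where
  "adjoin R J x = {j \<oplus>\<^bsub>R\<^esub> (r \<otimes>\<^bsub>R\<^esub> x) | j r. j \<in> J \<and> r \<in> carrier R}"

context cring
begin

lemma ideal_subset: "ideal J R \<Longrightarrow> J \<subseteq> carrier R"
  by (auto dest: ideal.Icarr)

lemma ideal_add: "ideal J R \<Longrightarrow> a \<in> J \<Longrightarrow> b \<in> J \<Longrightarrow> a \<oplus> b \<in> J"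
  by (rule additive_subgroup.a_closed[OF ideal.axioms(1)])

lemma ideal_minus: "ideal J R \<Longrightarrow> a \<in> J \<Longrightarrow> b \<in> J \<Longrightarrow> a \<ominus> b \<in> J"
  by (rule ideal.minus_mem)

lemma ideal_zero: "ideal J R \<Longrightarrow> \<zero> \<in> J"
  by (rule additive_subgroup.zero_closed[OF ideal.axioms(1)])

lemma ideal_mult_l: "ideal J R \<Longrightarrow> a \<in> J \<Longrightarrow> r \<in> carrier R \<Longrightarrow> r \<otimes> a \<in> J"
  by (rule ideal.I_l_closed)

lemma ideal_mult_r: "ideal J R \<Longrightarrow> a \<in> J \<Longrightarrow> r \<in> carrier R \<Longrightarrow> a \<otimes> r \<in> J"
  by (rule ideal.I_r_closed)

lemma primeideal_ideal: "primeideal P R \<Longrightarrow> ideal P R"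
  by (rule primeideal.axioms(1))

lemma prime_mult_notin:
  "primeideal P R \<Longrightarrow> a \<in> carrier R \<Longrightarrow> b \<in> carrier R \<Longrightarrow> a \<notin> P \<Longrightarrow> b \<notin> P \<Longrightarrow> a \<otimes> b \<notin> P"
  by (auto dest: primeideal.I_prime)

lemma prime_one_notin: "primeideal P R \<Longrightarrow> \<one> \<notin> P"
  by (metis primeideal.I_notcarr ideal.one_imp_carrier primeideal_ideal)

lemma prime_pow_notin:
  "primeideal P R \<Longrightarrow> a \<in> carrier R \<Longrightarrow> a \<notin> P \<Longrightarrow> a [^] (n::nat) \<notin> P"
  by (induction n) (simp_all add: prime_one_notin prime_mult_notin)

lemma ideal_pow_mem:
  assumes "ideal J R" "a \<in> J" "0 < n" shows "a [^] (n::nat) \<in> J"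
proof -
  obtain m where "n = Suc m" using assms(3) gr0_implies_Suc by blast
  then show ?thesis using assms ideal_subset ideal_mult_l[OF assms(1,2), of "a [^] m"] by auto
qed

lemma prime_mult_system: "primeideal P R \<Longrightarrow> mult_system R (carrier R - P)"
  unfolding mult_system_def using prime_one_notin prime_mult_notin by auto

lemma colon_ideal:
  assumes "ideal J R" "x \<in> carrier R" shows "ideal (colon R J x) R"
proof (rule cidealI)
  show "\<zero> \<in> colon R J x" using assms by (simp add: colon_def ideal_zero)
  show "a \<oplus> b \<in> colon R J x" if "a \<in> colon R J x" "b \<in> colon R J x" for a b
    using that assms by (auto simp: colon_def l_distr ideal_add)
  show "r \<otimes> a \<in> colon R J x" if "r \<in> carrier R" "a \<in> colon R J x" for r a
    using that assms by (auto simp: colon_def m_assoc ideal_mult_l)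
qed (auto simp: colon_def)

lemma colon_superset: "ideal J R \<Longrightarrow> x \<in> carrier R \<Longrightarrow> J \<subseteq> colon R J x"
  unfolding colon_def using ideal_subset by (auto intro: ideal_mult_r)

lemma adjoin_ideal:
  assumes J: "ideal J R" and x: "x \<in> carrier R" shows "ideal (adjoin R J x) R"
proof (rule cidealI)
  note c = subsetD[OF ideal_subset[OF J]]
  show "adjoin R J x \<subseteq> carrier R" using x c by (auto simp: adjoin_def)
  have "\<zero> = \<zero> \<oplus> \<zero> \<otimes> x" using x by simp
  then show "\<zero> \<in> adjoin R J x" unfolding adjoin_def using ideal_zero[OF J] by blast
  show "a \<oplus> b \<in> adjoin R J x" if H: "a \<in> adjoin R J x" "b \<in> adjoin R J x" for a b
  proof -
    obtain j r j' r' where *: "a = j \<oplus> r \<otimes> x" "b = j' \<oplus> r' \<otimes> x" "j \<in> J" "j' \<in> J"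
      "r \<in> carrier R" "r' \<in> carrier R" using H unfolding adjoin_def by blast
    then have "a \<oplus> b = (j \<oplus> j') \<oplus> (r \<oplus> r') \<otimes> x"
      using x c by (simp add: cring_simprules)
    then show ?thesis unfolding adjoin_def using * ideal_add[OF J] by blast
  qed
  show "s \<otimes> a \<in> adjoin R J x" if H: "s \<in> carrier R" "a \<in> adjoin R J x" for s a
  proof -
    obtain j r where *: "a = j \<oplus> r \<otimes> x" "j \<in> J" "r \<in> carrier R"
      using H unfolding adjoin_def by blast
    then have "s \<otimes> a = s \<otimes> j \<oplus> (s \<otimes> r) \<otimes> x"
      using x c H by (simp add: cring_simprules)
    then show ?thesis unfolding adjoin_def using * ideal_mult_l[OF J] H by blast
  qed
qed

lemma adjoin_superset:
  assumes "ideal J R" "x \<in> carrier R" shows "J \<subseteq> adjoin R J x"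
proof
  fix j assume "j \<in> J"
  then have "j = j \<oplus> \<zero> \<otimes> x" using assms ideal_subset[OF assms(1)] by auto
  then show "j \<in> adjoin R J x" unfolding adjoin_def using \<open>j \<in> J\<close> by blast
qed

lemma adjoin_self:
  assumes "ideal J R" "x \<in> carrier R" shows "x \<in> adjoin R J x"
proof -
  have "x = \<zero> \<oplus> \<one> \<otimes> x" using assms by simp
  then show ?thesis unfolding adjoin_def using ideal_zero[OF assms(1)] by blast
qed

text \<open>Multiply together one element of S from each ideal. Two choices of S matter: the
  complement of a minimal prime, which gives an element outside it and inside all other minimal
  primes, and W itself, which gives an element of W inside every minimal prime that meets W.\<close>

lemma mult_system_common:
  assumes S: "mult_system R S" and "finite F" and "\<And>J. J \<in> F \<Longrightarrow> ideal J R" and "\<And>J. J \<in> F \<Longrightarrow> J \<inter> S \<noteq> {}"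
  shows "\<exists>s \<in> S. \<forall>J \<in> F. s \<in> J"
  using assms(2-4)
proof (induction F rule: finite_induct)
  case empty
  then show ?case using S by (auto simp: mult_system_def)
next
  case (insert J F)
  have "\<exists>s \<in> S. \<forall>J \<in> F. s \<in> J" by (rule insert.IH) (use insert.prems in auto)
  moreover have "J \<inter> S \<noteq> {}" using insert.prems(2) by auto
  ultimately obtain s t where st: "s \<in> S" "\<forall>J \<in> F. s \<in> J" "t \<in> S" "t \<in> J" by blast
  have c: "s \<in> carrier R" "t \<in> carrier R" using st S by (auto simp: mult_system_def)
  have "s \<otimes> t \<in> S" using st S by (auto simp: mult_system_def)
  moreover have "\<forall>J \<in> insert J F. s \<otimes> t \<in> J"
    using st c insert.prems(1) by (auto intro: ideal_mult_l ideal_mult_r)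
  ultimately show ?case by blast
qed

end

section \<open>Noetherian induction, existence of primes, and minimal primes\<close>

context noetherian_cring
begin

text \<open>In a Noetherian ring the union of a nonempty chain of ideals is a member of the chain.
  Zorn's lemma therefore applies to an arbitrary predicate \<open>Pr\<close>, whose stability under
  unions need not be checked.\<close>

lemma maximal_ideal_with:
  assumes "ideal J0 R" "Pr J0"
  shows "\<exists>J. ideal J R \<and> Pr J \<and> J0 \<subseteq> J \<and> (\<forall>J'. ideal J' R \<longrightarrow> Pr J' \<longrightarrow> J \<subseteq> J' \<longrightarrow> J' = J)"
proof -
  let ?A = "{J. ideal J R \<and> Pr J \<and> J0 \<subseteq> J}"
  have "\<exists>M\<in>?A. \<forall>Z\<in>?A. M \<subseteq> Z \<longrightarrow> Z = M"
  proof (rule subset_Zorn_nonempty)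
    show "?A \<noteq> {}" using assms by auto
    fix C assume C: "C \<noteq> {}" "subset.chain ?A C"
    then have "subset.chain {I. ideal I R} C"
      by (auto simp: pred_on.chain_def)
    then have "\<Union>C \<in> C" using ideal_chain_is_trivial C(1) by auto
    then show "\<Union>C \<in> ?A" using C(2) by (auto simp: pred_on.chain_def)
  qed
  then obtain M where M: "M \<in> ?A" "\<forall>Z\<in>?A. M \<subseteq> Z \<longrightarrow> Z = M" by auto
  then show ?thesis by (intro exI[of _ M]) auto
qed

lemma ideal_induct [consumes 1, case_names step]:
  assumes "ideal J R" and "\<And>J. ideal J R \<Longrightarrow> (\<And>J'. ideal J' R \<Longrightarrow> J \<subset> J' \<Longrightarrow> Pr J') \<Longrightarrow> Pr J"
  shows "Pr J"
proof (rule ccontr)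
  assume "\<not> Pr J"
  then obtain M where M: "ideal M R" "\<not> Pr M" "\<forall>J'. ideal J' R \<longrightarrow> \<not> Pr J' \<longrightarrow> M \<subseteq> J' \<longrightarrow> J' = M"
    using maximal_ideal_with[of J "\<lambda>J. \<not> Pr J"] assms(1) by auto
  have "Pr M" by (rule assms(2)[OF M(1)]) (use M(3) in auto)
  then show False using M(2) by simp
qed

lemma ascending_ideals_stabilise:
  fixes Y :: "nat \<Rightarrow> 'a set"
  assumes "\<And>n. ideal (Y n) R" and "\<And>n. Y n \<subseteq> Y (Suc n)"
  shows "\<exists>k. \<forall>n. Y n \<subseteq> Y k"
proof -
  have mono: "Y i \<subseteq> Y j" if "i \<le> j" for i j using lift_Suc_mono_le[of Y, OF assms(2) that] .
  obtain J where J: "J \<in> range Y" "\<forall>J'. ideal J' R \<longrightarrow> J' \<in> range Y \<longrightarrow> J \<subseteq> J' \<longrightarrow> J' = J"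
    using maximal_ideal_with[of "Y 0" "\<lambda>J. J \<in> range Y"] assms(1) by auto
  then obtain k where k: "J = Y k" by auto
  have "Y n \<subseteq> Y k" for n
    using J(2)[rule_format, of "Y (max n k)"] assms(1) mono[of k "max n k"] mono[of n "max n k"] k by auto
  then show ?thesis by auto
qed

text \<open>This is the source of progress in the arguments by maximality below: J + Rx, J + Ry and
  (J : x) are all strictly larger than J, the last one because it contains y.\<close>

lemma not_prime_split:
  assumes "ideal J R" "J \<noteq> carrier R" "\<not> primeideal J R"
  obtains x y where "x \<in> carrier R" "y \<in> carrier R" "x \<notin> J" "y \<notin> J" "x \<otimes> y \<in> J"
  using primeidealI[of J R] assms is_cring by metis

text \<open>An ideal P maximal among those disjoint from S is prime: if x y \<in> P with x and y
  outside P, then P + Rx and P + Ry both meet S, and the product of two such elements of S lies in P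
  + Rxy, that is, in P.\<close>

lemma prime_avoiding:
  assumes J: "ideal J R" and S: "mult_system R S" and disj: "J \<inter> S = {}"
  obtains P where "primeideal P R" "J \<subseteq> P" "P \<inter> S = {}"
proof -
  obtain P where P: "ideal P R" "P \<inter> S = {}" "J \<subseteq> P"
    "\<forall>J'. ideal J' R \<longrightarrow> J' \<inter> S = {} \<longrightarrow> P \<subseteq> J' \<longrightarrow> J' = P"
    using maximal_ideal_with[of J "\<lambda>J. J \<inter> S = {}"] J disj by auto
  have SR: "S \<subseteq> carrier R" "\<one> \<in> S" "\<And>a b. a \<in> S \<Longrightarrow> b \<in> S \<Longrightarrow> a \<otimes> b \<in> S"
    using S by (auto simp: mult_system_def)
  have "primeideal P R"
  proof (rule ccontr)
    assume np: "\<not> primeideal P R"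
    have "P \<noteq> carrier R" using P(2) SR by auto
    then obtain x y where xy: "x \<in> carrier R" "y \<in> carrier R" "x \<notin> P" "y \<notin> P" "x \<otimes> y \<in> P"
      using not_prime_split P(1) np by blast
    have "\<exists>s \<in> S. s \<in> adjoin R P z" if "z \<in> carrier R" "z \<notin> P" for z
      using P(4)[rule_format, of "adjoin R P z"] adjoin_ideal[OF P(1) that(1)] adjoin_superset[OF P(1) that(1)]
        adjoin_self[OF P(1) that(1)] that(2) by blast
    then obtain s t where st: "s \<in> S" "t \<in> S" "s \<in> adjoin R P x" "t \<in> adjoin R P y" using xy by meson
    then obtain i r j u where *: "s = i \<oplus> r \<otimes> x" "t = j \<oplus> u \<otimes> y" "i \<in> P" "j \<in> P" "r \<in> carrier R" "u \<in> carrier R"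
      by (auto simp: adjoin_def)
    note c = subsetD[OF ideal_subset[OF P(1)]]
    have "s \<otimes> t = i \<otimes> (j \<oplus> u \<otimes> y) \<oplus> (r \<otimes> x) \<otimes> j \<oplus> (r \<otimes> u) \<otimes> (x \<otimes> y)"
      unfolding * using *(3-6) xy(1,2) c by (simp add: cring_simprules)
    also have "\<dots> \<in> P"
      by (rule ideal_add[OF P(1) ideal_add[OF P(1) ideal_mult_r[OF P(1) *(3)] ideal_mult_l[OF P(1) *(4)]]
          ideal_mult_l[OF P(1) xy(5)]]) (use * xy c in simp_all)
    finally show False using SR(3)[OF st(1,2)] P(2) by blast
  qed
  then show thesis using P by (intro that[of P]) auto
qed

lemma proper_ideal_in_maximal:
  assumes J: "ideal J R" and "J \<noteq> carrier R"
  obtains M where "maximalideal M R" "J \<subseteq> M"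
proof -
  obtain M where M: "ideal M R" "M \<noteq> carrier R" "J \<subseteq> M"
    "\<forall>J'. ideal J' R \<longrightarrow> J' \<noteq> carrier R \<longrightarrow> M \<subseteq> J' \<longrightarrow> J' = M"
    using maximal_ideal_with[of J "\<lambda>J. J \<noteq> carrier R"] assms by auto
  then have "maximalideal M R" by (intro maximalidealI) auto
  then show thesis using that M(3) by simp
qed

text \<open>If x y \<in> J, then a prime above J contains x or y, so the families for J + Rx and J +
  Ry may be united. F may contain more than the minimal primes above J; only its finiteness and its
  having a member below each prime above J are claimed.\<close>

lemma finite_primes_below:
  assumes "ideal J R"
  shows "\<exists>F. finite F \<and> (\<forall>P \<in> F. primeideal P R) \<and> (\<forall>Q. primeideal Q R \<longrightarrow> J \<subseteq> Q \<longrightarrow> (\<exists>P \<in> F. P \<subseteq> Q))"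
  using assms
proof (induction rule: ideal_induct)
  case (step J)
  show ?case
  proof (cases "J = carrier R \<or> primeideal J R")
    case True
    then show ?thesis
    proof
      assume "J = carrier R"
      then have "\<not> J \<subseteq> Q" if "primeideal Q R" for Q
        using prime_one_notin[OF that] by auto
      then show ?thesis by (intro exI[of _ "{}"]) auto
    next
      assume "primeideal J R"
      then show ?thesis by (intro exI[of _ "{J}"]) auto
    qed
  next
    case False
    then obtain x y where xy: "x \<in> carrier R" "y \<in> carrier R" "x \<notin> J" "y \<notin> J" "x \<otimes> y \<in> J"
      using not_prime_split step.hyps by blast
    have "\<exists>F. finite F \<and> (\<forall>P \<in> F. primeideal P R) \<and> (\<forall>Q. primeideal Q R \<longrightarrow> adjoin R J z \<subseteq> Q \<longrightarrow> (\<exists>P \<in> F. P \<subseteq> Q))"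
      if "z \<in> carrier R" "z \<notin> J" for z
      using step.IH[of "adjoin R J z"] adjoin_ideal[OF step.hyps that(1)] adjoin_superset[OF step.hyps that(1)]
        adjoin_self[OF step.hyps that(1)] that(2) by blast
    note ex = this
    obtain F where F: "finite F" "\<forall>P \<in> F. primeideal P R" "\<forall>Q. primeideal Q R \<longrightarrow> adjoin R J x \<subseteq> Q \<longrightarrow> (\<exists>P \<in> F. P \<subseteq> Q)"
      using ex[OF xy(1,3)] by auto
    obtain G where G: "finite G" "\<forall>P \<in> G. primeideal P R" "\<forall>Q. primeideal Q R \<longrightarrow> adjoin R J y \<subseteq> Q \<longrightarrow> (\<exists>P \<in> G. P \<subseteq> Q)"
      using ex[OF xy(2,4)] by auto
    have sub: "adjoin R J z \<subseteq> Q" if "primeideal Q R" "J \<subseteq> Q" "z \<in> Q" for z Q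
      unfolding adjoin_def using that primeideal_ideal by (auto intro!: ideal_add ideal_mult_l)
    have "\<exists>P \<in> F \<union> G. P \<subseteq> Q" if Q: "primeideal Q R" "J \<subseteq> Q" for Q
    proof -
      have "x \<in> Q \<or> y \<in> Q" using xy Q primeideal.I_prime[of Q R x y] by blast
      then have "adjoin R J x \<subseteq> Q \<or> adjoin R J y \<subseteq> Q" using sub[OF Q] by auto
      then show ?thesis using F(3)[rule_format, OF Q(1)] G(3)[rule_format, OF Q(1)] by blast
    qed
    then show ?thesis using F G by (intro exI[of _ "F \<union> G"]) auto
  qed
qed

text \<open>Both facts come from one finite family F with a member below every prime: a minimal
  prime must itself belong to F, and a member of F that is minimal among those inside Q is a minimal
  prime.\<close>

lemma minimal_primes:
  shows finite_minimal_primes: "finite {P. minimal_prime R P}"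
    and prime_contains_minimal: "primeideal Q R \<Longrightarrow> \<exists>P. minimal_prime R P \<and> P \<subseteq> Q"
proof -
  obtain F where F: "finite F" "\<forall>P \<in> F. primeideal P R"
      "\<forall>Q. primeideal Q R \<longrightarrow> {\<zero>} \<subseteq> Q \<longrightarrow> (\<exists>P \<in> F. P \<subseteq> Q)"
    using finite_primes_below[OF zeroideal] by auto
  have F3: "\<exists>P \<in> F. P \<subseteq> Q" if "primeideal Q R" for Q
    using F(3) ideal_zero[OF primeideal_ideal[OF that]] that by auto
  have "P \<in> F" if P: "minimal_prime R P" for P
  proof -
    obtain P' where "P' \<in> F" "P' \<subseteq> P" using F3[of P] P by (auto simp: minimal_prime_def)
    then show ?thesis using P F(2) by (auto simp: minimal_prime_def)
  qed
  then have "{P. minimal_prime R P} \<subseteq> F" by auto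
  then show "finite {P. minimal_prime R P}" using F(1) finite_subset by auto
  assume Q: "primeideal Q R"
  let ?G = "{P \<in> F. P \<subseteq> Q}"
  have "finite ?G" "?G \<noteq> {}" using F(1) F3[OF Q] by auto
  then obtain P where P: "P \<in> ?G" "\<And>P'. P' \<in> ?G \<Longrightarrow> P' \<subseteq> P \<Longrightarrow> P' = P"
    using finite_has_minimal[of ?G] by metis
  have "minimal_prime R P" unfolding minimal_prime_def
  proof (intro conjI allI impI)
    show "primeideal P R" using P(1) F(2) by auto
    fix Q' assume Q': "primeideal Q' R \<and> Q' \<subseteq> P"
    then obtain P' where "P' \<in> F" "P' \<subseteq> Q'" using F3[of Q'] by auto
    then show "Q' = P" using P(1) P(2)[of P'] Q' by auto
  qed
  then show "\<exists>P. minimal_prime R P \<and> P \<subseteq> Q" using P(1) by auto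
qed

text \<open>Descending chain condition for the ideals of the localization of R/J at Q, when Q is the
  only prime between J and Q: a largest J violating it would be prime, hence equal to Q.\<close>

lemma descending_chain_locally_stable:
  fixes Y :: "nat \<Rightarrow> 'a set"
  assumes Q: "primeideal Q R" and "ideal J R"
    and "\<And>Q'. primeideal Q' R \<Longrightarrow> J \<subseteq> Q' \<Longrightarrow> Q' \<subseteq> Q \<Longrightarrow> Q' = Q"
    and "\<And>n. ideal (Y n) R" "\<And>n. Y (Suc n) \<subseteq> Y n" "\<And>n. J \<subseteq> Y n"
  shows "\<exists>k. \<forall>n\<ge>k. \<forall>g \<in> Y n. \<exists>t \<in> carrier R - Q. t \<otimes> g \<in> Y (Suc n)"
  using assms(2-)
proof (induction arbitrary: Y rule: ideal_induct)
  case (step J)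
  note Y = step.prems(2-4)
  have c: "g \<in> carrier R" if "g \<in> Y n" for g n using ideal_subset[OF Y(1)] that by blast
  have mono: "Y n \<subseteq> Y m" if "m \<le> n" for n m using lift_Suc_antimono_le[of Y, OF Y(2) that] .
  have Qsub: "ideal Q R" "\<one> \<in> carrier R - Q" using Q primeideal_ideal prime_one_notin by auto
  \<comment> \<open>When no Y n lies in Q, an element of Y (Suc n) outside Q is a multiplier t at
    once.\<close>
  have fromY: ?case if *: "\<And>n. \<not> Y n \<subseteq> Q"
  proof (intro exI[of _ 0] allI impI ballI)
    fix n g assume g: "g \<in> Y n"
    obtain t where t: "t \<in> Y (Suc n)" "t \<notin> Q" using *[of "Suc n"] by auto
    have "t \<otimes> g \<in> Y (Suc n)" using ideal_mult_r[OF Y(1) t(1) c[OF g]] .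
    then show "\<exists>t \<in> carrier R - Q. t \<otimes> g \<in> Y (Suc n)" using t(2) c[OF t(1)] by auto
  qed
  show ?case
  proof (cases "J \<subseteq> Q")
    case False
    then show ?thesis by (intro fromY) (use Y(3) in auto)
  next
    case JQ: True
    show ?thesis
    proof (cases "primeideal J R")
      case True
      then have JQ: "J = Q" using step.prems(1)[of J] JQ by auto
      show ?thesis
      proof (cases "\<exists>k. Y k \<subseteq> Q")
        case True
        then obtain k where k: "Y k \<subseteq> Q" by blast
        have "Y n = Q" if "n \<ge> k" for n using k mono[OF that] Y(3) JQ by blast
        then have "\<one> \<otimes> g \<in> Y (Suc n)" if "n \<ge> k" "g \<in> Y n" for n g
          using that c[OF that(2)] le_SucI[OF that(1)] by auto
        then show ?thesis using Qsub(2) by (intro exI[of _ k]) auto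
      next
        case False
        then show ?thesis by (intro fromY) auto
      qed
    next
      case False
      then obtain x y where xy: "x \<in> carrier R" "y \<in> carrier R" "x \<notin> J" "y \<notin> J" "x \<otimes> y \<in> J"
        by (rule not_prime_split[OF step.hyps, rotated]) (use JQ Qsub in auto)
      \<comment> \<open>The hypothesis on primes between J and Q is inherited by the larger ideals J
        + Rx and (J : x); the induction hypothesis is applied to the chains Y n + Rx and (Y n : x)
        above them.\<close>
      have "\<exists>k. \<forall>n\<ge>k. \<forall>g \<in> adjoin R (Y n) x. \<exists>t \<in> carrier R - Q. t \<otimes> g \<in> adjoin R (Y (Suc n)) x"
      proof (rule step.IH)
        show "ideal (adjoin R J x) R" "J \<subset> adjoin R J x"
          using adjoin_ideal[OF step.hyps xy(1)] adjoin_superset[OF step.hyps xy(1)]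
            adjoin_self[OF step.hyps xy(1)] xy(3) by auto
        then show "Q' = Q" if "primeideal Q' R" "adjoin R J x \<subseteq> Q'" "Q' \<subseteq> Q" for Q'
          using that step.prems(1)[of Q'] by auto
        fix n
        show "ideal (adjoin R (Y n) x) R" by (rule adjoin_ideal[OF Y(1) xy(1)])
        show "adjoin R (Y (Suc n)) x \<subseteq> adjoin R (Y n) x" "adjoin R J x \<subseteq> adjoin R (Y n) x"
          using Y(2,3)[of n] unfolding adjoin_def by blast+
      qed
      moreover have "\<exists>k. \<forall>n\<ge>k. \<forall>g \<in> colon R (Y n) x. \<exists>t \<in> carrier R - Q. t \<otimes> g \<in> colon R (Y (Suc n)) x"
      proof (rule step.IH)
        have "y \<in> colon R J x" using xy m_comm by (simp add: colon_def)
        then show "ideal (colon R J x) R" "J \<subset> colon R J x"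
          using colon_ideal[OF step.hyps xy(1)] colon_superset[OF step.hyps xy(1)] xy(4) by auto
        then show "Q' = Q" if "primeideal Q' R" "colon R J x \<subseteq> Q'" "Q' \<subseteq> Q" for Q'
          using that step.prems(1)[of Q'] by auto
        fix n
        show "ideal (colon R (Y n) x) R" by (rule colon_ideal[OF Y(1) xy(1)])
        show "colon R (Y (Suc n)) x \<subseteq> colon R (Y n) x" "colon R J x \<subseteq> colon R (Y n) x"
          using Y(2,3)[of n] unfolding colon_def by blast+
      qed
      ultimately obtain k l where
        k: "\<And>n g. n \<ge> k \<Longrightarrow> g \<in> adjoin R (Y n) x \<Longrightarrow> \<exists>t \<in> carrier R - Q. t \<otimes> g \<in> adjoin R (Y (Suc n)) x"
        and l: "\<And>n g. n \<ge> l \<Longrightarrow> g \<in> colon R (Y n) x \<Longrightarrow> \<exists>t \<in> carrier R - Q. t \<otimes> g \<in> colon R (Y (Suc n)) x"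
        by metis
      show ?thesis
      proof (intro exI[of _ "max k l"] allI impI ballI)
        fix n g assume n: "max k l \<le> n" and g: "g \<in> Y n"
        \<comment> \<open>Stability of both derived chains gives that of Y. From t g = h + r x with
          h in Y (Suc n) it follows that r x = t g - h lies in Y n, so r is in (Y n : x), and a
          further multiplier u moves it into (Y (Suc n) : x). This is additivity of length along
          multiplication by x, carried out on elements.\<close>
        have "g \<in> adjoin R (Y n) x" using g adjoin_superset[OF Y(1) xy(1)] by blast
        then obtain t where t: "t \<in> carrier R - Q" "t \<otimes> g \<in> adjoin R (Y (Suc n)) x" using k[of n g] n by auto
        then obtain h r where hr: "t \<otimes> g = h \<oplus> r \<otimes> x" "h \<in> Y (Suc n)" "r \<in> carrier R" by (auto simp: adjoin_def)
        have "r \<otimes> x = t \<otimes> g \<ominus> h"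
          using hr c[OF hr(2)] c[OF g] xy t by (simp add: cring_simprules)
        also have "\<dots> \<in> Y n" using t g hr(2) Y(2)[of n]
          by (intro ideal_minus[OF Y(1)] ideal_mult_l[OF Y(1)]) auto
        finally have "r \<in> colon R (Y n) x" using hr by (simp add: colon_def)
        then obtain u where u: "u \<in> carrier R - Q" "u \<otimes> r \<in> colon R (Y (Suc n)) x" using l[of n r] n by auto
        have "(u \<otimes> t) \<otimes> g = u \<otimes> (h \<oplus> r \<otimes> x)" using hr(1) u t c[OF g] by (simp add: m_assoc)
        also have "\<dots> = u \<otimes> h \<oplus> (u \<otimes> r) \<otimes> x" using u hr c[OF hr(2)] xy by (simp add: cring_simprules)
        also have "\<dots> \<in> Y (Suc n)"
          by (rule ideal_add[OF Y(1) ideal_mult_l[OF Y(1) hr(2)]]) (use u in \<open>simp_all add: colon_def\<close>)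
        finally show "\<exists>t \<in> carrier R - Q. t \<otimes> g \<in> Y (Suc n)"
          using prime_mult_notin[OF Q] u t by (intro bexI[of _ "u \<otimes> t"]) auto
      qed
    qed
  qed
qed

end

section \<open>Frobenius powers and tight closure\<close>

context cring
begin

lemma binomial_expansion:
  assumes x: "x \<in> carrier R" and y: "y \<in> carrier R"
  shows "(x \<oplus> y) [^] n = (\<Oplus>k\<in>{..n}. add_pow R (n choose k) (x [^] k \<otimes> y [^] (n - k)))"
proof (induction n)
  case 0
  then show ?case using x y by simp
next
  case (Suc n)
  define T where "T = (\<lambda>n k. add_pow R (n choose k) (x [^] k \<otimes> y [^] (n - k)))"
  have T: "T n k \<in> carrier R" for n k using x y by (simp add: T_def)
  \<comment> \<open>Pascal's rule. It holds for every k because the coefficients beyond the top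
    index vanish, so the boundary needs no separate recurrence.\<close>
  have step: "T (Suc n) (Suc k) = x \<otimes> T n k \<oplus> y \<otimes> T n (Suc k)" for k
  proof (cases "Suc k \<le> n")
    case True
    then have "n - k = Suc (n - Suc k)" by simp
    then show ?thesis using x y
      by (simp add: T_def add.nat_pow_mult[symmetric] add_pow_rdistr m_ac)
  next
    case False
    then show ?thesis using x y
      by (simp add: T_def add_pow_rdistr m_ac binomial_eq_0)
  qed
  have T0: "T (Suc n) 0 = y \<otimes> T n 0" using x y by (simp add: T_def m_comm)
  have TS: "T n (Suc n) = \<zero>" by (simp add: T_def binomial_eq_0)
  have shift: "T n 0 \<oplus> (\<Oplus>k\<in>{..n}. T n (Suc k)) = (\<Oplus>k\<in>{..n}. T n k)"
  proof -
    have "T n 0 \<oplus> (\<Oplus>k\<in>{..n}. T n (Suc k)) = (\<Oplus>k\<in>{..Suc n}. T n k)"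
      using T by (subst finsum_Suc2) (auto simp: a_comm)
    also have "\<dots> = (\<Oplus>k\<in>{..n}. T n k)" using T TS by simp
    finally show ?thesis .
  qed
  have "(\<Oplus>k\<in>{..Suc n}. T (Suc n) k) = (\<Oplus>k\<in>{..n}. T (Suc n) (Suc k)) \<oplus> T (Suc n) 0"
    using T by (subst finsum_Suc2) auto
  also have "\<dots> = (\<Oplus>k\<in>{..n}. x \<otimes> T n k \<oplus> y \<otimes> T n (Suc k)) \<oplus> y \<otimes> T n 0"
    by (simp add: step T0)
  also have "\<dots> = x \<otimes> (\<Oplus>k\<in>{..n}. T n k) \<oplus> y \<otimes> (\<Oplus>k\<in>{..n}. T n (Suc k)) \<oplus> y \<otimes> T n 0"
    using T x y by (simp add: finsum_addf finsum_rdistr)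
  also have "\<dots> = x \<otimes> (\<Oplus>k\<in>{..n}. T n k) \<oplus> y \<otimes> (T n 0 \<oplus> (\<Oplus>k\<in>{..n}. T n (Suc k)))"
    using T x y by (simp add: r_distr a_ac)
  also have "\<dots> = (x \<oplus> y) \<otimes> (\<Oplus>k\<in>{..n}. T n k)"
    using T x y by (simp add: shift l_distr)
  finally show ?case using Suc x y T by (simp add: T_def m_comm)
qed

end

locale prime_char = cring R for R (structure) +
  fixes p :: nat
  assumes char: "char_p R p"
begin

lemma p_prime: "Factorial_Ring.prime p" using char by (simp add: char_p_def)

lemma p_pos: "0 < p ^ e" using p_prime by (simp add: prime_gt_0_nat)

lemma p_mult_zero: assumes "z \<in> carrier R" "p dvd m" shows "add_pow R m z = \<zero>"
proof -
  obtain k where k: "m = p * k" using assms(2) by blast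
  have "add_pow R p w = \<zero>" if "w \<in> carrier R" for w
  proof -
    have "add_pow R p w = (add_pow R p \<one>) \<otimes> w" using that by (simp add: add_pow_ldistr)
    then show ?thesis using that char by (simp add: char_p_def)
  qed
  then show ?thesis using assms(1) k add.nat_pow_pow[of z k p] by (simp add: mult.commute)
qed

lemma frobenius_add_p:
  assumes x: "x \<in> carrier R" and y: "y \<in> carrier R"
  shows "(x \<oplus> y) [^] p = x [^] p \<oplus> y [^] p"
proof -
  define T where "T = (\<lambda>k. add_pow R (p choose k) (x [^] k \<otimes> y [^] (p - k)))"
  have T: "T k \<in> carrier R" for k using x y by (simp add: T_def)
  have "p \<ge> 2" using p_prime by (rule prime_ge_2_nat)
  \<comment> \<open>The inner indices, where p divides the binomial coefficient, are the Suc k with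
    k \<le> m; the indices 0 and Suc (Suc m) = p remain.\<close>
  define m where "m = p - 2"
  have m: "p = Suc (Suc m)" using \<open>p \<ge> 2\<close> by (simp add: m_def)
  have z: "T (Suc k) = \<zero>" if "k \<le> m" for k
    unfolding T_def
  proof (rule p_mult_zero)
    show "p dvd (p choose Suc k)" by (rule dvd_choose_prime) (use that m p_prime in auto)
  qed (use x y in simp)
  have "(x \<oplus> y) [^] p = (\<Oplus>k\<in>{..Suc (Suc m)}. T k)"
    using binomial_expansion[OF x y, of p] m by (simp add: T_def)
  also have "\<dots> = T (Suc (Suc m)) \<oplus> (\<Oplus>k\<in>{..Suc m}. T k)" using T by (subst finsum_Suc) auto
  also have "(\<Oplus>k\<in>{..Suc m}. T k) = (\<Oplus>k\<in>{..m}. T (Suc k)) \<oplus> T 0" using T by (subst finsum_Suc2) auto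
  also have "(\<Oplus>k\<in>{..m}. T (Suc k)) = \<zero>"
    using z by (intro add.finprod_one_eqI) auto
  finally show ?thesis using T x y by (simp add: T_def m)
qed

lemma frobenius_add:
  assumes x: "x \<in> carrier R" and y: "y \<in> carrier R"
  shows "(x \<oplus> y) [^] (p ^ e) = x [^] (p ^ e) \<oplus> y [^] (p ^ e)"
proof (induction e)
  case 0
  then show ?case using x y by simp
next
  case (Suc e)
  have *: "z [^] (p ^ Suc e) = (z [^] (p ^ e)) [^] p" if "z \<in> carrier R" for z
    using that by (simp add: nat_pow_pow mult.commute)
  show ?case using x y Suc frobenius_add_p[of "x [^] (p ^ e)" "y [^] (p ^ e)"] by (simp add: * del: power_Suc)
qed

lemma frobenius_minus:
  assumes x: "x \<in> carrier R" and y: "y \<in> carrier R"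
  shows "(x \<ominus> y) [^] (p ^ e) = x [^] (p ^ e) \<ominus> y [^] (p ^ e)"
proof -
  have "x [^] (p ^ e) = ((x \<ominus> y) \<oplus> y) [^] (p ^ e)" using x y by (simp add: cring_simprules)
  also have "\<dots> = (x \<ominus> y) [^] (p ^ e) \<oplus> y [^] (p ^ e)" using x y by (intro frobenius_add) auto
  finally show ?thesis using x y by (simp add: a_minus_def a_assoc r_neg)
qed

text \<open>Additivity of Frobenius turns a condition on q-th powers, imposed for all exponents in E
  at once, into an ideal, so that the condition has to be checked on generators only.\<close>

lemma frobenius_preimage_ideal:
  assumes "\<And>e. e \<in> E \<Longrightarrow> c e \<in> carrier R" and F: "\<And>e. e \<in> E \<Longrightarrow> ideal (F e) R"
  shows "ideal {y \<in> carrier R. \<forall>e\<in>E. c e \<otimes> y [^] (p ^ e) \<in> F e} R"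
proof (rule cidealI)
  show "\<zero> \<in> {y \<in> carrier R. \<forall>e\<in>E. c e \<otimes> y [^] (p ^ e) \<in> F e}"
    using assms p_pos F by (auto simp: nat_pow_zero ideal_zero neq0_conv)
  fix a b assume "a \<in> {y \<in> carrier R. \<forall>e\<in>E. c e \<otimes> y [^] (p ^ e) \<in> F e}" "b \<in> {y \<in> carrier R. \<forall>e\<in>E. c e \<otimes> y [^] (p ^ e) \<in> F e}"
  then show "a \<oplus> b \<in> {y \<in> carrier R. \<forall>e\<in>E. c e \<otimes> y [^] (p ^ e) \<in> F e}"
    using assms F by (auto simp: frobenius_add r_distr ideal_add)
next
  fix r a assume *: "r \<in> carrier R" "a \<in> {y \<in> carrier R. \<forall>e\<in>E. c e \<otimes> y [^] (p ^ e) \<in> F e}"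
  have "c e \<otimes> (r \<otimes> a) [^] (p ^ e) = r [^] (p ^ e) \<otimes> (c e \<otimes> a [^] (p ^ e))" if "e \<in> E" for e
    using * that assms by (simp add: nat_pow_distrib m_ac)
  then show "r \<otimes> a \<in> {y \<in> carrier R. \<forall>e\<in>E. c e \<otimes> y [^] (p ^ e) \<in> F e}"
    using * F by (auto intro: ideal_mult_l)
qed auto

lemma frob_ideal_ideal: "ideal I R \<Longrightarrow> ideal (frob_ideal R q I) R"
  unfolding frob_ideal_def using ideal_subset by (intro genideal_ideal) auto

lemma pow_mem_frob_ideal: "ideal I R \<Longrightarrow> x \<in> I \<Longrightarrow> x [^] q \<in> frob_ideal R q I"
  unfolding frob_ideal_def
  using genideal_self[of "(\<lambda>x. x [^] q) ` I"] ideal_subset[of I] by auto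

lemma frob_ideal_minimal:
  "ideal J R \<Longrightarrow> (\<And>x. x \<in> I \<Longrightarrow> x [^] q \<in> J) \<Longrightarrow> frob_ideal R q I \<subseteq> J"
  unfolding frob_ideal_def by (rule genideal_minimal) auto

text \<open>Elements whose p^k-th power lies in a given ideal form an ideal, so only the generators
  of the Frobenius power have to be raised. The lemma serves to turn a congruence modulo nilpotents
  into an equation by applying Frobenius further.\<close>

lemma frob_ideal_pow:
  assumes I: "ideal I R" and y: "y \<in> frob_ideal R (p ^ e) I"
  shows "y [^] (p ^ k) \<in> frob_ideal R (p ^ (e + k)) I"
proof -
  have id: "ideal {y \<in> carrier R. \<forall>e'\<in>{k}. \<one> \<otimes> y [^] (p ^ e') \<in> frob_ideal R (p ^ (e + k)) I} R"
    by (rule frobenius_preimage_ideal) (use frob_ideal_ideal[OF I] in auto)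
  have "frob_ideal R (p ^ e) I \<subseteq> {y \<in> carrier R. \<forall>e'\<in>{k}. \<one> \<otimes> y [^] (p ^ e') \<in> frob_ideal R (p ^ (e + k)) I}"
    by (rule frob_ideal_minimal[OF id])
      (use pow_mem_frob_ideal[OF I] ideal_subset[OF I] in \<open>auto simp: nat_pow_pow power_add subset_iff\<close>)
  then have "\<one> \<otimes> y [^] (p ^ k) \<in> frob_ideal R (p ^ (e + k)) I" "y \<in> carrier R" using y by auto
  then show ?thesis by simp
qed

end

section \<open>Elements avoiding all minimal primes, and tight closure as an ideal\<close>

context cring
begin

lemma ring_circ_iff: "c \<in> ring_circ R \<longleftrightarrow> c \<in> carrier R \<and> (\<forall>P. minimal_prime R P \<longrightarrow> c \<notin> P)"
  by (auto simp: ring_circ_def)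

lemma minimal_prime_prime: "minimal_prime R P \<Longrightarrow> primeideal P R"
  by (simp add: minimal_prime_def)

lemma ring_circ_mult: "c \<in> ring_circ R \<Longrightarrow> d \<in> ring_circ R \<Longrightarrow> c \<otimes> d \<in> ring_circ R"
  using prime_mult_notin[OF minimal_prime_prime] by (simp add: ring_circ_iff)

lemma ring_circ_one: "\<one> \<in> ring_circ R"
  by (auto simp: ring_circ_iff dest: minimal_prime_prime prime_one_notin)

lemma ring_circ_pow: "c \<in> ring_circ R \<Longrightarrow> c [^] (n::nat) \<in> ring_circ R"
  by (induction n) (simp_all add: ring_circ_one ring_circ_mult)

lemma ring_circ_closed: "c \<in> ring_circ R \<Longrightarrow> c \<in> carrier R"
  by (simp add: ring_circ_def)

end

context prime_char
begin

text \<open>Multiply the finitely many multipliers and take the largest starting exponent. For two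
  elements this yields closure of tight closure under addition; for generators of a colon ideal it
  yields the single d of the overview.\<close>

lemma tight_closure_uniform:
  assumes I: "ideal I R" and "finite A" "A \<subseteq> tight_closure R p I"
  shows "\<exists>c \<in> ring_circ R. \<exists>e0. \<forall>a \<in> A. \<forall>e\<ge>e0. c \<otimes> a [^] (p ^ e) \<in> frob_ideal R (p ^ e) I"
  using assms(2,3)
proof (induction A rule: finite_induct)
  case empty
  then show ?case using ring_circ_one by auto
next
  case (insert a A)
  then obtain c e0 where c: "c \<in> ring_circ R" "\<forall>a \<in> A. \<forall>e\<ge>e0. c \<otimes> a [^] (p ^ e) \<in> frob_ideal R (p ^ e) I" by auto
  obtain d e1 where d: "d \<in> ring_circ R" "\<forall>e\<ge>e1. d \<otimes> a [^] (p ^ e) \<in> frob_ideal R (p ^ e) I" "a \<in> carrier R"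
    using insert.prems by (auto simp: tight_closure_def)
  have A: "A \<subseteq> carrier R" using insert.prems by (auto simp: tight_closure_def)
  note cc = ring_circ_closed[OF c(1)] ring_circ_closed[OF d(1)]
  show ?case
  proof (intro bexI[of _ "c \<otimes> d"] exI[of _ "max e0 e1"] ballI allI impI)
    fix x e assume x: "x \<in> insert a A" and e: "max e0 e1 \<le> e"
    have xc: "x \<in> carrier R" using x A d by auto
    have eq: "c \<otimes> d \<otimes> x [^] (p ^ e) = d \<otimes> (c \<otimes> x [^] (p ^ e))" "c \<otimes> d \<otimes> x [^] (p ^ e) = c \<otimes> (d \<otimes> x [^] (p ^ e))"
      using xc cc by (simp_all add: m_ac)
    show "c \<otimes> d \<otimes> x [^] (p ^ e) \<in> frob_ideal R (p ^ e) I"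
    proof (cases "x = a")
      case True
      then show ?thesis using e d(2) ideal_mult_l[OF frob_ideal_ideal[OF I] _ cc(1)] by (subst eq(2)) auto
    next
      case False
      then show ?thesis using x e c(2) ideal_mult_l[OF frob_ideal_ideal[OF I] _ cc(2)] by (subst eq(1)) auto
    qed
  qed (rule ring_circ_mult[OF c(1) d(1)])
qed

lemma tight_closure_ideal:
  assumes I: "ideal I R" shows "ideal (tight_closure R p I) R"
proof (rule cidealI)
  show "tight_closure R p I \<subseteq> carrier R" by (auto simp: tight_closure_def)
  show "\<zero> \<in> tight_closure R p I"
    using p_pos ring_circ_one ideal_zero[OF frob_ideal_ideal[OF I]]
    by (auto simp: tight_closure_def nat_pow_zero neq0_conv intro!: bexI[of _ \<one>])
next
  fix a b assume ab: "a \<in> tight_closure R p I" "b \<in> tight_closure R p I"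
  then have abc: "a \<in> carrier R" "b \<in> carrier R" by (auto simp: tight_closure_def)
  obtain c e0 where c: "c \<in> ring_circ R" "\<forall>a \<in> {a, b}. \<forall>e\<ge>e0. c \<otimes> a [^] (p ^ e) \<in> frob_ideal R (p ^ e) I"
    using tight_closure_uniform[OF I, of "{a, b}"] ab by auto
  then have "\<forall>e\<ge>e0. c \<otimes> (a \<oplus> b) [^] (p ^ e) \<in> frob_ideal R (p ^ e) I"
    using abc ring_circ_closed[OF c(1)] by (auto simp: frobenius_add r_distr ideal_add[OF frob_ideal_ideal[OF I]])
  then show "a \<oplus> b \<in> tight_closure R p I" using c(1) abc by (auto simp: tight_closure_def)
next
  fix r a assume r: "r \<in> carrier R" and a: "a \<in> tight_closure R p I"
  then obtain c e0 where c: "c \<in> ring_circ R" "\<forall>e\<ge>e0. c \<otimes> a [^] (p ^ e) \<in> frob_ideal R (p ^ e) I" "a \<in> carrier R"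
    by (auto simp: tight_closure_def)
  have "c \<otimes> (r \<otimes> a) [^] (p ^ e) = r [^] (p ^ e) \<otimes> (c \<otimes> a [^] (p ^ e))" for e
    using r c(3) ring_circ_closed[OF c(1)] by (simp add: nat_pow_distrib m_ac)
  then have "\<forall>e\<ge>e0. c \<otimes> (r \<otimes> a) [^] (p ^ e) \<in> frob_ideal R (p ^ e) I"
    using c(2) r ideal_mult_l[OF frob_ideal_ideal[OF I]] by simp
  then show "r \<otimes> a \<in> tight_closure R p I" using c(1,3) r by (auto simp: tight_closure_def)
qed

end

section \<open>Nilpotents, and reduction of tight closure modulo the minimal primes\<close>

lemma (in cring) combination_identity:
  "\<lbrakk>c \<in> carrier R; d \<in> carrier R; b \<in> carrier R; y \<in> carrier R; i \<in> carrier R; j \<in> carrier R\<rbrakk>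
   \<Longrightarrow> (c \<oplus> d \<otimes> b) \<otimes> y \<ominus> (i \<oplus> d \<otimes> j) = (c \<otimes> y \<ominus> i) \<oplus> d \<otimes> (b \<otimes> y \<ominus> j)"
  by algebra

locale noetherian_char_p = noetherian_cring R + prime_char R p for R (structure) and p
begin

text \<open>Otherwise some prime avoids all powers of x; it contains a minimal prime, and with it
  x.\<close>

lemma nilpotent_if_in_minimal_primes:
  assumes x: "x \<in> carrier R" "\<And>P. minimal_prime R P \<Longrightarrow> x \<in> P"
  shows "\<exists>n::nat. x [^] n = \<zero>"
proof (rule ccontr)
  assume nn: "\<not> ?thesis"
  have S: "mult_system R (range (\<lambda>n::nat. x [^] n))"
    unfolding mult_system_def
  proof (intro conjI ballI)
    show "\<one> \<in> range (\<lambda>n::nat. x [^] n)" using nat_pow_0 by (metis rangeI)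
    show "a \<otimes> b \<in> range (\<lambda>n::nat. x [^] n)" if "a \<in> range (\<lambda>n::nat. x [^] n)" "b \<in> range (\<lambda>n::nat. x [^] n)" for a b
      using that x(1) by (auto simp: nat_pow_mult)
  qed (use x in auto)
  obtain Q where Q: "primeideal Q R" "Q \<inter> range (\<lambda>n::nat. x [^] n) = {}"
    by (rule prime_avoiding[OF zeroideal S]) (use nn in auto)
  obtain P where "minimal_prime R P" "P \<subseteq> Q" using prime_contains_minimal[OF Q(1)] by auto
  then have "x [^] (1::nat) \<in> Q" using x by auto
  then show False using Q(2) by blast
qed

text \<open>The kernels of the iterates of Frobenius form an ascending chain of ideals, which stops
  at some k. As n \<le> p^n, every nilpotent element lies in one of these kernels, hence in the
  k-th, so the exponent is uniform over the nilradical.\<close>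

lemma nilradical_frobenius_killed:
  shows "\<exists>k. \<forall>x \<in> carrier R. (\<forall>P. minimal_prime R P \<longrightarrow> x \<in> P) \<longrightarrow> x [^] (p ^ k) = \<zero>"
proof -
  define Y where "Y = (\<lambda>k. {x \<in> carrier R. x [^] (p ^ k) = \<zero>})"
  have id: "ideal (Y k) R" for k
  proof (rule cidealI)
    show "\<zero> \<in> Y k" using p_pos by (auto simp: Y_def nat_pow_zero neq0_conv)
  qed (auto simp: Y_def frobenius_add nat_pow_distrib)
  have mono: "Y k \<subseteq> Y (Suc k)" for k
  proof
    fix x assume x: "x \<in> Y k"
    then have "x [^] (p ^ Suc k) = (x [^] (p ^ k)) [^] p"
      using nat_pow_pow[of x "p ^ k" p] by (simp add: Y_def mult.commute)
    then show "x \<in> Y (Suc k)" using x p_prime by (auto simp: Y_def nat_pow_zero prime_gt_0_nat)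
  qed
  obtain k where k: "\<forall>n. Y n \<subseteq> Y k" using ascending_ideals_stabilise[of Y, OF id mono] by auto
  have "x \<in> Y k" if x: "x \<in> carrier R" "\<And>P. minimal_prime R P \<Longrightarrow> x \<in> P" for x
  proof -
    obtain n :: nat where n: "x [^] n = \<zero>" using nilpotent_if_in_minimal_primes[OF x] by auto
    have "n \<le> p ^ n" using p_prime less_exp[of n] power_mono[of 2 p n] prime_ge_2_nat[of p] by linarith
    then have "x [^] (p ^ n) = x [^] n \<otimes> x [^] (p ^ n - n)" using x by (simp add: nat_pow_mult)
    then have "x \<in> Y n" using n x by (simp add: Y_def)
    then show ?thesis using k by auto
  qed
  then show ?thesis by (intro exI[of _ k]) (auto simp: Y_def)
qed

text \<open>The multipliers belonging to the single minimal primes are glued into one c that avoids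
  all of them and makes c x^q - i nilpotent. The Frobenius iterate that kills every nilpotent turns
  this into an equation, at the price of replacing c by c^(p^k) and shifting the exponent e by
  k.\<close>

lemma tight_closure_mod_minimal_primes:
  assumes I: "ideal I R" and x: "x \<in> carrier R"
    and mp: "\<And>P. minimal_prime R P \<Longrightarrow>
      \<exists>c \<in> carrier R - P. \<exists>e0. \<forall>e\<ge>e0. \<exists>i \<in> frob_ideal R (p ^ e) I. c \<otimes> x [^] (p ^ e) \<ominus> i \<in> P"
  shows "x \<in> tight_closure R p I"
proof -
  let ?M = "{P. minimal_prime R P}"
  note fid = frob_ideal_ideal[OF I]
  note fsub = subsetD[OF ideal_subset[OF fid]]
  have pid: "ideal P R" if "P \<in> ?M" for P using that minimal_prime_prime primeideal_ideal by auto
  \<comment> \<open>S is the set of minimal primes treated so far. c is kept inside the others so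
    that c + d b leaves the next prime P as soon as d b does. The congruence is demanded for all
    minimal primes from the start, with c = i = \<zero> when S is empty.\<close>
  have ind: "\<exists>c \<in> carrier R. (\<forall>P \<in> S. c \<notin> P) \<and> (\<forall>P \<in> ?M - S. c \<in> P) \<and>
      (\<exists>e0. \<forall>e\<ge>e0. \<exists>i \<in> frob_ideal R (p ^ e) I. \<forall>P \<in> ?M. c \<otimes> x [^] (p ^ e) \<ominus> i \<in> P)"
    if "finite S" "S \<subseteq> ?M" for S
    using that
  proof (induction S rule: finite_induct)
    case empty
    have "\<zero> \<otimes> x [^] (p ^ e) \<ominus> \<zero> \<in> P" if "P \<in> ?M" for P e
      using x ideal_zero[OF pid[OF that]] by (simp add: a_minus_def)
    then show ?case using ideal_zero[OF fid] pid ideal_zero by (intro bexI[of _ \<zero>] conjI exI[of _ 0] allI impI) auto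
  next
    case (insert P S)
    have PM: "P \<in> ?M" and SM: "S \<subseteq> ?M" using insert.prems by auto
    obtain c e0 where c: "c \<in> carrier R" "\<forall>P \<in> S. c \<notin> P" "\<forall>P \<in> ?M - S. c \<in> P"
        "\<forall>e\<ge>e0. \<exists>i \<in> frob_ideal R (p ^ e) I. \<forall>P \<in> ?M. c \<otimes> x [^] (p ^ e) \<ominus> i \<in> P"
      using insert.IH[OF SM] by auto
    have Pp: "primeideal P R" using PM minimal_prime_prime by simp
    \<comment> \<open>This element, named d below, vanishes modulo every minimal prime except P, so
      replacing c by c + d b and i by i + d j changes nothing modulo those.\<close>
    have "\<exists>s \<in> carrier R - P. \<forall>J \<in> ?M - {P}. s \<in> J"
    proof (rule mult_system_common[OF prime_mult_system[OF Pp]])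
      show "finite (?M - {P})" using finite_minimal_primes by simp
      fix J assume J: "J \<in> ?M - {P}"
      show "ideal J R" using pid J by simp
      have "\<not> J \<subseteq> P" using J PM minimal_prime_prime[of J] by (auto simp: minimal_prime_def)
      then show "J \<inter> (carrier R - P) \<noteq> {}" using ideal_subset[OF \<open>ideal J R\<close>] by auto
    qed
    then obtain d where d: "d \<in> carrier R" "d \<notin> P" "\<forall>J \<in> ?M - {P}. d \<in> J" by auto
    obtain b e1 where b: "b \<in> carrier R" "b \<notin> P"
      "\<forall>e\<ge>e1. \<exists>i \<in> frob_ideal R (p ^ e) I. b \<otimes> x [^] (p ^ e) \<ominus> i \<in> P" using mp[of P] PM by auto
    have db: "d \<otimes> b \<notin> P" by (rule prime_mult_notin[OF Pp d(1) b(1) d(2) b(2)])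
    have db': "d \<otimes> b \<in> P'" if "P' \<in> ?M - {P}" for P' using ideal_mult_r[OF pid _ b(1)] that d by auto
    have canc: "b' \<in> P'" if "P' \<in> ?M" "a \<in> P'" "a \<oplus> b' \<in> P'" "b' \<in> carrier R" for P' a b'
    proof -
      have ac: "a \<in> carrier R" using ideal_subset[OF pid[OF that(1)]] that(2) by auto
      have "(a \<oplus> b') \<ominus> a \<in> P'" using ideal_minus[OF pid[OF that(1)] that(3,2)] .
      moreover have "(a \<oplus> b') \<ominus> a = b'" using ac that(4) by algebra
      ultimately show ?thesis by simp
    qed
    have c1: "c \<oplus> d \<otimes> b \<notin> P'" if P': "P' \<in> insert P S" for P'
    proof (cases "P' = P")
      case True
      then have "c \<in> P" using c(3) PM insert.hyps by auto
      then show ?thesis using canc[OF PM, of c "d \<otimes> b"] db d b True by auto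
    next
      case False
      then have *: "P' \<in> ?M" "d \<otimes> b \<in> P'" "c \<notin> P'" using db' P' SM c(2) by auto
      then show ?thesis using canc[OF *(1,2), of c] c(1) d b a_comm by auto
    qed
    have c2: "c \<oplus> d \<otimes> b \<in> P'" if "P' \<in> ?M - insert P S" for P'
      using that db' c(3) ideal_add[OF pid] by auto
    show ?case
    proof (intro bexI[of _ "c \<oplus> d \<otimes> b"] conjI)
      show "\<forall>P\<in>insert P S. c \<oplus> d \<otimes> b \<notin> P" using c1 by auto
      show "\<forall>P\<in>{P. minimal_prime R P} - insert P S. c \<oplus> d \<otimes> b \<in> P" using c2 by auto
      show "c \<oplus> d \<otimes> b \<in> carrier R" using c d b by simp
      show "\<exists>e0. \<forall>e\<ge>e0. \<exists>i\<in>frob_ideal R (p ^ e) I. \<forall>P\<in>?M. (c \<oplus> d \<otimes> b) \<otimes> x [^] (p ^ e) \<ominus> i \<in> P"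
      proof (intro exI[of _ "max e0 e1"] allI impI)
        fix e assume e: "max e0 e1 \<le> e"
        obtain i where i: "i \<in> frob_ideal R (p ^ e) I" "\<forall>P\<in>?M. c \<otimes> x [^] (p ^ e) \<ominus> i \<in> P" using c(4) e by auto
        obtain j where j: "j \<in> frob_ideal R (p ^ e) I" "b \<otimes> x [^] (p ^ e) \<ominus> j \<in> P" using b(3) e by auto
        note ij = fsub[OF i(1)] fsub[OF j(1)]
        have "(c \<oplus> d \<otimes> b) \<otimes> x [^] (p ^ e) \<ominus> (i \<oplus> d \<otimes> j) \<in> P'" if P': "P' \<in> ?M" for P'
        proof -
          have "(c \<oplus> d \<otimes> b) \<otimes> x [^] (p ^ e) \<ominus> (i \<oplus> d \<otimes> j) =
             (c \<otimes> x [^] (p ^ e) \<ominus> i) \<oplus> d \<otimes> (b \<otimes> x [^] (p ^ e) \<ominus> j)"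
            by (rule combination_identity) (use c(1) d(1) b(1) x ij in auto)
          moreover have "d \<otimes> (b \<otimes> x [^] (p ^ e) \<ominus> j) \<in> P'"
          proof (cases "P' = P")
            case True
            then show ?thesis using ideal_mult_l[OF pid[OF PM] j(2) d(1)] by simp
          next
            case False
            then have "d \<in> P'" using d P' by auto
            then show ?thesis using ideal_mult_r[OF pid[OF P']] b x ij by simp
          qed
          ultimately show ?thesis using ideal_add[OF pid[OF P']] i(2) P' by simp
        qed
        moreover have "i \<oplus> d \<otimes> j \<in> frob_ideal R (p ^ e) I"
          using ideal_add[OF fid i(1) ideal_mult_l[OF fid j(1) d(1)]] .
        ultimately show "\<exists>i\<in>frob_ideal R (p ^ e) I. \<forall>P\<in>?M. (c \<oplus> d \<otimes> b) \<otimes> x [^] (p ^ e) \<ominus> i \<in> P" by auto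
      qed
    qed
  qed
  obtain c e0 where c: "c \<in> carrier R" "\<forall>P \<in> ?M. c \<notin> P"
    "\<forall>e\<ge>e0. \<exists>i \<in> frob_ideal R (p ^ e) I. \<forall>P \<in> ?M. c \<otimes> x [^] (p ^ e) \<ominus> i \<in> P"
    using ind[OF finite_minimal_primes] by auto
  obtain k where k: "\<forall>x \<in> carrier R. (\<forall>P. minimal_prime R P \<longrightarrow> x \<in> P) \<longrightarrow> x [^] (p ^ k) = \<zero>"
    using nilradical_frobenius_killed by auto
  have circ: "c [^] (p ^ k) \<in> ring_circ R" using c by (intro ring_circ_pow) (auto simp: ring_circ_iff)
  have "c [^] (p ^ k) \<otimes> x [^] (p ^ e) \<in> frob_ideal R (p ^ e) I" if e: "e \<ge> e0 + k" for e
  proof -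
    define e' where "e' = e - k"
    have e': "e = e' + k" "e' \<ge> e0" using e by (auto simp: e'_def)
    obtain i where i: "i \<in> frob_ideal R (p ^ e') I" "\<forall>P \<in> ?M. c \<otimes> x [^] (p ^ e') \<ominus> i \<in> P"
      using c(3) e'(2) by auto
    have ic: "i \<in> carrier R" using fsub[OF i(1)] .
    have "\<zero> = (c \<otimes> x [^] (p ^ e') \<ominus> i) [^] (p ^ k)" using k i c(1) x ic by auto
    also have "\<dots> = (c \<otimes> x [^] (p ^ e')) [^] (p ^ k) \<ominus> i [^] (p ^ k)" using c(1) x ic by (intro frobenius_minus) auto
    finally have "(c \<otimes> x [^] (p ^ e')) [^] (p ^ k) \<ominus> i [^] (p ^ k) = \<zero>" by simp
    then have "(c \<otimes> x [^] (p ^ e')) [^] (p ^ k) = i [^] (p ^ k)" using c(1) x ic by simp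
    moreover have "(c \<otimes> x [^] (p ^ e')) [^] (p ^ k) = c [^] (p ^ k) \<otimes> x [^] (p ^ e)"
      using c(1) x e'(1) by (simp add: nat_pow_distrib nat_pow_pow power_add)
    ultimately show ?thesis using frob_ideal_pow[OF I i(1), of k] e'(1) by simp
  qed
  then show ?thesis using x by (auto simp: tight_closure_def intro!: bexI[OF _ circ] exI[of _ "e0 + k"])
qed

end

section \<open>Two adjacent primes\<close>

text \<open>K is the fraction field of R/P, described by its properties \<open>kernel\<close> and
  \<open>fraction\<close> instead of a construction. The condition \<open>between\<close> says that
  the local domain (R/P)_Q has dimension at most 1; the case P = Q is allowed.\<close>

locale adjacent_primes = field K + R: noetherian_char_p R p
  for K :: "('k, 'm) ring_scheme" (structure) and R :: "('a, 'b) ring_scheme" and p :: nat +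
  fixes \<phi> :: "'a \<Rightarrow> 'k" and P Q :: "'a set"
  assumes hom: "\<phi> \<in> ring_hom R K"
    and kernel: "r \<in> carrier R \<Longrightarrow> \<phi> r = \<zero> \<longleftrightarrow> r \<in> P"
    and fraction: "z \<in> carrier K \<Longrightarrow> \<exists>a \<in> carrier R. \<exists>b \<in> carrier R - P. \<phi> b \<otimes> z = \<phi> a"
    and P_prime: "primeideal P R" and Q_prime: "primeideal Q R" and PQ: "P \<subseteq> Q"
    and between: "primeideal Q' R \<Longrightarrow> P \<subset> Q' \<Longrightarrow> Q' \<subseteq> Q \<Longrightarrow> Q' = Q"
begin

text \<open>D is the image of R/P in its fraction field K, and S is the image of the complement of Q.\<close>

definition D where "D = \<phi> ` carrier R"
definition S where "S = \<phi> ` (carrier R - Q)"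

lemma hom_closed: "r \<in> carrier R \<Longrightarrow> \<phi> r \<in> carrier K"
  using ring_hom_closed[OF hom] .
lemma hom_add: "r \<in> carrier R \<Longrightarrow> s \<in> carrier R \<Longrightarrow> \<phi> (r \<oplus>\<^bsub>R\<^esub> s) = \<phi> r \<oplus> \<phi> s"
  using ring_hom_add[OF hom] .
lemma hom_mult: "r \<in> carrier R \<Longrightarrow> s \<in> carrier R \<Longrightarrow> \<phi> (r \<otimes>\<^bsub>R\<^esub> s) = \<phi> r \<otimes> \<phi> s"
  using ring_hom_mult[OF hom] .
lemma hom_one: "\<phi> \<one>\<^bsub>R\<^esub> = \<one>"
  using ring_hom_one[OF hom] .
lemma hom_zero: "\<phi> \<zero>\<^bsub>R\<^esub> = \<zero>"
  using kernel[OF R.zero_closed] R.ideal_zero[OF R.primeideal_ideal[OF P_prime]] by simp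
lemma hom_pow: "r \<in> carrier R \<Longrightarrow> \<phi> (r [^]\<^bsub>R\<^esub> (n::nat)) = \<phi> r [^] n"
  by (induction n) (simp_all add: hom_one hom_mult)
lemma hom_minus:
  assumes "r \<in> carrier R" "s \<in> carrier R" shows "\<phi> (r \<ominus>\<^bsub>R\<^esub> s) = \<phi> r \<ominus> \<phi> s"
proof -
  have "(r \<ominus>\<^bsub>R\<^esub> s) \<oplus>\<^bsub>R\<^esub> s = r" using assms by (simp add: R.cring_simprules)
  then have "\<phi> (r \<ominus>\<^bsub>R\<^esub> s) \<oplus> \<phi> s = \<phi> r" using hom_add[of "r \<ominus>\<^bsub>R\<^esub> s" s] assms by simp
  moreover have "\<phi> (r \<ominus>\<^bsub>R\<^esub> s) = (\<phi> (r \<ominus>\<^bsub>R\<^esub> s) \<oplus> \<phi> s) \<ominus> \<phi> s"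
    using hom_closed[of "r \<ominus>\<^bsub>R\<^esub> s"] hom_closed[of s] assms by (simp add: a_minus_def a_assoc r_neg)
  ultimately show ?thesis by simp
qed

lemma char_p_K: "char_p K p"
proof -
  have "\<phi> (add_pow R n \<one>\<^bsub>R\<^esub>) = add_pow K n \<one>" for n :: nat
    by (induction n) (simp_all add: hom_zero hom_one hom_add)
  from this[of p] show ?thesis using R.char hom_zero by (simp add: char_p_def)
qed

sublocale prime_char K p
  by unfold_locales (rule char_p_K)

lemma D_carrier: "d \<in> D \<Longrightarrow> d \<in> carrier K" by (auto simp: D_def hom_closed)
lemma D_zero: "\<zero> \<in> D" unfolding D_def using hom_zero R.zero_closed by (metis imageI)
lemma D_one: "\<one> \<in> D" unfolding D_def using hom_one R.one_closed by (metis imageI)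
lemma D_add: "c \<in> D \<Longrightarrow> d \<in> D \<Longrightarrow> c \<oplus> d \<in> D"
  unfolding D_def by (auto simp: hom_add[symmetric])
lemma D_mult: "c \<in> D \<Longrightarrow> d \<in> D \<Longrightarrow> c \<otimes> d \<in> D"
  unfolding D_def by (auto simp: hom_mult[symmetric])
lemma D_minus: "c \<in> D \<Longrightarrow> d \<in> D \<Longrightarrow> c \<ominus> d \<in> D"
  unfolding D_def by (auto simp: hom_minus[symmetric])
lemma D_pow: "d \<in> D \<Longrightarrow> d [^] (n::nat) \<in> D"
  by (induction n) (simp_all add: D_one D_mult)
lemma D_neg: "d \<in> D \<Longrightarrow> \<ominus> d \<in> D"
  using D_minus[OF D_zero, of d] D_carrier[of d] by (simp add: a_minus_def)

lemma S_D: "u \<in> S \<Longrightarrow> u \<in> D" by (auto simp: S_def D_def)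
lemma S_nonzero: "u \<in> S \<Longrightarrow> u \<noteq> \<zero>" using PQ by (auto simp: S_def kernel)
lemma S_one: "\<one> \<in> S"
  unfolding S_def using R.prime_one_notin[OF Q_prime] by (intro image_eqI[of _ _ "\<one>\<^bsub>R\<^esub>"]) (auto simp: hom_one)
lemma S_mult: "u \<in> S \<Longrightarrow> v \<in> S \<Longrightarrow> u \<otimes> v \<in> S"
  unfolding S_def using R.prime_mult_notin[OF Q_prime] by (auto simp: hom_mult[symmetric])
lemma S_carrier: "u \<in> S \<Longrightarrow> u \<in> carrier K" by (simp add: S_D D_carrier)

lemma inv_closed': "u \<in> carrier K \<Longrightarrow> u \<noteq> \<zero> \<Longrightarrow> inv u \<in> carrier K"
  and inv_right: "u \<in> carrier K \<Longrightarrow> u \<noteq> \<zero> \<Longrightarrow> u \<otimes> inv u = \<one>"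
  using field_Units Units_inv_closed Units_r_inv by auto

lemma pow_nonzero: "u \<in> carrier K \<Longrightarrow> u \<noteq> \<zero> \<Longrightarrow> u [^] (n::nat) \<noteq> \<zero>"
  by (induction n) (simp_all add: integral_iff)

text \<open>Almost integral over the localization of D at Q, with denominators that are uniform in n.\<close>

definition almost_integral where
  "almost_integral s \<longleftrightarrow> s \<in> carrier K \<and> (\<exists>f \<in> S. \<exists>c \<in> D. c \<noteq> \<zero> \<and> (\<forall>n::nat. c \<otimes> (f \<otimes> s) [^] n \<in> D))"

lemma almost_integralI: "s \<in> carrier K \<Longrightarrow> f \<in> S \<Longrightarrow> c \<in> D \<Longrightarrow> c \<noteq> \<zero> \<Longrightarrow> (\<And>n::nat. c \<otimes> (f \<otimes> s) [^] n \<in> D) \<Longrightarrow> almost_integral s"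
  by (auto simp: almost_integral_def)

lemma almost_integral_carrier: "almost_integral s \<Longrightarrow> s \<in> carrier K" by (simp add: almost_integral_def)

text \<open>The product of the multipliers and the product of the denominators work for all members
  of G: the surplus factors are elements of D and powers of elements of S, hence stay in D.\<close>

lemma almost_integral_uniform:
  assumes "finite G" "\<And>s. s \<in> G \<Longrightarrow> almost_integral s"
  shows "\<exists>f \<in> S. \<exists>c \<in> D. c \<noteq> \<zero> \<and> (\<forall>s \<in> G. \<forall>n::nat. c \<otimes> (f \<otimes> s) [^] n \<in> D)"
  using assms
proof (induction G rule: finite_induct)
  case empty
  then show ?case using S_one D_one by (intro bexI[of _ \<one>] conjI) auto
next
  case (insert s G)
  then obtain f c where fc: "f \<in> S" "c \<in> D" "c \<noteq> \<zero>" "\<forall>s \<in> G. \<forall>n::nat. c \<otimes> (f \<otimes> s) [^] n \<in> D" by auto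
  obtain g d where gd: "g \<in> S" "d \<in> D" "d \<noteq> \<zero>" "\<forall>n::nat. d \<otimes> (g \<otimes> s) [^] n \<in> D" "s \<in> carrier K"
    using insert.prems[of s] by (auto simp: almost_integral_def)
  note car = D_carrier[OF fc(2)] D_carrier[OF gd(2)] S_carrier[OF fc(1)] S_carrier[OF gd(1)]
  have "(c \<otimes> d) \<otimes> ((f \<otimes> g) \<otimes> t) [^] n \<in> D" if t: "t \<in> insert s G" for t and n :: nat
  proof (cases "t = s")
    case True
    have "(c \<otimes> d) \<otimes> ((f \<otimes> g) \<otimes> t) [^] n = (c \<otimes> f [^] n) \<otimes> (d \<otimes> (g \<otimes> t) [^] n)"
      using car gd(5) True by (simp add: nat_pow_distrib m_ac)
    then show ?thesis using D_mult D_pow fc(2) S_D[OF fc(1)] gd(4) True by auto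
  next
    case False
    then have tc: "t \<in> carrier K" using t insert.prems almost_integral_carrier by auto
    have "(c \<otimes> d) \<otimes> ((f \<otimes> g) \<otimes> t) [^] n = (d \<otimes> g [^] n) \<otimes> (c \<otimes> (f \<otimes> t) [^] n)"
      using car tc by (simp add: nat_pow_distrib m_ac)
    then show ?thesis using D_mult D_pow gd(2) S_D[OF gd(1)] fc(4) t False by auto
  qed
  moreover have "c \<otimes> d \<in> D" "c \<otimes> d \<noteq> \<zero>" "f \<otimes> g \<in> S"
    using D_mult fc gd car S_mult by (auto simp: integral_iff)
  ultimately show ?case by (intro bexI[of _ "f \<otimes> g"] bexI[of _ "c \<otimes> d"]) auto
qed

lemma almost_integral_D: assumes "d \<in> D" shows "almost_integral d"
  using assms S_one D_one D_pow D_carrier by (intro almost_integralI[of _ \<one> \<one>]) auto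

lemma almost_integral_mult: assumes "almost_integral s" "almost_integral t" shows "almost_integral (s \<otimes> t)"
proof -
  have st: "s \<in> carrier K" "t \<in> carrier K" using assms almost_integral_carrier by auto
  obtain f c where fc: "f \<in> S" "c \<in> D" "c \<noteq> \<zero>" "\<forall>s \<in> {s, t}. \<forall>n::nat. c \<otimes> (f \<otimes> s) [^] n \<in> D"
    using almost_integral_uniform[of "{s, t}"] assms by auto
  note car = D_carrier[OF fc(2)] S_carrier[OF fc(1)]
  have "(c \<otimes> c) \<otimes> ((f \<otimes> f) \<otimes> (s \<otimes> t)) [^] n = (c \<otimes> (f \<otimes> s) [^] n) \<otimes> (c \<otimes> (f \<otimes> t) [^] n)" for n :: nat
    using car st by (simp add: nat_pow_distrib m_ac)
  then show ?thesis using fc st car S_mult D_mult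
    by (intro almost_integralI[of _ "f \<otimes> f" "c \<otimes> c"]) (auto simp: integral_iff)
qed

lemma almost_integral_add: assumes "almost_integral s" "almost_integral t" shows "almost_integral (s \<oplus> t)"
proof -
  have st: "s \<in> carrier K" "t \<in> carrier K" using assms almost_integral_carrier by auto
  obtain f c where fc: "f \<in> S" "c \<in> D" "c \<noteq> \<zero>" "\<forall>s \<in> {s, t}. \<forall>n::nat. c \<otimes> (f \<otimes> s) [^] n \<in> D"
    using almost_integral_uniform[of "{s, t}"] assms by auto
  note car = D_carrier[OF fc(2)] S_carrier[OF fc(1)]
  define u v where "u = f \<otimes> s" and "v = f \<otimes> t"
  have uv: "u \<in> carrier K" "v \<in> carrier K" "\<And>n::nat. c \<otimes> u [^] n \<in> D" "\<And>n::nat. c \<otimes> v [^] n \<in> D"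
    using fc st car by (auto simp: u_def v_def)
  \<comment> \<open>Generalising over i and j lets each factor u + v be distributed over the two
    monomials, which replaces a binomial expansion; the case i = j = 0 is the one wanted.\<close>
  have "((c \<otimes> u [^] i) \<otimes> (c \<otimes> v [^] j)) \<otimes> (u \<oplus> v) [^] n \<in> D" for i j n :: nat
  proof (induction n arbitrary: i j)
    case 0
    then show ?case using uv car D_mult by simp
  next
    case (Suc n)
    have "((c \<otimes> u [^] i) \<otimes> (c \<otimes> v [^] j)) \<otimes> (u \<oplus> v) [^] (Suc n) =
      ((c \<otimes> u [^] (Suc i)) \<otimes> (c \<otimes> v [^] j)) \<otimes> (u \<oplus> v) [^] n \<oplus>
      ((c \<otimes> u [^] i) \<otimes> (c \<otimes> v [^] (Suc j))) \<otimes> (u \<oplus> v) [^] n"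
      using uv(1,2) car by (simp add: l_distr r_distr m_ac)
    then show ?case using Suc.IH[of "Suc i" j] Suc.IH[of i "Suc j"] D_add by simp
  qed
  from this[of 0 0] have "(c \<otimes> c) \<otimes> (f \<otimes> (s \<oplus> t)) [^] n \<in> D" for n :: nat
    using car st by (simp add: u_def v_def r_distr)
  then show ?thesis using fc st car D_mult
    by (intro almost_integralI[of _ f "c \<otimes> c"]) (auto simp: integral_iff)
qed

text \<open>Here the multiplier f is u itself. Together with closure under sums and products this
  makes the almost integral elements a ring over the localization of D at Q, not merely over
  D.\<close>

lemma almost_integral_inv: assumes "u \<in> S" shows "almost_integral (inv u)"
  using assms S_carrier[OF assms] S_nonzero[OF assms] D_one
  by (intro almost_integralI[of _ u \<one>]) (auto simp: inv_closed' inv_right)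

text \<open>The D-span of 1, y, ..., y^(n - 1), in Horner form.\<close>

fun poly_span :: "'k \<Rightarrow> nat \<Rightarrow> 'k set" where
  "poly_span y 0 = {\<zero>}"
| "poly_span y (Suc n) = {d \<oplus> y \<otimes> m | d m. d \<in> D \<and> m \<in> poly_span y n}"

lemma span_carrier: "y \<in> carrier K \<Longrightarrow> m \<in> poly_span y n \<Longrightarrow> m \<in> carrier K"
  by (induction n arbitrary: m) (auto simp: D_carrier)

lemma span_SucI: "d \<in> D \<Longrightarrow> m \<in> poly_span y n \<Longrightarrow> d \<oplus> y \<otimes> m \<in> poly_span y (Suc n)"
  by auto

lemma span_SucE:
  assumes "x \<in> poly_span y (Suc n)"
  obtains d m where "d \<in> D" "m \<in> poly_span y n" "x = d \<oplus> y \<otimes> m"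
  using assms by auto

declare poly_span.simps(2) [simp del]

context fixes y assumes y: "y \<in> carrier K"
begin

lemma span_zero: "\<zero> \<in> poly_span y n"
proof (induction n)
  case (Suc n)
  then show ?case using span_SucI[OF D_zero Suc] y by simp
qed simp

lemma span_add: "m \<in> poly_span y n \<Longrightarrow> m' \<in> poly_span y n \<Longrightarrow> m \<oplus> m' \<in> poly_span y n"
proof (induction n arbitrary: m m')
  case (Suc n)
  obtain d z where d: "d \<in> D" "z \<in> poly_span y n" "m = d \<oplus> y \<otimes> z" by (rule span_SucE[OF Suc.prems(1)])
  obtain d' z' where d': "d' \<in> D" "z' \<in> poly_span y n" "m' = d' \<oplus> y \<otimes> z'" by (rule span_SucE[OF Suc.prems(2)])
  have "m \<oplus> m' = (d \<oplus> d') \<oplus> y \<otimes> (z \<oplus> z')"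
    using d d' y span_carrier[OF y] D_carrier by (simp add: r_distr a_ac)
  then show ?case using span_SucI[OF D_add[OF d(1) d'(1)] Suc.IH[OF d(2) d'(2)]] by simp
qed simp

lemma span_scale: "c \<in> D \<Longrightarrow> m \<in> poly_span y n \<Longrightarrow> c \<otimes> m \<in> poly_span y n"
proof (induction n arbitrary: m)
  case (Suc n)
  obtain d z where d: "d \<in> D" "z \<in> poly_span y n" "m = d \<oplus> y \<otimes> z" by (rule span_SucE[OF Suc.prems(2)])
  have "c \<otimes> m = (c \<otimes> d) \<oplus> y \<otimes> (c \<otimes> z)"
    using d y span_carrier[OF y] D_carrier Suc.prems(1) by (simp add: r_distr m_ac)
  then show ?case using span_SucI[OF D_mult[OF Suc.prems(1) d(1)] Suc.IH[OF Suc.prems(1) d(2)]] by simp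
qed (simp add: D_carrier)

lemma span_minus: "m \<in> poly_span y n \<Longrightarrow> m' \<in> poly_span y n \<Longrightarrow> m \<ominus> m' \<in> poly_span y n"
proof -
  assume m: "m \<in> poly_span y n" "m' \<in> poly_span y n"
  have "m \<ominus> m' = m \<oplus> (\<ominus> \<one>) \<otimes> m'" using m span_carrier[OF y] by (simp add: a_minus_def l_minus)
  then show ?thesis using span_add[OF m(1) span_scale[OF D_neg[OF D_one] m(2)]] by simp
qed

lemma span_Suc: "m \<in> poly_span y n \<Longrightarrow> m \<in> poly_span y (Suc n)"
proof (induction n arbitrary: m)
  case 0
  then show ?case using span_zero by simp
next
  case (Suc n)
  obtain d z where d: "d \<in> D" "z \<in> poly_span y n" "m = d \<oplus> y \<otimes> z" by (rule span_SucE[OF Suc.prems])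
  then show ?case using span_SucI[OF d(1) Suc.IH[OF d(2)]] by simp
qed

lemma span_mono: "m \<in> poly_span y n \<Longrightarrow> n \<le> k \<Longrightarrow> m \<in> poly_span y k"
  using lift_Suc_mono_le[of "poly_span y" n k] span_Suc by auto

lemma span_y: "m \<in> poly_span y n \<Longrightarrow> y \<otimes> m \<in> poly_span y (Suc n)"
  using span_SucI[OF D_zero, of m y n] y span_carrier[OF y] by simp

lemma span_y_pow: "m \<in> poly_span y n \<Longrightarrow> y [^] i \<otimes> m \<in> poly_span y (n + i)"
proof (induction i)
  case 0
  then show ?case using span_carrier[OF y] by simp
next
  case (Suc i)
  have "y [^] Suc i \<otimes> m = y \<otimes> (y [^] i \<otimes> m)" using y span_carrier[OF y Suc.prems] by (simp add: m_ac)
  then show ?case using span_y[OF Suc.IH[OF Suc.prems]] by simp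
qed

lemma span_D: "d \<in> D \<Longrightarrow> d \<in> poly_span y (Suc n)"
  using span_SucI[OF _ span_zero, of d n] y D_carrier by simp

lemma span_monomial: "d \<in> D \<Longrightarrow> d \<otimes> y [^] n \<in> poly_span y (Suc n)"
  using span_y_pow[OF span_D[of d 0], of n] y D_carrier[of d] by (simp add: m_comm)

text \<open>Division with remainder by y^n. The quotient is only claimed to lie in
  \<open>poly_span y k\<close>, which avoids a truncated difference of lengths.\<close>

lemma span_split:
  assumes "m \<in> poly_span y k"
  shows "\<exists>l \<in> poly_span y n. \<exists>r \<in> poly_span y k. m = l \<oplus> y [^] n \<otimes> r"
proof (induction n)
  case 0
  then show ?case using assms span_carrier[OF y] by (intro bexI[of _ \<zero>] bexI[of _ m]) auto
next
  case (Suc n)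
  then obtain l r where lr: "l \<in> poly_span y n" "r \<in> poly_span y k" "m = l \<oplus> y [^] n \<otimes> r" by auto
  have "\<exists>d \<in> D. \<exists>r' \<in> poly_span y k. r = d \<oplus> y \<otimes> r'"
  proof (cases k)
    case 0
    then show ?thesis using lr(2) y D_zero by (intro bexI[of _ \<zero>]) auto
  next
    case (Suc k')
    obtain d r' where "d \<in> D" "r' \<in> poly_span y k'" "r = d \<oplus> y \<otimes> r'" by (rule span_SucE[OF lr(2)[unfolded Suc]])
    then show ?thesis using span_Suc Suc by auto
  qed
  then obtain d r' where d: "d \<in> D" "r' \<in> poly_span y k" "r = d \<oplus> y \<otimes> r'" by auto
  have "m = (l \<oplus> d \<otimes> y [^] n) \<oplus> y [^] Suc n \<otimes> r'"
    using lr d y D_carrier span_carrier[OF y] by (simp add: r_distr m_ac a_ac)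
  moreover have "l \<oplus> d \<otimes> y [^] n \<in> poly_span y (Suc n)"
    using span_add span_Suc[OF lr(1)] span_monomial[OF d(1)] by auto
  ultimately show ?case using d(2) by (intro bexI) auto
qed

text \<open>The Horner form exposes the constant coefficient; the leading one is exposed
  here.\<close>

lemma span_Suc_split:
  "m \<in> poly_span y (Suc n) \<Longrightarrow> \<exists>l \<in> poly_span y n. \<exists>d \<in> D. m = l \<oplus> d \<otimes> y [^] n"
proof (induction n arbitrary: m)
  case 0
  then show ?case using y D_carrier by (auto simp: poly_span.simps(2))
next
  case (Suc n)
  obtain d z where d: "d \<in> D" "z \<in> poly_span y (Suc n)" "m = d \<oplus> y \<otimes> z" by (rule span_SucE[OF Suc.prems])
  obtain l d' where l: "l \<in> poly_span y n" "d' \<in> D" "z = l \<oplus> d' \<otimes> y [^] n" using Suc.IH[OF d(2)] by auto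
  have "m = (d \<oplus> y \<otimes> l) \<oplus> d' \<otimes> y [^] Suc n"
    using d l y D_carrier span_carrier[OF y] by (simp add: r_distr m_ac a_ac)
  then show ?case using span_SucI[OF d(1) l(1)] l(2) by auto
qed

lemma span_denominator:
  assumes "a \<in> D" "a \<otimes> y \<in> D"
  shows "m \<in> poly_span y n \<Longrightarrow> a [^] n \<otimes> m \<in> D"
proof (induction n arbitrary: m)
  case 0
  then show ?case using D_zero by simp
next
  case (Suc n)
  obtain d z where d: "d \<in> D" "z \<in> poly_span y n" "m = d \<oplus> y \<otimes> z" by (rule span_SucE[OF Suc.prems])
  have "a [^] Suc n \<otimes> m = a [^] Suc n \<otimes> d \<oplus> (a \<otimes> y) \<otimes> (a [^] n \<otimes> z)"
    using d y D_carrier span_carrier[OF y] assms(1) by (simp add: r_distr m_ac)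
  then show ?case using Suc.IH[OF d(2)] D_add D_mult D_pow assms d(1) by simp
qed

text \<open>A substitute for the determinant argument: as N > 0, the span contains 1, so a
  multiplier s mapping the span into itself has all its powers there, and a^N is a common
  denominator of the span.\<close>

lemma almost_integral_if_stable:
  assumes a: "a \<in> D" "a \<noteq> \<zero>" "a \<otimes> y \<in> D" and N: "N > 0" and s: "s \<in> carrier K"
    and st: "\<And>m. m \<in> poly_span y N \<Longrightarrow> s \<otimes> m \<in> poly_span y N"
  shows "almost_integral s"
proof (rule almost_integralI[OF s S_one, where c = "a [^] N"])
  have "s [^] n \<in> poly_span y N" for n :: nat
  proof (induction n)
    case 0
    then show ?case using span_D[OF D_one, of "N - 1"] N by simp
  next
    case (Suc n)
    then show ?case using st[OF Suc] s by (simp add: m_comm)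
  qed
  then show "a [^] N \<otimes> (\<one> \<otimes> s) [^] n \<in> D" for n :: nat using span_denominator[OF a(1,3)] s by simp
qed (use a D_pow D_carrier pow_nonzero in auto)

text \<open>The test involves N + 1 powers of y, one more than span the module: stability under s
  uses y^0, ..., y^(N - 1), and stability under y s uses y^1, ..., y^N.\<close>

lemma almost_integral_if_powers_stable:
  assumes a: "a \<in> D" "a \<noteq> \<zero>" "a \<otimes> y \<in> D" and N: "N > 0" and s: "s \<in> carrier K"
    and st: "\<And>i. i \<le> N \<Longrightarrow> y [^] i \<otimes> s \<in> poly_span y N"
  shows "almost_integral s" "almost_integral (y \<otimes> s)"
proof -
  \<comment> \<open>Coefficients are peeled off m while the exponent i grows, so that i + j is
    constant. The bound Suc N admits j = N with both i = 0 and i = 1.\<close>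
  have main: "s \<otimes> (y [^] i \<otimes> m) \<in> poly_span y N" if "m \<in> poly_span y j" "i + j \<le> Suc N" for i j m
    using that
  proof (induction j arbitrary: i m)
    case 0
    then show ?case using s y span_zero by simp
  next
    case (Suc j)
    obtain d z where d: "d \<in> D" "z \<in> poly_span y j" "m = d \<oplus> y \<otimes> z" by (rule span_SucE[OF Suc.prems(1)])
    have "s \<otimes> (y [^] i \<otimes> m) = d \<otimes> (y [^] i \<otimes> s) \<oplus> s \<otimes> (y [^] Suc i \<otimes> z)"
      using d y s D_carrier span_carrier[OF y] by (simp add: r_distr m_ac)
    then show ?case using span_add span_scale[OF d(1) st[of i]] Suc.IH[OF d(2), of "Suc i"] Suc.prems(2) by simp
  qed
  show "almost_integral s"
    by (rule almost_integral_if_stable[OF a N s]) (use main[of _ N 0] s y span_carrier[OF y] in auto)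
  show "almost_integral (y \<otimes> s)"
  proof (rule almost_integral_if_stable[OF a N])
    fix m assume m: "m \<in> poly_span y N"
    have "y \<otimes> s \<otimes> m = s \<otimes> (y [^] (1::nat) \<otimes> m)" using s y span_carrier[OF y m] by (simp add: m_ac)
    then show "y \<otimes> s \<otimes> m \<in> poly_span y N" using main[OF m, of 1] by simp
  qed (use s y in simp)
qed

end

end

section \<open>Akizuki's finiteness argument, and invertibility of two-generated ideals\<close>

context adjacent_primes
begin

text \<open>This is the bridge to the Noetherian hypothesis: D-submodules of K pull back to ideals
  of R, where the chain conditions are available.\<close>

lemma preimage_ideal:
  assumes "\<zero> \<in> M" "\<And>m m'. m \<in> M \<Longrightarrow> m' \<in> M \<Longrightarrow> m \<oplus> m' \<in> M" "\<And>d m. d \<in> D \<Longrightarrow> m \<in> M \<Longrightarrow> d \<otimes> m \<in> M"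
  shows "ideal {r \<in> carrier R. \<phi> r \<in> M} R"
proof (rule R.cidealI)
  show "\<zero>\<^bsub>R\<^esub> \<in> {r \<in> carrier R. \<phi> r \<in> M}" using assms(1) hom_zero by simp
  show "a \<oplus>\<^bsub>R\<^esub> b \<in> {r \<in> carrier R. \<phi> r \<in> M}" if "a \<in> {r \<in> carrier R. \<phi> r \<in> M}" "b \<in> {r \<in> carrier R. \<phi> r \<in> M}" for a b
    using that assms(2) by (auto simp: hom_add)
  show "r \<otimes>\<^bsub>R\<^esub> a \<in> {r \<in> carrier R. \<phi> r \<in> M}" if "r \<in> carrier R" "a \<in> {r \<in> carrier R. \<phi> r \<in> M}" for r a
    using that assms(3)[of "\<phi> r"] by (auto simp: hom_mult D_def)
qed auto

lemma scaled_span_preimage_ideal: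
  assumes y: "y \<in> carrier K" and a: "a \<in> carrier K"
  shows "ideal {r \<in> carrier R. \<exists>m \<in> poly_span y n. \<phi> r = a \<otimes> m} R"
proof -
  have "ideal {r \<in> carrier R. \<phi> r \<in> (\<lambda>m. a \<otimes> m) ` poly_span y n} R"
  proof (rule preimage_ideal)
    show "\<zero> \<in> (\<lambda>m. a \<otimes> m) ` poly_span y n" using span_zero[OF y] a by (intro image_eqI[of _ _ \<zero>]) auto
    fix m m' assume "m \<in> (\<lambda>m. a \<otimes> m) ` poly_span y n" "m' \<in> (\<lambda>m. a \<otimes> m) ` poly_span y n"
    then obtain z z' where z: "m = a \<otimes> z" "m' = a \<otimes> z'" "z \<in> poly_span y n" "z' \<in> poly_span y n" by auto
    then have "m \<oplus> m' = a \<otimes> (z \<oplus> z')" using a span_carrier[OF y] by (simp add: r_distr)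
    then show "m \<oplus> m' \<in> (\<lambda>m. a \<otimes> m) ` poly_span y n" using span_add[OF y z(3,4)] by simp
  next
    fix d m assume d: "d \<in> D" and "m \<in> (\<lambda>m. a \<otimes> m) ` poly_span y n"
    then obtain z where z: "m = a \<otimes> z" "z \<in> poly_span y n" by auto
    then have "d \<otimes> m = a \<otimes> (d \<otimes> z)" using a span_carrier[OF y] D_carrier[OF d] by (simp add: m_ac)
    then show "d \<otimes> m \<in> (\<lambda>m. a \<otimes> m) ` poly_span y n" using span_scale[OF y d z(2)] by simp
  qed
  moreover have "{r \<in> carrier R. \<phi> r \<in> (\<lambda>m. a \<otimes> m) ` poly_span y n} = {r \<in> carrier R. \<exists>m \<in> poly_span y n. \<phi> r = a \<otimes> m}" by auto
  ultimately show ?thesis by simp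
qed

text \<open>The ring D[y], handled as a D-module.\<close>

definition span_ring where "span_ring y = (\<Union>n. poly_span y n)"

lemma span_ringI: "m \<in> poly_span y n \<Longrightarrow> m \<in> span_ring y" by (auto simp: span_ring_def)
lemma span_ring_carrier: "y \<in> carrier K \<Longrightarrow> m \<in> span_ring y \<Longrightarrow> m \<in> carrier K"
  by (auto simp: span_ring_def span_carrier)
lemma span_ring_add:
  assumes y: "y \<in> carrier K" and "m \<in> span_ring y" "m' \<in> span_ring y" shows "m \<oplus> m' \<in> span_ring y"
proof -
  obtain n n' where "m \<in> poly_span y n" "m' \<in> poly_span y n'" using assms by (auto simp: span_ring_def)
  then have "m \<oplus> m' \<in> poly_span y (max n n')" by (intro span_add[OF y]) (auto intro: span_mono[OF y])
  then show ?thesis by (rule span_ringI)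
qed
lemma span_ring_scale: "y \<in> carrier K \<Longrightarrow> d \<in> D \<Longrightarrow> m \<in> span_ring y \<Longrightarrow> d \<otimes> m \<in> span_ring y"
  by (auto simp: span_ring_def intro: span_scale)
lemma span_ring_zero: "y \<in> carrier K \<Longrightarrow> \<zero> \<in> span_ring y"
  using span_zero[of y 0] by (rule span_ringI)
lemma span_ring_minus:
  assumes y: "y \<in> carrier K" and "m \<in> span_ring y" "m' \<in> span_ring y" shows "m \<ominus> m' \<in> span_ring y"
proof -
  have "m \<ominus> m' = m \<oplus> (\<ominus> \<one>) \<otimes> m'" using assms span_ring_carrier by (simp add: a_minus_def l_minus)
  then show ?thesis using span_ring_add[OF y assms(2) span_ring_scale[OF y D_neg[OF D_one] assms(3)]] by simp
qed

text \<open>Akizuki's argument: D[y]/aD[y] is finitely generated locally at Q, which yields a polynomial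
  relation for y in which the coefficient u of y^n is outside Q; l collects the lower terms and
  y^(n + 1) h the higher ones.\<close>

lemma unit_coefficient_relation:
  assumes a: "a \<in> D" "a \<noteq> \<zero>" and y: "y \<in> carrier K" and ay: "a \<otimes> y \<in> D"
  shows "\<exists>n k. \<exists>u \<in> S. \<exists>l \<in> poly_span y n. \<exists>h \<in> poly_span y k. u \<otimes> y [^] n = l \<oplus> y [^] Suc n \<otimes> h"
proof (cases "a \<in> S")
  case True
  \<comment> \<open>For a in S, the membership a y \<in> D is already such a relation, with n = 1, u
    = a and no higher terms.\<close>
  have "a \<otimes> y [^] (1::nat) = a \<otimes> y \<oplus> y [^] Suc 1 \<otimes> \<zero>" using a(1) y D_carrier[OF a(1)] by simp
  then show ?thesis using True span_D[OF y ay, of 0] span_zero[OF y, of 0]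
    by (intro exI[of _ 1] exI[of _ 0] bexI[of _ a] bexI[of _ "a \<otimes> y"] bexI[of _ \<zero>]) auto
next
  case False
  let ?B = "span_ring y"
  have ac: "a \<in> carrier K" using a D_carrier by simp
  obtain \<alpha> where al: "\<alpha> \<in> carrier R" "a = \<phi> \<alpha>" using a(1) by (auto simp: D_def)
  have alQ: "\<alpha> \<in> Q" "\<alpha> \<notin> P" using False al a(2) by (auto simp: S_def kernel)
  have Pid: "ideal P R" using R.primeideal_ideal[OF P_prime] .
  define Y where "Y = (\<lambda>n::nat. {r \<in> carrier R. \<phi> r \<in> (\<lambda>m. a [^] n \<otimes> m) ` ?B})"
  have Yid: "ideal (Y n) R" for n unfolding Y_def
  proof (rule preimage_ideal)
    show "\<zero> \<in> (\<lambda>m. a [^] n \<otimes> m) ` ?B" using span_ring_zero[OF y] ac by (intro image_eqI[of _ _ \<zero>]) auto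
    fix m m' assume "m \<in> (\<lambda>m. a [^] n \<otimes> m) ` ?B" "m' \<in> (\<lambda>m. a [^] n \<otimes> m) ` ?B"
    then obtain z z' where z: "m = a [^] n \<otimes> z" "m' = a [^] n \<otimes> z'" "z \<in> ?B" "z' \<in> ?B" by auto
    then have "m \<oplus> m' = a [^] n \<otimes> (z \<oplus> z')" using ac span_ring_carrier[OF y] by (simp add: r_distr)
    then show "m \<oplus> m' \<in> (\<lambda>m. a [^] n \<otimes> m) ` ?B" using span_ring_add[OF y z(3,4)] by simp
  next
    fix d m assume d: "d \<in> D" and "m \<in> (\<lambda>m. a [^] n \<otimes> m) ` ?B"
    then obtain z where z: "m = a [^] n \<otimes> z" "z \<in> ?B" by auto
    then have "d \<otimes> m = a [^] n \<otimes> (d \<otimes> z)" using ac span_ring_carrier[OF y] D_carrier[OF d] by (simp add: m_ac)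
    then show "d \<otimes> m \<in> (\<lambda>m. a [^] n \<otimes> m) ` ?B" using span_ring_scale[OF y d z(2)] by simp
  qed
  have Ymono: "Y (Suc n) \<subseteq> Y n" for n
  proof
    fix r assume "r \<in> Y (Suc n)"
    then obtain z where z: "r \<in> carrier R" "\<phi> r = a [^] Suc n \<otimes> z" "z \<in> ?B" by (auto simp: Y_def)
    then have "\<phi> r = a [^] n \<otimes> (a \<otimes> z)" using ac span_ring_carrier[OF y] by (simp add: m_assoc)
    then show "r \<in> Y n" using z(1) span_ring_scale[OF y a(1) z(3)] by (auto simp: Y_def)
  qed
  have PY: "P \<subseteq> Y n" for n
  proof
    fix r assume "r \<in> P"
    then have "r \<in> carrier R" "\<phi> r = a [^] n \<otimes> \<zero>" using R.ideal_subset[OF Pid] kernel ac by auto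
    then show "r \<in> Y n" using span_ring_zero[OF y] by (auto simp: Y_def)
  qed
  \<comment> \<open>Y n is the preimage of a^n D[y]. Adding \<alpha> places the chain above P +
    R\<alpha>, and a prime between this ideal and Q can only be Q because \<alpha> \<in> Q - P; the
    descending chain condition at Q becomes applicable.\<close>
  define E where "E = (\<lambda>n. adjoin R (Y n) \<alpha>)"
  have "\<exists>k. \<forall>n\<ge>k. \<forall>g \<in> E n. \<exists>t \<in> carrier R - Q. t \<otimes>\<^bsub>R\<^esub> g \<in> E (Suc n)"
  proof (rule R.descending_chain_locally_stable[OF Q_prime])
    show "ideal (adjoin R P \<alpha>) R" by (rule R.adjoin_ideal[OF Pid al(1)])
    show "Q' = Q" if "primeideal Q' R" "adjoin R P \<alpha> \<subseteq> Q'" "Q' \<subseteq> Q" for Q'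
      using that between[of Q'] R.adjoin_superset[OF Pid al(1)] R.adjoin_self[OF Pid al(1)] alQ by auto
    show "ideal (E n) R" for n unfolding E_def by (rule R.adjoin_ideal[OF Yid al(1)])
    show "E (Suc n) \<subseteq> E n" for n unfolding E_def adjoin_def using Ymono by blast
    show "adjoin R P \<alpha> \<subseteq> E n" for n unfolding E_def adjoin_def using PY by blast
  qed
  then obtain k where k: "\<And>n g. n \<ge> k \<Longrightarrow> g \<in> E n \<Longrightarrow> \<exists>t \<in> carrier R - Q. t \<otimes>\<^bsub>R\<^esub> g \<in> E (Suc n)" by metis
  \<comment> \<open>Modulo a D[y] and up to multipliers in S, denominators a^(k+m) of elements of
    D[y] can be lowered to a^k. One step of the chain writes t a^(k+m+1) \<gamma> as a^(k+m+2)
    \<beta>' + r a; cancelling a shows that \<gamma>' = t \<gamma> - a \<beta>' has denominator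
    a^(k+m).\<close>
  have reduce: "\<exists>t \<in> S. \<exists>h \<in> ?B. \<exists>\<beta> \<in> ?B. a [^] k \<otimes> h \<in> D \<and> t \<otimes> \<gamma> = h \<oplus> a \<otimes> \<beta>"
    if "\<gamma> \<in> ?B" "a [^] (k + m) \<otimes> \<gamma> \<in> D" for m \<gamma>
    using that
  proof (induction m arbitrary: \<gamma>)
    case 0
    have "\<one> \<otimes> \<gamma> = \<gamma> \<oplus> a \<otimes> \<zero>" using ac span_ring_carrier[OF y 0(1)] by simp
    then show ?case using S_one 0 span_ring_zero[OF y] by (intro bexI[of _ \<one>] bexI[of _ \<gamma>] bexI[of _ \<zero>]) auto
  next
    case (Suc m)
    have gc: "\<gamma> \<in> carrier K" using span_ring_carrier[OF y Suc.prems(1)] .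
    obtain g where g: "g \<in> carrier R" "a [^] (k + Suc m) \<otimes> \<gamma> = \<phi> g" using Suc.prems(2) by (auto simp: D_def)
    have "\<phi> g = a [^] (k + Suc m) \<otimes> \<gamma>" using g(2) by simp
    then have "g \<in> Y (k + Suc m)" using g(1) Suc.prems(1) unfolding Y_def by blast
    then have "g \<in> E (k + Suc m)" unfolding E_def using R.adjoin_superset[OF Yid al(1)] by auto
    then obtain t where t: "t \<in> carrier R - Q" "t \<otimes>\<^bsub>R\<^esub> g \<in> E (Suc (k + Suc m))" using k[of "k + Suc m" g] by auto
    then obtain g' r where gr: "g' \<in> Y (Suc (k + Suc m))" "r \<in> carrier R" "t \<otimes>\<^bsub>R\<^esub> g = g' \<oplus>\<^bsub>R\<^esub> r \<otimes>\<^bsub>R\<^esub> \<alpha>"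
      by (auto simp: E_def adjoin_def)
    then obtain \<beta>' where b: "g' \<in> carrier R" "\<beta>' \<in> ?B" "\<phi> g' = a [^] Suc (k + Suc m) \<otimes> \<beta>'" by (auto simp: Y_def)
    have bc: "\<beta>' \<in> carrier K" using span_ring_carrier[OF y b(2)] .
    have tS: "\<phi> t \<in> S" using t by (auto simp: S_def)
    have tc: "\<phi> t \<in> carrier K" "\<phi> r \<in> carrier K" using hom_closed t gr by auto
    define \<gamma>' where "\<gamma>' = \<phi> t \<otimes> \<gamma> \<ominus> a \<otimes> \<beta>'"
    have gB: "\<gamma>' \<in> ?B" unfolding \<gamma>'_def
      using span_ring_minus[OF y span_ring_scale[OF y S_D[OF tS] Suc.prems(1)] span_ring_scale[OF y a(1) b(2)]] .
    have gc': "\<gamma>' \<in> carrier K" using span_ring_carrier[OF y gB] .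
    have "\<phi> t \<otimes> (a [^] (k + Suc m) \<otimes> \<gamma>) = \<phi> (t \<otimes>\<^bsub>R\<^esub> g)" using g t by (simp add: hom_mult)
    also have "\<dots> = a [^] Suc (k + Suc m) \<otimes> \<beta>' \<oplus> \<phi> r \<otimes> a"
      using gr(2,3) b(1,3) al by (simp add: hom_add hom_mult)
    finally have e1: "\<phi> t \<otimes> (a [^] (k + Suc m) \<otimes> \<gamma>) = a [^] Suc (k + Suc m) \<otimes> \<beta>' \<oplus> \<phi> r \<otimes> a" .
    have "a \<otimes> (a [^] (k + m) \<otimes> \<gamma>') = \<phi> t \<otimes> (a [^] (k + Suc m) \<otimes> \<gamma>) \<ominus> a [^] Suc (k + Suc m) \<otimes> \<beta>'"
      using ac gc bc tc by (simp add: \<gamma>'_def a_minus_def r_distr r_minus m_ac)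
    also have "\<dots> = a \<otimes> \<phi> r" unfolding e1 using ac bc tc by (simp add: a_minus_def a_ac m_comm r_neg r_neg1)
    finally have "a [^] (k + m) \<otimes> \<gamma>' = \<phi> r" using ac a(2) gc' tc m_lcancel[of a] by simp
    then have "a [^] (k + m) \<otimes> \<gamma>' \<in> D" using gr(2) by (simp add: D_def)
    then obtain t' h \<beta> where th: "t' \<in> S" "h \<in> ?B" "\<beta> \<in> ?B" "a [^] k \<otimes> h \<in> D" "t' \<otimes> \<gamma>' = h \<oplus> a \<otimes> \<beta>"
      using Suc.IH[OF gB] by auto
    have thc: "t' \<in> carrier K" "h \<in> carrier K" "\<beta> \<in> carrier K"
      using S_carrier[OF th(1)] span_ring_carrier[OF y] th by auto
    have "t' \<otimes> \<gamma>' = (t' \<otimes> \<phi> t) \<otimes> \<gamma> \<ominus> a \<otimes> (t' \<otimes> \<beta>')"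
      using ac gc bc tc thc by (simp add: \<gamma>'_def a_minus_def r_distr r_minus m_ac)
    then have "(t' \<otimes> \<phi> t) \<otimes> \<gamma> = t' \<otimes> \<gamma>' \<oplus> a \<otimes> (t' \<otimes> \<beta>')"
      using ac gc bc tc thc by (simp add: a_minus_def a_assoc l_neg)
    also have "\<dots> = h \<oplus> a \<otimes> (\<beta> \<oplus> t' \<otimes> \<beta>')" unfolding th(5) using ac bc thc by (simp add: r_distr a_ac)
    finally show ?case
      using S_mult[OF th(1) tS] th(2,4) span_ring_add[OF y th(3) span_ring_scale[OF y S_D[OF th(1)] b(2)]]
      by (intro bexI[of _ "t' \<otimes> \<phi> t"] bexI[of _ h] bexI[of _ "\<beta> \<oplus> t' \<otimes> \<beta>'"]) auto
  qed
  \<comment> \<open>The h in D[y] with a^k h \<in> D all lie in one \<open>poly_span y n0\<close>: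
    the products a^k h, sorted by the length of h, pull back to an ascending chain of
    ideals.\<close>
  define Z where "Z = (\<lambda>j. {r \<in> carrier R. \<exists>m \<in> poly_span y j. \<phi> r = a [^] k \<otimes> m})"
  have "\<exists>n0. \<forall>n. Z n \<subseteq> Z n0"
  proof (rule R.ascending_ideals_stabilise)
    show "ideal (Z n) R" for n unfolding Z_def by (rule scaled_span_preimage_ideal[OF y]) (use ac in simp)
    show "Z n \<subseteq> Z (Suc n)" for n unfolding Z_def using span_Suc[OF y] by auto
  qed
  then obtain n0 where n0: "\<And>n. Z n \<subseteq> Z n0" by auto
  have bounded: "h \<in> poly_span y n0" if h: "h \<in> ?B" "a [^] k \<otimes> h \<in> D" for h
  proof -
    obtain n where n: "h \<in> poly_span y n" using h(1) by (auto simp: span_ring_def)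
    obtain r where r: "r \<in> carrier R" "a [^] k \<otimes> h = \<phi> r" using h(2) by (auto simp: D_def)
    then have "r \<in> Z n" using n r(2)[symmetric] by (auto simp: Z_def)
    then have "r \<in> Z n0" using n0 by auto
    then obtain m where m: "m \<in> poly_span y n0" "\<phi> r = a [^] k \<otimes> m" by (auto simp: Z_def)
    then have "h = m" using r(2) ac pow_nonzero[OF ac a(2), of k] span_carrier[OF y] n
      m_lcancel[of "a [^] k" h m] by auto
    then show ?thesis using m by simp
  qed
  \<comment> \<open>The reduction is applied to y^n0 itself, whose denominator is a^n0 because a y
    \<in> D. The representative h then involves only powers below y^n0.\<close>
  have yB: "y [^] n0 \<in> ?B"
    using span_monomial[OF y D_one, of n0] y by (intro span_ringI[of _ _ "Suc n0"]) simp
  have "a [^] (k + n0) \<otimes> y [^] n0 = a [^] k \<otimes> (a \<otimes> y) [^] n0"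
    using ac y by (simp add: nat_pow_mult[symmetric] nat_pow_distrib m_ac)
  then have "a [^] (k + n0) \<otimes> y [^] n0 \<in> D" using D_mult D_pow a ay by simp
  then obtain t h \<beta> where th: "t \<in> S" "h \<in> ?B" "\<beta> \<in> ?B" "a [^] k \<otimes> h \<in> D" "t \<otimes> y [^] n0 = h \<oplus> a \<otimes> \<beta>"
    using reduce[OF yB, of n0] by auto
  have hn: "h \<in> poly_span y n0" using bounded th by simp
  obtain j where j: "\<beta> \<in> poly_span y j" using th(3) by (auto simp: span_ring_def)
  \<comment> \<open>The coefficient d of y^n0 in \<beta> is to be moved to the left, where it
    changes t into t - a d. This remains in S, since a comes from an element of Q and t from one
    outside Q.\<close>
  obtain l r where lr: "l \<in> poly_span y (Suc n0)" "r \<in> poly_span y j" "\<beta> = l \<oplus> y [^] Suc n0 \<otimes> r"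
    using span_split[OF y j, of "Suc n0"] by auto
  obtain l' d where l': "l' \<in> poly_span y n0" "d \<in> D" "l = l' \<oplus> d \<otimes> y [^] n0"
    using span_Suc_split[OF y lr(1)] by auto
  have car: "t \<in> carrier K" "h \<in> carrier K" "l' \<in> carrier K" "r \<in> carrier K" "d \<in> carrier K" "\<beta> \<in> carrier K"
    using S_carrier[OF th(1)] span_carrier[OF y] hn l'(1) lr(2) j D_carrier[OF l'(2)] by auto
  have "(t \<ominus> a \<otimes> d) \<otimes> y [^] n0 = t \<otimes> y [^] n0 \<ominus> (a \<otimes> d) \<otimes> y [^] n0"
    using car ac y by (simp add: a_minus_def l_distr l_minus)
  also have "t \<otimes> y [^] n0 = (h \<oplus> a \<otimes> l') \<oplus> y [^] Suc n0 \<otimes> (a \<otimes> r) \<oplus> (a \<otimes> d) \<otimes> y [^] n0"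
    unfolding th(5) lr(3) l'(3) using car ac y by (simp add: r_distr m_ac a_ac)
  also have "\<dots> \<ominus> (a \<otimes> d) \<otimes> y [^] n0 = (h \<oplus> a \<otimes> l') \<oplus> y [^] Suc n0 \<otimes> (a \<otimes> r)"
    using car ac y by (simp add: a_minus_def a_assoc r_neg)
  finally have rel: "(t \<ominus> a \<otimes> d) \<otimes> y [^] n0 = (h \<oplus> a \<otimes> l') \<oplus> y [^] Suc n0 \<otimes> (a \<otimes> r)" .
  have uS: "t \<ominus> a \<otimes> d \<in> S"
  proof -
    obtain \<tau> where tau: "\<tau> \<in> carrier R" "\<tau> \<notin> Q" "t = \<phi> \<tau>" using th(1) by (auto simp: S_def)
    obtain \<delta> where del: "\<delta> \<in> carrier R" "d = \<phi> \<delta>" using l'(2) by (auto simp: D_def)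
    have Qid: "ideal Q R" using R.primeideal_ideal[OF Q_prime] .
    have ad: "\<alpha> \<otimes>\<^bsub>R\<^esub> \<delta> \<in> Q" using R.ideal_mult_r[OF Qid alQ(1) del(1)] .
    have "\<tau> \<ominus>\<^bsub>R\<^esub> \<alpha> \<otimes>\<^bsub>R\<^esub> \<delta> \<notin> Q"
    proof
      assume "\<tau> \<ominus>\<^bsub>R\<^esub> \<alpha> \<otimes>\<^bsub>R\<^esub> \<delta> \<in> Q"
      then have "(\<tau> \<ominus>\<^bsub>R\<^esub> \<alpha> \<otimes>\<^bsub>R\<^esub> \<delta>) \<oplus>\<^bsub>R\<^esub> \<alpha> \<otimes>\<^bsub>R\<^esub> \<delta> \<in> Q" using R.ideal_add[OF Qid _ ad] by simp
      moreover have "(\<tau> \<ominus>\<^bsub>R\<^esub> \<alpha> \<otimes>\<^bsub>R\<^esub> \<delta>) \<oplus>\<^bsub>R\<^esub> \<alpha> \<otimes>\<^bsub>R\<^esub> \<delta> = \<tau>"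
        using tau(1) del(1) al(1) by (simp add: a_minus_def R.a_assoc R.l_neg)
      ultimately show False using tau by simp
    qed
    moreover have "\<phi> (\<tau> \<ominus>\<^bsub>R\<^esub> \<alpha> \<otimes>\<^bsub>R\<^esub> \<delta>) = t \<ominus> a \<otimes> d" using tau del al by (simp add: hom_minus hom_mult)
    ultimately show ?thesis unfolding S_def using tau(1) del(1) al(1)
      by (intro image_eqI[of _ _ "\<tau> \<ominus>\<^bsub>R\<^esub> \<alpha> \<otimes>\<^bsub>R\<^esub> \<delta>"]) auto
  qed
  show ?thesis
    using uS rel span_add[OF y hn span_scale[OF y a(1) l'(1)]] span_scale[OF y a(1) lr(2)]
    by (intro exI[of _ n0] exI[of _ j] bexI[of _ "t \<ominus> a \<otimes> d"] bexI[of _ "h \<oplus> a \<otimes> l'"] bexI[of _ "a \<otimes> r"]) auto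
qed

text \<open>Put y = b/a, take a relation u y^n = l + y^(n+1) h with u in S, and let A = u - y h.
  Then y^n A = l, so the relation controls high powers of y times h as well as times A, and h, y h,
  A, y A are almost integral. Since A + y h = u, the elements A/(u a) and h/(u a) are the
  coefficients sought.\<close>

lemma two_generated_invertible:
  assumes a: "a \<in> D" "a \<noteq> \<zero>" and b: "b \<in> D"
  shows "\<exists>g \<in> carrier K. \<exists>h \<in> carrier K. g \<otimes> a \<oplus> h \<otimes> b = \<one> \<and>
    almost_integral (g \<otimes> a) \<and> almost_integral (g \<otimes> b) \<and> almost_integral (h \<otimes> a) \<and> almost_integral (h \<otimes> b)"
proof -
  have car: "a \<in> carrier K" "b \<in> carrier K" "inv a \<in> carrier K" using a b D_carrier inv_closed' by auto
  define y where "y = b \<otimes> inv a"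
  have y: "y \<in> carrier K" using car by (simp add: y_def)
  have yab: "a \<otimes> y = b" using car inv_right[OF car(1) a(2)] m_lcomm[of a b "inv a"] by (simp add: y_def)
  then have ay: "a \<otimes> y \<in> D" using b by simp
  obtain n k u l h where ul: "u \<in> S" "l \<in> poly_span y n" "h \<in> poly_span y k"
      "u \<otimes> y [^] n = l \<oplus> y [^] Suc n \<otimes> h"
    using unit_coefficient_relation[OF a y ay] by blast
  have uc: "u \<in> carrier K" "l \<in> carrier K" "h \<in> carrier K" using S_carrier[OF ul(1)] span_carrier[OF y] ul by auto
  \<comment> \<open>The products y^i h with i \<le> n and y^i A with i < n have length at most n +
    k. For larger i the relation brings both back to length i \<le> N. The summand 1 keeps N
    positive.\<close>
  define N where "N = n + k + 1"
  define A where "A = u \<ominus> y \<otimes> h"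
  have Ac: "A \<in> carrier K" using uc y by (simp add: A_def)
  have hgood: "almost_integral h" "almost_integral (y \<otimes> h)"
  proof -
    have "y [^] i \<otimes> h \<in> poly_span y N" if i: "i \<le> N" for i
    proof (cases "i \<le> n")
      case True
      then show ?thesis using span_mono[OF y span_y_pow[OF y ul(3)]] by (simp add: N_def)
    next
      case False
      define j where "j = i - Suc n"
      have ij: "i = j + Suc n" using False by (simp add: j_def)
      have "y [^] Suc n \<otimes> h = u \<otimes> y [^] n \<ominus> l"
        unfolding ul(4) using uc y by (simp add: a_minus_def a_ac r_neg1 r_neg2)
      moreover have "u \<otimes> y [^] n \<ominus> l \<in> poly_span y (Suc n)"
        using span_minus[OF y span_monomial[OF y S_D[OF ul(1)]] span_Suc[OF y ul(2)]] .
      ultimately have "y [^] Suc n \<otimes> h \<in> poly_span y (Suc n)" by metis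
      then have "y [^] j \<otimes> (y [^] Suc n \<otimes> h) \<in> poly_span y (Suc n + j)" by (rule span_y_pow[OF y])
      moreover have "y [^] j \<otimes> (y [^] Suc n \<otimes> h) = y [^] i \<otimes> h"
        using uc y nat_pow_mult[OF y, of j "Suc n"] by (simp add: ij m_assoc[symmetric])
      ultimately show ?thesis using span_mono[OF y, of _ "Suc n + j" N] i ij by simp
    qed
    from almost_integral_if_powers_stable[OF y a ay _ uc(3) this] show "almost_integral h" "almost_integral (y \<otimes> h)" by (simp_all add: N_def)
  qed
  have Agood: "almost_integral A" "almost_integral (y \<otimes> A)"
  proof -
    have yA: "y [^] n \<otimes> A = l"
    proof -
      have "y [^] n \<otimes> A = u \<otimes> y [^] n \<ominus> y [^] Suc n \<otimes> h"
        using uc y by (simp add: A_def a_minus_def r_distr r_minus m_ac)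
      then show ?thesis unfolding ul(4) using uc y by (simp add: a_minus_def a_assoc r_neg)
    qed
    have Ak: "A \<in> poly_span y (Suc k)"
      unfolding A_def using span_minus[OF y span_D[OF y S_D[OF ul(1)]] span_y[OF y ul(3)]] .
    have "y [^] i \<otimes> A \<in> poly_span y N" if i: "i \<le> N" for i
    proof (cases "i < n")
      case True
      then show ?thesis using span_mono[OF y span_y_pow[OF y Ak]] by (simp add: N_def)
    next
      case False
      define j where "j = i - n"
      have ij: "i = j + n" using False by (simp add: j_def)
      have "y [^] i \<otimes> A = y [^] j \<otimes> l"
        using Ac y by (simp add: ij nat_pow_mult[OF y, of j n, symmetric] m_assoc yA[symmetric])
      then show ?thesis using span_mono[OF y span_y_pow[OF y ul(2), of j], of N] i ij by simp
    qed
    from almost_integral_if_powers_stable[OF y a ay _ Ac this] show "almost_integral A" "almost_integral (y \<otimes> A)" by (simp_all add: N_def)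
  qed
  have un: "u \<noteq> \<zero>" using S_nonzero[OF ul(1)] .
  have iu: "inv u \<in> carrier K" "u \<otimes> inv u = \<one>" using inv_closed'[OF uc(1) un] inv_right[OF uc(1) un] by auto
  have ia: "a \<otimes> inv a = \<one>" using inv_right[OF car(1) a(2)] .
  define g where "g = A \<otimes> inv u \<otimes> inv a"
  define h' where "h' = h \<otimes> inv u \<otimes> inv a"
  have ga: "g \<otimes> a = A \<otimes> inv u" "h' \<otimes> a = h \<otimes> inv u"
    using Ac uc iu car ia by (simp_all add: g_def h'_def m_assoc m_comm[of "inv a" a])
  have gb: "g \<otimes> b = (y \<otimes> A) \<otimes> inv u" "h' \<otimes> b = (y \<otimes> h) \<otimes> inv u"
  proof -
    have "g \<otimes> b = (g \<otimes> a) \<otimes> y" "h' \<otimes> b = (h' \<otimes> a) \<otimes> y"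
      unfolding yab[symmetric] using Ac uc iu car y by (simp_all add: g_def h'_def m_assoc)
    then show "g \<otimes> b = (y \<otimes> A) \<otimes> inv u" "h' \<otimes> b = (y \<otimes> h) \<otimes> inv u"
      unfolding ga using Ac uc iu y by (simp_all add: m_ac)
  qed
  have "A \<oplus> y \<otimes> h = u" using uc y by (simp add: A_def a_minus_def a_assoc l_neg)
  then have "g \<otimes> a \<oplus> h' \<otimes> b = \<one>"
    unfolding ga gb using Ac uc iu y l_distr[of A "y \<otimes> h" "inv u"] by simp
  moreover have "almost_integral (g \<otimes> a)" "almost_integral (g \<otimes> b)" "almost_integral (h' \<otimes> a)" "almost_integral (h' \<otimes> b)"
    unfolding ga gb using almost_integral_mult almost_integral_inv[OF ul(1)] hgood Agood by auto
  moreover have "g \<in> carrier K" "h' \<in> carrier K" using Ac uc iu car by (auto simp: g_def h'_def)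
  ultimately show ?thesis by blast
qed

end

section \<open>Inverse modules, integral relations from Frobenius powers, and tight closure at
  Q\<close>

context adjacent_primes
begin

text \<open>The fractional inverse of the ideal generated by F over the ring of almost integral elements; that
  1 lies in trace_sums F means that this ideal is invertible.\<close>

definition inverse_module where
  "inverse_module F = {h \<in> carrier K. \<forall>\<alpha> \<in> F. almost_integral (h \<otimes> \<alpha>)}"

inductive_set trace_sums for F where
  zero: "\<zero> \<in> trace_sums F"
| step: "h \<in> inverse_module F \<Longrightarrow> \<alpha> \<in> F \<Longrightarrow> s \<in> trace_sums F \<Longrightarrow> h \<otimes> \<alpha> \<oplus> s \<in> trace_sums F"

lemma trace_sums_carrier: "s \<in> trace_sums F \<Longrightarrow> F \<subseteq> D \<Longrightarrow> s \<in> carrier K"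
  by (induction rule: trace_sums.induct) (auto simp: inverse_module_def D_carrier)

text \<open>When b joins F, each term h \<alpha> of a sum equal to 1 is multiplied by 1 = g \<alpha>
  + g' b, an identity furnished by the ideal generated by \<alpha> and b. The new coefficients h
  \<alpha> g and h \<alpha> g' belong to the inverse of the larger ideal.\<close>

lemma one_in_trace_sums:
  assumes "finite F" "F \<noteq> {}" "F \<subseteq> D - {\<zero>}"
  shows "\<one> \<in> trace_sums F"
  using assms
proof (induction F rule: finite_ne_induct)
  case (singleton a)
  then have a: "a \<in> carrier K" "a \<noteq> \<zero>" using D_carrier by auto
  have ia: "inv a \<otimes> a = \<one>" using inv_right[OF a] inv_closed'[OF a] a m_comm by metis
  have "inv a \<in> inverse_module {a}" using inv_closed'[OF a] almost_integral_D[OF D_one] ia by (simp add: inverse_module_def)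
  from trace_sums.step[OF this singletonI trace_sums.zero] show ?case using ia by simp
next
  case (insert b F)
  have "s \<in> trace_sums (insert b F)" if "s \<in> trace_sums F" for s
    using that
  proof (induction rule: trace_sums.induct)
    case zero
    then show ?case by (rule trace_sums.zero)
  next
    case (step h \<alpha> s)
    have \<alpha>: "\<alpha> \<in> D" "\<alpha> \<noteq> \<zero>" "b \<in> D" and FD: "F \<subseteq> D" using step.hyps insert.prems by auto
    obtain g g' where g: "g \<in> carrier K" "g' \<in> carrier K" "g \<otimes> \<alpha> \<oplus> g' \<otimes> b = \<one>"
      "almost_integral (g \<otimes> \<alpha>)" "almost_integral (g \<otimes> b)" "almost_integral (g' \<otimes> \<alpha>)" "almost_integral (g' \<otimes> b)"
      using two_generated_invertible[OF \<alpha>] by auto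
    have h: "h \<in> carrier K" "\<And>\<beta>. \<beta> \<in> F \<Longrightarrow> almost_integral (h \<otimes> \<beta>)" using step.hyps by (auto simp: inverse_module_def)
    have car: "\<alpha> \<in> carrier K" "b \<in> carrier K" "s \<in> carrier K"
      using \<alpha> D_carrier trace_sums_carrier[OF step.hyps(3) FD] by auto
    \<comment> \<open>For \<beta> in F the two generators are exchanged: (h \<alpha>)(k \<beta>) =
      (h \<beta>)(k \<alpha>), where the first factor is almost integral by the choice of h and the
      second by that of k.\<close>
    have im: "h \<otimes> \<alpha> \<otimes> k \<in> inverse_module (insert b F)" if k: "k \<in> carrier K" "almost_integral (k \<otimes> \<alpha>)" "almost_integral (k \<otimes> b)" for k
    proof -
      have "almost_integral (h \<otimes> \<alpha> \<otimes> k \<otimes> \<beta>)" if \<beta>: "\<beta> \<in> insert b F" for \<beta>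
      proof (cases "\<beta> = b")
        case True
        have "h \<otimes> \<alpha> \<otimes> k \<otimes> \<beta> = (h \<otimes> \<alpha>) \<otimes> (k \<otimes> b)" using True h(1) car k(1) by (simp add: m_assoc)
        then show ?thesis using almost_integral_mult[OF h(2)[OF step.hyps(2)] k(3)] by simp
      next
        case False
        then have \<beta>F: "\<beta> \<in> F" "\<beta> \<in> carrier K" using \<beta> FD D_carrier by auto
        have "h \<otimes> \<alpha> \<otimes> k \<otimes> \<beta> = (h \<otimes> \<beta>) \<otimes> (k \<otimes> \<alpha>)" using \<beta>F(2) h(1) car k(1) by (simp add: m_ac)
        then show ?thesis using almost_integral_mult[OF h(2)[OF \<beta>F(1)] k(2)] by simp
      qed
      then show ?thesis using h(1) car k(1) by (simp add: inverse_module_def)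
    qed
    have "h \<otimes> \<alpha> = h \<otimes> \<alpha> \<otimes> (g \<otimes> \<alpha> \<oplus> g' \<otimes> b)" using g(3) h(1) car by simp
    also have "\<dots> = (h \<otimes> \<alpha> \<otimes> g) \<otimes> \<alpha> \<oplus> (h \<otimes> \<alpha> \<otimes> g') \<otimes> b"
      using g(1,2) h(1) car by (simp add: r_distr m_assoc)
    finally have "h \<otimes> \<alpha> \<oplus> s = ((h \<otimes> \<alpha> \<otimes> g) \<otimes> \<alpha> \<oplus> (h \<otimes> \<alpha> \<otimes> g') \<otimes> b) \<oplus> s"
      by (rule arg_cong[where f = "\<lambda>u. u \<oplus> s"])
    also have "\<dots> = (h \<otimes> \<alpha> \<otimes> g) \<otimes> \<alpha> \<oplus> ((h \<otimes> \<alpha> \<otimes> g') \<otimes> b \<oplus> s)"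
      using g(1,2) h(1) car by (simp add: a_assoc)
    finally have "h \<otimes> \<alpha> \<oplus> s = (h \<otimes> \<alpha> \<otimes> g) \<otimes> \<alpha> \<oplus> ((h \<otimes> \<alpha> \<otimes> g') \<otimes> b \<oplus> s)" .
    moreover have "(h \<otimes> \<alpha> \<otimes> g) \<otimes> \<alpha> \<oplus> ((h \<otimes> \<alpha> \<otimes> g') \<otimes> b \<oplus> s) \<in> trace_sums (insert b F)"
      by (intro trace_sums.step im g step.IH) (use step.hyps in auto)
    ultimately show ?case by simp
  qed
  moreover have "\<one> \<in> trace_sums F" using insert by auto
  ultimately show ?case by simp
qed

text \<open>All powers of w z stay in the span of 1, ..., z^(N - 1): multiplying by z may create a
  leading term d z^N, which the accompanying factor w turns into d (w z^N), again in the span. A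
  power of a denominator of z clears the span, and w serves as the multiplier f.\<close>

lemma integral_relation_almost_integral:
  assumes z: "z \<in> carrier K" and w: "w \<in> S" and N: "N > 0" and rel: "w \<otimes> z [^] N \<in> poly_span z N"
  shows "almost_integral z"
proof -
  have wc: "w \<in> carrier K" "w \<in> D" using w S_carrier S_D by auto
  obtain \<gamma> \<zeta> where g: "\<gamma> \<in> carrier R" "\<gamma> \<notin> P" "\<zeta> \<in> carrier R" "\<phi> \<gamma> \<otimes> z = \<phi> \<zeta>" using fraction[OF z] by auto
  have gD: "\<phi> \<gamma> \<in> D" "\<phi> \<gamma> \<noteq> \<zero>" "\<phi> \<gamma> \<otimes> z \<in> D" using g kernel by (auto simp: D_def)
  have "(w \<otimes> z) [^] n \<in> poly_span z N" for n :: nat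
  proof (induction n)
    case 0
    then show ?case using span_D[OF z D_one, of "N - 1"] N by simp
  next
    case (Suc n)
    obtain l d where ld: "l \<in> poly_span z N" "d \<in> D" "z \<otimes> (w \<otimes> z) [^] n = l \<oplus> d \<otimes> z [^] N"
      using span_Suc_split[OF z span_y[OF z Suc]] by auto
    have "(w \<otimes> z) [^] Suc n = w \<otimes> (z \<otimes> (w \<otimes> z) [^] n)" using wc z by (simp add: m_ac)
    also have "\<dots> = w \<otimes> l \<oplus> d \<otimes> (w \<otimes> z [^] N)"
      unfolding ld(3) using wc z span_carrier[OF z ld(1)] D_carrier[OF ld(2)] by (simp add: r_distr m_ac)
    also have "\<dots> \<in> poly_span z N"
      using span_add[OF z span_scale[OF z wc(2) ld(1)] span_scale[OF z ld(2) rel]] .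
    finally show ?case .
  qed
  then have "\<phi> \<gamma> [^] N \<otimes> (w \<otimes> z) [^] n \<in> D" for n :: nat using span_denominator[OF z gD(1,3)] by simp
  then show ?thesis using z w D_pow gD pow_nonzero D_carrier by (intro almost_integralI[of _ w "\<phi> \<gamma> [^] N"]) auto
qed

text \<open>The multiples by c of the spans of length p^e, intersected with D, pull back to an
  ascending chain of ideals; let it be stationary at N = p^e. The element w z^N has length N + 1
  \<le> p N, so it occurs at the next stage and therefore already in length N, which is an integral
  relation for z up to w. A single exponent e is used, so the dependence of w on e does no
  harm.\<close>

lemma frobenius_almost_integral:
  assumes z: "z \<in> carrier K" and c: "c \<in> D" "c \<noteq> \<zero>" and w: "\<And>e::nat. w e \<in> S"
    and mem: "\<And>e. e \<ge> e0 \<Longrightarrow> c \<otimes> (w e \<otimes> z [^] (p ^ e)) \<in> D"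
  shows "almost_integral z"
proof -
  have p2: "p \<ge> 2" using p_prime by (rule prime_ge_2_nat)
  have cc: "c \<in> carrier K" using c D_carrier by simp
  define Z where "Z = (\<lambda>j. {r \<in> carrier R. \<exists>m \<in> poly_span z (p ^ (e0 + j)). \<phi> r = c \<otimes> m})"
  have "\<exists>k. \<forall>n. Z n \<subseteq> Z k"
  proof (rule R.ascending_ideals_stabilise)
    show "ideal (Z n) R" for n unfolding Z_def by (rule scaled_span_preimage_ideal[OF z cc])
    show "Z n \<subseteq> Z (Suc n)" for n
      using span_mono[OF z, of _ "p ^ (e0 + n)" "p ^ (e0 + Suc n)"] p2 by (auto simp: Z_def)
  qed
  then obtain k where k: "Z (Suc k) \<subseteq> Z k" by auto
  define N where "N = p ^ (e0 + k)"
  have N: "N > 0" unfolding N_def by (rule p_pos)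
  have "Suc N \<le> p ^ (e0 + Suc k)"
  proof -
    have "2 * N \<le> p * N" using p2 by (rule mult_right_mono) simp
    moreover have "p ^ (e0 + Suc k) = p * N" by (simp add: N_def)
    ultimately show ?thesis using N by linarith
  qed
  obtain r where r: "r \<in> carrier R" "c \<otimes> (w (e0 + k) \<otimes> z [^] N) = \<phi> r" using mem[of "e0 + k"] by (auto simp: N_def D_def)
  have "w (e0 + k) \<otimes> z [^] N \<in> poly_span z (p ^ (e0 + Suc k))"
    using span_mono[OF z span_monomial[OF z S_D[OF w]] \<open>Suc N \<le> _\<close>] .
  then have "r \<in> Z (Suc k)" using r(1) r(2)[symmetric] by (auto simp: Z_def)
  then have "r \<in> Z k" using k by auto
  then obtain m where m: "m \<in> poly_span z N" "\<phi> r = c \<otimes> m" by (auto simp: Z_def N_def)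
  have "w (e0 + k) \<otimes> z [^] N = m"
    using r(2) m cc c(2) z S_carrier[OF w] span_carrier[OF z m(1)] m_lcancel[of c "w (e0 + k) \<otimes> z [^] N" m] by auto
  then show ?thesis using integral_relation_almost_integral[OF z w[of "e0 + k"] N] m(1) by simp
qed

text \<open>For h in the inverse of the ideal generated by the images of I, multiplying the
  hypothesis by h^q brings I^[q] into D up to controlled factors, so h x is almost integral. Writing
  1 as a sum of products h \<alpha> expresses x as a sum of terms (h x) \<alpha>; taking q-th
  powers, a multiple of (f x)^q lies in I^[q] modulo P. The multipliers w e are thereby traded for
  one f.\<close>

lemma local_tight_closure:
  assumes I: "ideal I R" and x: "x \<in> carrier R" and c0: "c0 \<in> carrier R - P"
    and w: "\<And>e. w e \<in> carrier R - Q"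
    and mem: "\<And>e. e \<ge> e0 \<Longrightarrow> c0 \<otimes>\<^bsub>R\<^esub> (w e \<otimes>\<^bsub>R\<^esub> x [^]\<^bsub>R\<^esub> (p ^ e)) \<in> frob_ideal R (p ^ e) I"
  shows "\<exists>f \<in> carrier R - Q. \<exists>c \<in> carrier R - P. \<forall>e. \<exists>i \<in> frob_ideal R (p ^ e) I.
    c \<otimes>\<^bsub>R\<^esub> (f \<otimes>\<^bsub>R\<^esub> x) [^]\<^bsub>R\<^esub> (p ^ e) \<ominus>\<^bsub>R\<^esub> i \<in> P"
proof -
  note fid = R.frob_ideal_ideal[OF I]
  have Pid: "ideal P R" using R.primeideal_ideal[OF P_prime] .
  obtain A where A: "A \<subseteq> carrier R" "finite A" "I = genideal R A" using R.finetely_gen[OF I] by auto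
  have AI: "A \<subseteq> I" using R.genideal_self[OF A(1)] A(3) by simp
  define F where "F = \<phi> ` A - {\<zero>}"
  have F: "finite F" "F \<subseteq> D - {\<zero>}" using A by (auto simp: F_def D_def)
  have xc: "\<phi> x \<in> carrier K" using hom_closed[OF x] .
  show ?thesis
  proof (cases "F = {}")
    case True
    \<comment> \<open>Without a nonzero generator there is nothing to invert. But then I lies in P,
      and the hypothesis at the single exponent e0 forces x \<in> P.\<close>
    have "A \<subseteq> P" using True A(1) kernel by (auto simp: F_def)
    then have "I \<subseteq> P" using R.genideal_minimal[OF Pid] A(3) by simp
    then have "frob_ideal R (p ^ e0) I \<subseteq> P"
      by (intro R.frob_ideal_minimal[OF Pid]) (use R.ideal_pow_mem[OF Pid] p_pos in auto)
    then have "c0 \<otimes>\<^bsub>R\<^esub> (w e0 \<otimes>\<^bsub>R\<^esub> x [^]\<^bsub>R\<^esub> (p ^ e0)) \<in> P" using mem[of e0] by auto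
    moreover have "w e0 \<notin> P" using w[of e0] PQ by auto
    ultimately have "x \<in> P"
      using R.prime_mult_notin[OF P_prime] R.prime_pow_notin[OF P_prime x] c0 w[of e0] x
      by (metis DiffD1 DiffD2 R.m_closed R.nat_pow_closed)
    then have "\<one>\<^bsub>R\<^esub> \<otimes>\<^bsub>R\<^esub> (\<one>\<^bsub>R\<^esub> \<otimes>\<^bsub>R\<^esub> x) [^]\<^bsub>R\<^esub> (p ^ e) \<ominus>\<^bsub>R\<^esub> \<zero>\<^bsub>R\<^esub> \<in> P" for e
      using R.ideal_minus[OF Pid R.ideal_pow_mem[OF Pid _ p_pos] R.ideal_zero[OF Pid]] x by simp
    then have "\<forall>e. \<exists>i \<in> frob_ideal R (p ^ e) I. \<one>\<^bsub>R\<^esub> \<otimes>\<^bsub>R\<^esub> (\<one>\<^bsub>R\<^esub> \<otimes>\<^bsub>R\<^esub> x) [^]\<^bsub>R\<^esub> (p ^ e) \<ominus>\<^bsub>R\<^esub> i \<in> P"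
      using R.ideal_zero[OF fid] by auto
    moreover have "\<one>\<^bsub>R\<^esub> \<in> carrier R - P" "\<one>\<^bsub>R\<^esub> \<in> carrier R - Q"
      using R.prime_one_notin[OF P_prime] R.prime_one_notin[OF Q_prime] by auto
    ultimately show ?thesis by blast
  next
    case False
    have hx: "almost_integral (h \<otimes> \<phi> x)" if h: "h \<in> inverse_module F" for h
    proof -
      have hc: "h \<in> carrier K" using h by (simp add: inverse_module_def)
      obtain f c where fc: "f \<in> S" "c \<in> D" "c \<noteq> \<zero>" "\<forall>s \<in> (\<lambda>\<alpha>. h \<otimes> \<alpha>) ` F. \<forall>n::nat. c \<otimes> (f \<otimes> s) [^] n \<in> D"
        using almost_integral_uniform[of "(\<lambda>\<alpha>. h \<otimes> \<alpha>) ` F"] F h by (auto simp: inverse_module_def)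
      note car = S_carrier[OF fc(1)] D_carrier[OF fc(2)]
      \<comment> \<open>Here q is an element of K, not a power of p: the multiple of h whose
        products with the generators have all their powers cleared by c.\<close>
      define q where "q = f \<otimes> h"
      have qc: "q \<in> carrier K" using car hc by (simp add: q_def)
      have qA: "c \<otimes> (q \<otimes> \<phi> \<alpha>) [^] (p ^ e) \<in> D" if \<alpha>: "\<alpha> \<in> A" for \<alpha> e
      proof (cases "\<phi> \<alpha> = \<zero>")
        case True
        then show ?thesis using qc car D_zero p_pos by (simp add: nat_pow_zero neq0_conv)
      next
        case False
        then have "\<phi> \<alpha> \<in> F" using \<alpha> by (simp add: F_def)
        then show ?thesis using fc(4) hom_closed A(1) \<alpha> car hc by (auto simp: q_def m_assoc)
      qed
      \<comment> \<open>Additivity of Frobenius carries the bound from the generators A to all of I.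
        A second, linear preimage argument then carries it from p^e-th powers of elements of I to
        the ideal they generate.\<close>
      have "ideal {r \<in> carrier R. \<phi> r \<in> {m \<in> carrier K. c \<otimes> (q \<otimes> m) [^] (p ^ e) \<in> D}} R" for e
      proof (rule preimage_ideal)
        show "\<zero> \<in> {m \<in> carrier K. c \<otimes> (q \<otimes> m) [^] (p ^ e) \<in> D}"
          using qc car D_zero p_pos by (simp add: nat_pow_zero neq0_conv)
        show "m \<oplus> m' \<in> {m \<in> carrier K. c \<otimes> (q \<otimes> m) [^] (p ^ e) \<in> D}"
          if "m \<in> {m \<in> carrier K. c \<otimes> (q \<otimes> m) [^] (p ^ e) \<in> D}" "m' \<in> {m \<in> carrier K. c \<otimes> (q \<otimes> m) [^] (p ^ e) \<in> D}" for m m'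
          using that qc car D_add by (auto simp: r_distr frobenius_add)
        show "d \<otimes> m \<in> {m \<in> carrier K. c \<otimes> (q \<otimes> m) [^] (p ^ e) \<in> D}"
          if d: "d \<in> D" and m: "m \<in> {m \<in> carrier K. c \<otimes> (q \<otimes> m) [^] (p ^ e) \<in> D}" for d m
        proof -
          have "c \<otimes> (q \<otimes> (d \<otimes> m)) [^] (p ^ e) = d [^] (p ^ e) \<otimes> (c \<otimes> (q \<otimes> m) [^] (p ^ e))"
            using m qc car D_carrier[OF d] by (simp add: nat_pow_distrib m_ac)
          then show ?thesis using m D_mult D_pow d D_carrier[OF d] by simp
        qed
      qed
      then have "I \<subseteq> {r \<in> carrier R. \<phi> r \<in> {m \<in> carrier K. c \<otimes> (q \<otimes> m) [^] (p ^ e) \<in> D}}" for e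
        unfolding A(3) by (rule R.genideal_minimal) (use qA A(1) hom_closed in auto)
      then have qI: "c \<otimes> (q \<otimes> \<phi> r) [^] (p ^ e) \<in> D" if "r \<in> I" for r e using that by blast
      have "ideal {r \<in> carrier R. \<phi> r \<in> {m \<in> carrier K. c \<otimes> q [^] (p ^ e) \<otimes> m \<in> D}} R" for e
      proof (rule preimage_ideal)
        show "\<zero> \<in> {m \<in> carrier K. c \<otimes> q [^] (p ^ e) \<otimes> m \<in> D}" using qc car D_zero by simp
        show "m \<oplus> m' \<in> {m \<in> carrier K. c \<otimes> q [^] (p ^ e) \<otimes> m \<in> D}"
          if "m \<in> {m \<in> carrier K. c \<otimes> q [^] (p ^ e) \<otimes> m \<in> D}" "m' \<in> {m \<in> carrier K. c \<otimes> q [^] (p ^ e) \<otimes> m \<in> D}" for m m'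
          using that qc car D_add by (auto simp: r_distr)
        show "d \<otimes> m \<in> {m \<in> carrier K. c \<otimes> q [^] (p ^ e) \<otimes> m \<in> D}"
          if d: "d \<in> D" and m: "m \<in> {m \<in> carrier K. c \<otimes> q [^] (p ^ e) \<otimes> m \<in> D}" for d m
        proof -
          have "c \<otimes> q [^] (p ^ e) \<otimes> (d \<otimes> m) = d \<otimes> (c \<otimes> q [^] (p ^ e) \<otimes> m)"
            using m qc car D_carrier[OF d] by (simp add: m_ac)
          then show ?thesis using m D_mult d D_carrier[OF d] by simp
        qed
      qed
      then have "frob_ideal R (p ^ e) I \<subseteq> {r \<in> carrier R. \<phi> r \<in> {m \<in> carrier K. c \<otimes> q [^] (p ^ e) \<otimes> m \<in> D}}" for e
      proof (rule R.frob_ideal_minimal)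
        fix r assume r: "r \<in> I"
        then have rc: "r \<in> carrier R" using R.ideal_subset[OF I] by auto
        have "c \<otimes> q [^] (p ^ e) \<otimes> \<phi> r [^] (p ^ e) = c \<otimes> (q \<otimes> \<phi> r) [^] (p ^ e)"
          using qc car hom_closed[OF rc] by (simp add: nat_pow_distrib m_assoc)
        then show "r [^]\<^bsub>R\<^esub> (p ^ e) \<in> {r \<in> carrier R. \<phi> r \<in> {m \<in> carrier K. c \<otimes> q [^] (p ^ e) \<otimes> m \<in> D}}"
          using qI[OF r] rc hom_closed[OF rc] by (simp add: hom_pow)
      qed
      then have fr: "c \<otimes> q [^] (p ^ e) \<otimes> \<phi> r \<in> D" if "r \<in> frob_ideal R (p ^ e) I" for e r using that by blast
      have c0c: "\<phi> c0 \<in> carrier K" "\<phi> c0 \<in> D" "\<phi> c0 \<noteq> \<zero>" using c0 hom_closed kernel by (auto simp: D_def)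
      have wS: "\<phi> (w e) \<in> S" for e using w[of e] by (auto simp: S_def)
      have "almost_integral (q \<otimes> \<phi> x)"
      proof (rule frobenius_almost_integral[where c = "c \<otimes> \<phi> c0" and w = "\<lambda>e. \<phi> (w e)" and ?e0.0 = e0])
        fix e assume "e \<ge> e0"
        note fr[OF mem[OF this]]
        moreover have "c \<otimes> q [^] (p ^ e) \<otimes> \<phi> (c0 \<otimes>\<^bsub>R\<^esub> (w e \<otimes>\<^bsub>R\<^esub> x [^]\<^bsub>R\<^esub> (p ^ e))) =
            c \<otimes> \<phi> c0 \<otimes> (\<phi> (w e) \<otimes> (q \<otimes> \<phi> x) [^] (p ^ e))"
          using car qc c0c(1) xc S_carrier[OF wS] c0 w[of e] x by (simp add: hom_mult hom_pow nat_pow_distrib m_ac)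
        ultimately show "c \<otimes> \<phi> c0 \<otimes> (\<phi> (w e) \<otimes> (q \<otimes> \<phi> x) [^] (p ^ e)) \<in> D" by simp
      qed (use qc xc fc c0c car D_mult wS in \<open>auto simp: integral_iff\<close>)
      moreover have "h \<otimes> \<phi> x = inv f \<otimes> (q \<otimes> \<phi> x)"
      proof -
        have "inv f \<otimes> f = \<one>" "inv f \<in> carrier K"
          using inv_right[OF car(1) S_nonzero[OF fc(1)]] inv_closed'[OF car(1) S_nonzero[OF fc(1)]] car m_comm by auto
        then show ?thesis using car hc xc m_assoc[of "inv f" f "h \<otimes> \<phi> x"] by (simp add: q_def m_assoc)
      qed
      ultimately show ?thesis using almost_integral_mult[OF almost_integral_inv[OF fc(1)]] by simp
    qed
    let ?Fr = "\<lambda>e. \<phi> ` frob_ideal R (p ^ e) I"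
    have Fr_add: "u \<oplus> v \<in> ?Fr e" if H: "u \<in> ?Fr e" "v \<in> ?Fr e" for u v e
    proof -
      obtain i j where ij: "i \<in> frob_ideal R (p ^ e) I" "j \<in> frob_ideal R (p ^ e) I" "u = \<phi> i" "v = \<phi> j" using H by auto
      then have "u \<oplus> v = \<phi> (i \<oplus>\<^bsub>R\<^esub> j)" using subsetD[OF R.ideal_subset[OF fid]] by (simp add: hom_add)
      then show ?thesis using R.ideal_add[OF fid ij(1,2)] by simp
    qed
    have Fr_scale: "d \<otimes> u \<in> ?Fr e" if H: "u \<in> ?Fr e" "d \<in> D" for u d e
    proof -
      obtain i r where ij: "i \<in> frob_ideal R (p ^ e) I" "u = \<phi> i" "r \<in> carrier R" "d = \<phi> r" using H by (auto simp: D_def)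
      then have "d \<otimes> u = \<phi> (r \<otimes>\<^bsub>R\<^esub> i)" using subsetD[OF R.ideal_subset[OF fid]] by (simp add: hom_mult)
      then show ?thesis using R.ideal_mult_l[OF fid ij(1,3)] by simp
    qed
    \<comment> \<open>The claim is made for s x with s any sum of products, and wanted at s = 1. A
      new summand contributes (h x) \<alpha>: the powers of h x have a uniform denominator, and the
      q-th power of \<alpha> comes from I^[q].\<close>
    have "\<exists>f \<in> S. \<exists>c \<in> D. c \<noteq> \<zero> \<and> (\<forall>e. c \<otimes> (f \<otimes> s \<otimes> \<phi> x) [^] (p ^ e) \<in> ?Fr e)" if "s \<in> trace_sums F" for s
      using that
    proof (induction rule: trace_sums.induct)
      case zero
      have "\<zero> \<in> ?Fr e" for e using R.ideal_zero[OF fid] hom_zero by (metis imageI)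
      then show ?case using S_one D_one xc p_pos
        by (intro bexI[of _ \<one>] conjI) (auto simp: nat_pow_zero neq0_conv)
    next
      case (step h \<alpha> s)
      obtain f c where fc: "f \<in> S" "c \<in> D" "c \<noteq> \<zero>" "\<forall>e. c \<otimes> (f \<otimes> s \<otimes> \<phi> x) [^] (p ^ e) \<in> ?Fr e" using step.IH by auto
      obtain g d where gd: "g \<in> S" "d \<in> D" "d \<noteq> \<zero>" "\<forall>n::nat. d \<otimes> (g \<otimes> (h \<otimes> \<phi> x)) [^] n \<in> D"
        using hx[OF step.hyps(1)] by (auto simp: almost_integral_def)
      obtain a where a: "a \<in> A" "\<alpha> = \<phi> a" using step.hyps(2) by (auto simp: F_def)
      have aI: "a \<in> I" "a \<in> carrier R" using a A(1) AI by auto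
      have FD: "F \<subseteq> D" using F by auto
      have car: "f \<in> carrier K" "c \<in> carrier K" "g \<in> carrier K" "d \<in> carrier K" "h \<in> carrier K" "\<alpha> \<in> carrier K" "s \<in> carrier K"
        using S_carrier D_carrier fc gd step.hyps trace_sums_carrier[OF _ FD] FD by (auto simp: inverse_module_def)
      have "(c \<otimes> d) \<otimes> ((f \<otimes> g) \<otimes> (h \<otimes> \<alpha> \<oplus> s) \<otimes> \<phi> x) [^] (p ^ e) \<in> ?Fr e" for e
      proof -
        have "(f \<otimes> g) \<otimes> (h \<otimes> \<alpha> \<oplus> s) \<otimes> \<phi> x = f \<otimes> (g \<otimes> (h \<otimes> \<phi> x)) \<otimes> \<alpha> \<oplus> g \<otimes> (f \<otimes> s \<otimes> \<phi> x)"
          using car xc by (simp add: r_distr l_distr m_ac)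
        then have "(c \<otimes> d) \<otimes> ((f \<otimes> g) \<otimes> (h \<otimes> \<alpha> \<oplus> s) \<otimes> \<phi> x) [^] (p ^ e) =
          (c \<otimes> f [^] (p ^ e) \<otimes> (d \<otimes> (g \<otimes> (h \<otimes> \<phi> x)) [^] (p ^ e))) \<otimes> \<alpha> [^] (p ^ e) \<oplus>
          (d \<otimes> g [^] (p ^ e)) \<otimes> (c \<otimes> (f \<otimes> s \<otimes> \<phi> x) [^] (p ^ e))"
          using car xc by (simp add: frobenius_add nat_pow_distrib r_distr m_ac)
        moreover have "\<alpha> [^] (p ^ e) \<in> ?Fr e"
          using R.pow_mem_frob_ideal[OF I aI(1), of "p ^ e"] a(2) aI(2) hom_pow by (metis imageI)
        ultimately show ?thesis
          using Fr_add Fr_scale fc gd S_D D_mult D_pow by auto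
      qed
      moreover have "c \<otimes> d \<in> D" "c \<otimes> d \<noteq> \<zero>" "f \<otimes> g \<in> S" using fc gd D_mult S_mult car by (auto simp: integral_iff)
      ultimately show ?case by blast
    qed
    from this[OF one_in_trace_sums[OF F(1) False F(2)]]
    obtain f c where fc: "f \<in> S" "c \<in> D" "c \<noteq> \<zero>" "\<forall>e. c \<otimes> (f \<otimes> \<one> \<otimes> \<phi> x) [^] (p ^ e) \<in> ?Fr e" by auto
    obtain f' c' where f': "f' \<in> carrier R - Q" "f = \<phi> f'" "c' \<in> carrier R" "c = \<phi> c'" using fc by (auto simp: S_def D_def)
    have c'P: "c' \<notin> P" using fc(3) f' kernel by auto
    have "\<exists>i \<in> frob_ideal R (p ^ e) I. c' \<otimes>\<^bsub>R\<^esub> (f' \<otimes>\<^bsub>R\<^esub> x) [^]\<^bsub>R\<^esub> (p ^ e) \<ominus>\<^bsub>R\<^esub> i \<in> P" for e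
    proof -
      obtain i where i: "i \<in> frob_ideal R (p ^ e) I" "c \<otimes> (f \<otimes> \<one> \<otimes> \<phi> x) [^] (p ^ e) = \<phi> i" using fc(4) by blast
      have ic: "i \<in> carrier R" using R.ideal_subset[OF fid] i by auto
      have "\<phi> (c' \<otimes>\<^bsub>R\<^esub> (f' \<otimes>\<^bsub>R\<^esub> x) [^]\<^bsub>R\<^esub> (p ^ e)) = \<phi> i"
        using i(2) f' x hom_closed by (simp add: hom_mult hom_pow)
      then have "\<phi> (c' \<otimes>\<^bsub>R\<^esub> (f' \<otimes>\<^bsub>R\<^esub> x) [^]\<^bsub>R\<^esub> (p ^ e) \<ominus>\<^bsub>R\<^esub> i) = \<zero>"
        using ic f' x hom_closed by (simp add: hom_minus)
      then show ?thesis using i(1) kernel ic f' x by (intro bexI[of _ i]) auto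
    qed
    then show ?thesis using f' c'P by blast
  qed
qed

end

section \<open>Localization\<close>

locale localized_ring = cring R for R (structure) +
  fixes W assumes W: "mult_system R W"
begin

abbreviation L where "L \<equiv> localization R W"
abbreviation frac where "frac \<equiv> loc_frac R W"

lemma W_carrier: "w \<in> W \<Longrightarrow> w \<in> carrier R" and W_one: "\<one> \<in> W"
  and W_mult: "v \<in> W \<Longrightarrow> w \<in> W \<Longrightarrow> v \<otimes> w \<in> W"
  using W by (auto simp: mult_system_def)

lemma W_pow: "w \<in> W \<Longrightarrow> w [^] (n::nat) \<in> W"
  by (induction n) (simp_all add: W_one W_mult)

lemma loc_rel_iff:
  "((r, s), (r', s')) \<in> loc_rel R W \<longleftrightarrow> r \<in> carrier R \<and> s \<in> W \<and> r' \<in> carrier R \<and> s' \<in> W \<and>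
     (\<exists>u \<in> W. u \<otimes> (r \<otimes> s') = u \<otimes> (r' \<otimes> s))"
proof -
  have "u \<otimes> (r \<otimes> s' \<ominus> r' \<otimes> s) = \<zero> \<longleftrightarrow> u \<otimes> (r \<otimes> s') = u \<otimes> (r' \<otimes> s)"
    if "r \<in> carrier R" "s \<in> W" "r' \<in> carrier R" "s' \<in> W" "u \<in> W" for u
  proof -
    have "u \<otimes> (r \<otimes> s' \<ominus> r' \<otimes> s) = u \<otimes> (r \<otimes> s') \<ominus> u \<otimes> (r' \<otimes> s)"
      using that W_carrier by (simp add: a_minus_def r_distr r_minus)
    then show ?thesis using that W_carrier by simp
  qed
  then show ?thesis unfolding loc_rel_def by auto
qed

lemma loc_equiv: "equiv (carrier R \<times> W) (loc_rel R W)"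
proof (rule equivI)
  show "loc_rel R W \<subseteq> (carrier R \<times> W) \<times> (carrier R \<times> W)" by (auto simp: loc_rel_def)
  show "refl_on (carrier R \<times> W) (loc_rel R W)" using W_one by (auto simp: refl_on_def loc_rel_iff)
  show "sym (loc_rel R W)"
  proof (rule symI)
    fix a b assume "(a, b) \<in> loc_rel R W"
    then show "(b, a) \<in> loc_rel R W" by (cases a; cases b) (auto simp: loc_rel_iff dest: sym)
  qed
  show "trans (loc_rel R W)"
  proof (rule transI)
    fix a b c assume ab: "(a, b) \<in> loc_rel R W" "(b, c) \<in> loc_rel R W"
    obtain r s r' s' r'' s'' where eq: "a = (r, s)" "b = (r', s')" "c = (r'', s'')" by (cases a; cases b; cases c)
    obtain u v where u: "u \<in> W" "u \<otimes> (r \<otimes> s') = u \<otimes> (r' \<otimes> s)" and v: "v \<in> W" "v \<otimes> (r' \<otimes> s'') = v \<otimes> (r'' \<otimes> s')"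
      using ab by (auto simp: eq loc_rel_iff)
    have mem: "r \<in> carrier R" "s \<in> W" "r' \<in> carrier R" "s' \<in> W" "r'' \<in> carrier R" "s'' \<in> W"
      using ab by (auto simp: eq loc_rel_iff)
    note car = mem(1,3,5) mem(2,4,6)[THEN W_carrier] W_carrier[OF u(1)] W_carrier[OF v(1)]
    have "u \<otimes> v \<otimes> s' \<otimes> (r \<otimes> s'') = v \<otimes> s'' \<otimes> (u \<otimes> (r \<otimes> s'))" using car by (simp add: m_ac)
    also have "\<dots> = u \<otimes> s \<otimes> (v \<otimes> (r' \<otimes> s''))" unfolding u(2) using car by (simp add: m_ac)
    also have "\<dots> = u \<otimes> v \<otimes> s' \<otimes> (r'' \<otimes> s)" unfolding v(2) using car by (simp add: m_ac)
    finally show "(a, c) \<in> loc_rel R W" unfolding eq loc_rel_iff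
      using mem W_mult[OF W_mult[OF u(1) v(1)] mem(4)] by auto
  qed
qed

lemma frac_eq_iff:
  assumes "r \<in> carrier R" "s \<in> W" "r' \<in> carrier R" "s' \<in> W"
  shows "frac r s = frac r' s' \<longleftrightarrow> (\<exists>u \<in> W. u \<otimes> (r \<otimes> s') = u \<otimes> (r' \<otimes> s))"
  using eq_equiv_class_iff[OF loc_equiv, of "(r, s)" "(r', s')"] assms
  by (simp add: loc_frac_def loc_rel_iff)

lemma frac_eqI:
  assumes "r \<in> carrier R" "s \<in> W" "r' \<in> carrier R" "s' \<in> W" "r \<otimes> s' = r' \<otimes> s"
  shows "frac r s = frac r' s'"
  using assms W_one frac_eq_iff by auto

lemma mem_frac: "(a, b) \<in> frac r s \<longleftrightarrow> ((r, s), (a, b)) \<in> loc_rel R W"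
  by (simp add: loc_frac_def)

lemma carrier_L: "carrier L = {frac r s | r s. r \<in> carrier R \<and> s \<in> W}"
  by (auto simp: localization_def quotient_def loc_frac_def)

lemma frac_closed: "r \<in> carrier R \<Longrightarrow> s \<in> W \<Longrightarrow> frac r s \<in> carrier L"
  by (auto simp: carrier_L)

lemma mult_frac:
  assumes "r \<in> carrier R" "s \<in> W" "r' \<in> carrier R" "s' \<in> W"
  shows "frac r s \<otimes>\<^bsub>L\<^esub> frac r' s' = frac (r \<otimes> r') (s \<otimes> s')"
proof -
  have *: "frac (a \<otimes> a') (b \<otimes> b') = frac (r \<otimes> r') (s \<otimes> s')" if ab: "(a, b) \<in> frac r s" "(a', b') \<in> frac r' s'" for a b a' b'
  proof -
    obtain u v where u: "u \<in> W" "u \<otimes> (r \<otimes> b) = u \<otimes> (a \<otimes> s)" and v: "v \<in> W" "v \<otimes> (r' \<otimes> b') = v \<otimes> (a' \<otimes> s')"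
      and m: "a \<in> carrier R" "b \<in> W" "a' \<in> carrier R" "b' \<in> W"
      using ab by (auto simp: mem_frac loc_rel_iff)
    note car = assms(1,3) m(1,3) assms(2,4)[THEN W_carrier] m(2,4)[THEN W_carrier] W_carrier[OF u(1)] W_carrier[OF v(1)]
    have "u \<otimes> v \<otimes> (a \<otimes> a' \<otimes> (s \<otimes> s')) = (u \<otimes> (a \<otimes> s)) \<otimes> (v \<otimes> (a' \<otimes> s'))" using car by (simp add: m_ac)
    also have "\<dots> = u \<otimes> v \<otimes> (r \<otimes> r' \<otimes> (b \<otimes> b'))" unfolding u(2)[symmetric] v(2)[symmetric] using car by (simp add: m_ac)
    finally show ?thesis using m assms W_mult u(1) v(1) by (subst frac_eq_iff) auto
  qed
  have self: "(r, s) \<in> frac r s" "(r', s') \<in> frac r' s'" using assms W_one by (auto simp: mem_frac loc_rel_iff)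
  have "{frac (a \<otimes> a') (b \<otimes> b') | a b a' b'. (a, b) \<in> frac r s \<and> (a', b') \<in> frac r' s'} = {frac (r \<otimes> r') (s \<otimes> s')}"
    using * self by blast
  then show ?thesis by (simp add: localization_def)
qed

lemma add_frac:
  assumes "r \<in> carrier R" "s \<in> W" "r' \<in> carrier R" "s' \<in> W"
  shows "frac r s \<oplus>\<^bsub>L\<^esub> frac r' s' = frac (r \<otimes> s' \<oplus> r' \<otimes> s) (s \<otimes> s')"
proof -
  have *: "frac (a \<otimes> b' \<oplus> a' \<otimes> b) (b \<otimes> b') = frac (r \<otimes> s' \<oplus> r' \<otimes> s) (s \<otimes> s')" if ab: "(a, b) \<in> frac r s" "(a', b') \<in> frac r' s'" for a b a' b'
  proof -
    obtain u v where u: "u \<in> W" "u \<otimes> (r \<otimes> b) = u \<otimes> (a \<otimes> s)" and v: "v \<in> W" "v \<otimes> (r' \<otimes> b') = v \<otimes> (a' \<otimes> s')"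
      and m: "a \<in> carrier R" "b \<in> W" "a' \<in> carrier R" "b' \<in> W"
      using ab by (auto simp: mem_frac loc_rel_iff)
    note car = assms(1,3) m(1,3) assms(2,4)[THEN W_carrier] m(2,4)[THEN W_carrier] W_carrier[OF u(1)] W_carrier[OF v(1)]
    have "u \<otimes> v \<otimes> ((a \<otimes> b' \<oplus> a' \<otimes> b) \<otimes> (s \<otimes> s')) =
        (u \<otimes> (a \<otimes> s)) \<otimes> (v \<otimes> b' \<otimes> s') \<oplus> (v \<otimes> (a' \<otimes> s')) \<otimes> (u \<otimes> b \<otimes> s)"
      using car by (simp add: l_distr r_distr m_ac)
    also have "\<dots> = u \<otimes> v \<otimes> ((r \<otimes> s' \<oplus> r' \<otimes> s) \<otimes> (b \<otimes> b'))"
      unfolding u(2)[symmetric] v(2)[symmetric] using car by (simp add: l_distr r_distr m_ac)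
    finally show ?thesis using m assms W_mult u(1) v(1) W_carrier by (subst frac_eq_iff) auto
  qed
  have self: "(r, s) \<in> frac r s" "(r', s') \<in> frac r' s'" using assms W_one by (auto simp: mem_frac loc_rel_iff)
  have "{frac (a \<otimes> b' \<oplus> a' \<otimes> b) (b \<otimes> b') | a b a' b'. (a, b) \<in> frac r s \<and> (a', b') \<in> frac r' s'} = {frac (r \<otimes> s' \<oplus> r' \<otimes> s) (s \<otimes> s')}"
    using * self by blast
  then show ?thesis by (simp add: localization_def)
qed

lemma one_L: "\<one>\<^bsub>L\<^esub> = frac \<one> \<one>" and zero_L: "\<zero>\<^bsub>L\<^esub> = frac \<zero> \<one>"
  by (simp_all add: localization_def)

lemma carrier_L_cases:
  assumes "x \<in> carrier L"
  obtains r s where "r \<in> carrier R" "s \<in> W" "x = frac r s"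
  using assms by (auto simp: carrier_L)

lemma L_cring: "cring L"
proof (rule cringI)
  show "abelian_group L"
  proof (rule abelian_groupI)
    fix x y assume "x \<in> carrier L" "y \<in> carrier L"
    then show "x \<oplus>\<^bsub>L\<^esub> y \<in> carrier L"
      by (elim carrier_L_cases) (auto simp: add_frac W_carrier W_mult intro!: frac_closed)
  next
    show "\<zero>\<^bsub>L\<^esub> \<in> carrier L" by (simp add: zero_L frac_closed W_one)
  next
    fix x y z assume "x \<in> carrier L" "y \<in> carrier L" "z \<in> carrier L"
    then show "x \<oplus>\<^bsub>L\<^esub> y \<oplus>\<^bsub>L\<^esub> z = x \<oplus>\<^bsub>L\<^esub> (y \<oplus>\<^bsub>L\<^esub> z)"
      by (elim carrier_L_cases) (simp add: add_frac W_carrier W_mult l_distr r_distr m_ac a_ac)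
  next
    fix x y assume "x \<in> carrier L" "y \<in> carrier L"
    then show "x \<oplus>\<^bsub>L\<^esub> y = y \<oplus>\<^bsub>L\<^esub> x"
      by (elim carrier_L_cases) (simp add: add_frac W_carrier W_mult m_ac a_ac)
  next
    fix x assume "x \<in> carrier L"
    then show "\<zero>\<^bsub>L\<^esub> \<oplus>\<^bsub>L\<^esub> x = x"
      by (elim carrier_L_cases) (simp add: zero_L add_frac W_carrier W_one)
  next
    fix x assume "x \<in> carrier L"
    then obtain r s where x: "r \<in> carrier R" "s \<in> W" "x = frac r s" by (rule carrier_L_cases)
    have "frac (\<ominus> r) s \<oplus>\<^bsub>L\<^esub> x = \<zero>\<^bsub>L\<^esub>"
      unfolding x(3) zero_L using x(1,2) W_carrier[OF x(2)] W_mult W_one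
      by (simp add: add_frac l_minus l_neg) (intro frac_eqI, auto)
    then show "\<exists>y\<in>carrier L. y \<oplus>\<^bsub>L\<^esub> x = \<zero>\<^bsub>L\<^esub>" using x frac_closed by blast
  qed
next
  show "Group.comm_monoid L"
  proof (rule comm_monoidI)
    fix x y assume "x \<in> carrier L" "y \<in> carrier L"
    then show "x \<otimes>\<^bsub>L\<^esub> y \<in> carrier L"
      by (elim carrier_L_cases) (auto simp: mult_frac W_carrier W_mult intro!: frac_closed)
  next
    show "\<one>\<^bsub>L\<^esub> \<in> carrier L" by (simp add: one_L frac_closed W_one)
  next
    fix x y z assume "x \<in> carrier L" "y \<in> carrier L" "z \<in> carrier L"
    then show "x \<otimes>\<^bsub>L\<^esub> y \<otimes>\<^bsub>L\<^esub> z = x \<otimes>\<^bsub>L\<^esub> (y \<otimes>\<^bsub>L\<^esub> z)"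
      by (elim carrier_L_cases) (simp add: mult_frac W_carrier W_mult m_ac)
  next
    fix x assume "x \<in> carrier L"
    then show "\<one>\<^bsub>L\<^esub> \<otimes>\<^bsub>L\<^esub> x = x"
      by (elim carrier_L_cases) (simp add: one_L mult_frac W_carrier W_one)
  next
    fix x y assume "x \<in> carrier L" "y \<in> carrier L"
    then show "x \<otimes>\<^bsub>L\<^esub> y = y \<otimes>\<^bsub>L\<^esub> x"
      by (elim carrier_L_cases) (simp add: mult_frac W_carrier m_ac)
  qed
next
  fix x y z assume "x \<in> carrier L" "y \<in> carrier L" "z \<in> carrier L"
  then obtain r s r' s' r'' s'' where *: "r \<in> carrier R" "s \<in> W" "x = frac r s" "r' \<in> carrier R" "s' \<in> W" "y = frac r' s'"
     "r'' \<in> carrier R" "s'' \<in> W" "z = frac r'' s''" by (elim carrier_L_cases)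
  note car = *(1,4,7) *(2,5,8)[THEN W_carrier]
  show "(x \<oplus>\<^bsub>L\<^esub> y) \<otimes>\<^bsub>L\<^esub> z = x \<otimes>\<^bsub>L\<^esub> z \<oplus>\<^bsub>L\<^esub> y \<otimes>\<^bsub>L\<^esub> z"
    unfolding * using car *(2,5,8) W_mult
    by (simp add: add_frac mult_frac) (intro frac_eqI, auto simp: l_distr r_distr m_ac)
qed

end

sublocale localized_ring \<subseteq> L: cring "localization R W" by (rule L_cring)

section \<open>Extension and contraction of ideals, and minimal primes of the localization\<close>

context localized_ring
begin

lemma pow_frac: "r \<in> carrier R \<Longrightarrow> s \<in> W \<Longrightarrow> frac r s [^]\<^bsub>L\<^esub> (n::nat) = frac (r [^] n) (s [^] n)"
  by (induction n) (simp_all add: one_L mult_frac W_pow)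

lemma frac_split: "r \<in> carrier R \<Longrightarrow> s \<in> W \<Longrightarrow> frac r s = frac \<one> s \<otimes>\<^bsub>L\<^esub> frac r \<one>"
  by (simp add: mult_frac W_one W_carrier)

lemma frac_unit: "w \<in> W \<Longrightarrow> frac w \<one> \<otimes>\<^bsub>L\<^esub> frac \<one> w = \<one>\<^bsub>L\<^esub>"
  by (simp add: mult_frac W_one W_carrier one_L) (intro frac_eqI, auto simp: W_carrier W_one)

lemma frac_cancel: "r \<in> carrier R \<Longrightarrow> s \<in> W \<Longrightarrow> w \<in> W \<Longrightarrow> frac (w \<otimes> r) (w \<otimes> s) = frac r s"
  by (intro frac_eqI) (auto simp: W_carrier W_mult m_ac)

text \<open>Passing to a common denominator keeps numerators in J, so single fractions are closed
  under sums and no finite combinations are needed.\<close>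

lemma ext_ideal_eq:
  assumes J: "ideal J R"
  shows "ext_ideal R W J = {frac j s | j s. j \<in> J \<and> s \<in> W}"
proof
  note Jc = subsetD[OF ideal_subset[OF J]]
  have id: "ideal {frac j s | j s. j \<in> J \<and> s \<in> W} L"
  proof (rule L.cidealI)
    show "{frac j s | j s. j \<in> J \<and> s \<in> W} \<subseteq> carrier L" using Jc frac_closed by auto
    show "\<zero>\<^bsub>L\<^esub> \<in> {frac j s | j s. j \<in> J \<and> s \<in> W}" unfolding zero_L using ideal_zero[OF J] W_one by auto
    fix a b assume "a \<in> {frac j s | j s. j \<in> J \<and> s \<in> W}" "b \<in> {frac j s | j s. j \<in> J \<and> s \<in> W}"
    then obtain j s j' s' where *: "a = frac j s" "j \<in> J" "s \<in> W" "b = frac j' s'" "j' \<in> J" "s' \<in> W" by auto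
    have "j \<otimes> s' \<oplus> j' \<otimes> s \<in> J" using ideal_add[OF J ideal_mult_r[OF J] ideal_mult_r[OF J]] * W_carrier by auto
    moreover have "a \<oplus>\<^bsub>L\<^esub> b = frac (j \<otimes> s' \<oplus> j' \<otimes> s) (s \<otimes> s')" using * Jc by (simp add: add_frac)
    ultimately show "a \<oplus>\<^bsub>L\<^esub> b \<in> {frac j s | j s. j \<in> J \<and> s \<in> W}" using W_mult * by blast
  next
    fix x a assume x: "x \<in> carrier L" and a: "a \<in> {frac j s | j s. j \<in> J \<and> s \<in> W}"
    obtain r t where r: "r \<in> carrier R" "t \<in> W" "x = frac r t" using x by (rule carrier_L_cases)
    obtain j s where j: "a = frac j s" "j \<in> J" "s \<in> W" using a by auto
    have "x \<otimes>\<^bsub>L\<^esub> a = frac (r \<otimes> j) (t \<otimes> s)" using r j Jc by (simp add: mult_frac)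
    then show "x \<otimes>\<^bsub>L\<^esub> a \<in> {frac j s | j s. j \<in> J \<and> s \<in> W}" using W_mult[OF r(2) j(3)] ideal_mult_l[OF J j(2) r(1)] by blast
  qed
  show "ext_ideal R W J \<subseteq> {frac j s | j s. j \<in> J \<and> s \<in> W}"
    unfolding ext_ideal_def by (rule L.genideal_minimal[OF id]) (use W_one in \<open>auto simp: loc_map_def\<close>)
  have sub: "loc_map R W ` J \<subseteq> carrier L" using Jc W_one by (auto simp: loc_map_def intro!: frac_closed)
  note gid = L.genideal_ideal[OF sub]
  show "{frac j s | j s. j \<in> J \<and> s \<in> W} \<subseteq> ext_ideal R W J"
  proof
    fix a assume "a \<in> {frac j s | j s. j \<in> J \<and> s \<in> W}"
    then obtain j s where j: "a = frac j s" "j \<in> J" "s \<in> W" by auto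
    have "frac j \<one> \<in> ext_ideal R W J" using L.genideal_self[OF sub] j by (auto simp: ext_ideal_def loc_map_def)
    then show "a \<in> ext_ideal R W J"
      using L.ideal_mult_l[OF gid, of "frac j \<one>" "frac \<one> s"] frac_split[of j s] j Jc frac_closed by (simp add: ext_ideal_def)
  qed
qed

lemma ext_ideal_ideal: assumes "ideal J R" shows "ideal (ext_ideal R W J) L"
  unfolding ext_ideal_def using ideal_subset[OF assms] W_one
  by (intro L.genideal_ideal) (auto simp: loc_map_def intro!: frac_closed)

text \<open>The denominator s is a unit of the localization and does not matter. The factor w on the
  right is the origin of the multipliers w_q.\<close>

lemma frac_in_ext_ideal_iff:
  assumes J: "ideal J R" and r: "r \<in> carrier R" "s \<in> W"
  shows "frac r s \<in> ext_ideal R W J \<longleftrightarrow> (\<exists>w \<in> W. w \<otimes> r \<in> J)"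
proof
  assume "frac r s \<in> ext_ideal R W J"
  then obtain j t where j: "frac r s = frac j t" "j \<in> J" "t \<in> W" by (auto simp: ext_ideal_eq[OF J])
  have jc: "j \<in> carrier R" using ideal_subset[OF J] j by auto
  obtain u where u: "u \<in> W" "u \<otimes> (r \<otimes> t) = u \<otimes> (j \<otimes> s)" using j frac_eq_iff[OF r jc j(3)] by auto
  have "u \<otimes> t \<otimes> r = u \<otimes> s \<otimes> j" using u(2) r j(3) W_carrier u(1) jc by (simp add: m_ac)
  also have "\<dots> \<in> J" using ideal_mult_l[OF J j(2)] W_carrier W_mult u(1) r(2) by auto
  finally show "\<exists>w \<in> W. w \<otimes> r \<in> J" using W_mult[OF u(1) j(3)] by auto
next
  assume "\<exists>w \<in> W. w \<otimes> r \<in> J"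
  then obtain w where w: "w \<in> W" "w \<otimes> r \<in> J" by auto
  then have "frac (w \<otimes> r) (w \<otimes> s) \<in> ext_ideal R W J"
    unfolding ext_ideal_eq[OF J] using W_mult[OF w(1) r(2)] by blast
  then show "frac r s \<in> ext_ideal R W J" by (simp only: frac_cancel[OF r w(1)])
qed

definition contraction where "contraction q = {r \<in> carrier R. frac r \<one> \<in> q}"

lemma contraction_ideal:
  assumes q: "ideal q L" shows "ideal (contraction q) R"
proof (rule cidealI)
  show "\<zero> \<in> contraction q" using L.ideal_zero[OF q] by (simp add: contraction_def zero_L)
  show "a \<oplus> b \<in> contraction q" if "a \<in> contraction q" "b \<in> contraction q" for a b
    using that L.ideal_add[OF q, of "frac a \<one>" "frac b \<one>"] by (simp add: contraction_def add_frac W_one)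
  show "r \<otimes> a \<in> contraction q" if "r \<in> carrier R" "a \<in> contraction q" for r a
    using that L.ideal_mult_l[OF q, of "frac a \<one>" "frac r \<one>"] frac_closed
    by (simp add: contraction_def mult_frac W_one)
qed (auto simp: contraction_def)

lemma frac_in_iff_contraction:
  assumes q: "ideal q L" and r: "r \<in> carrier R" "s \<in> W"
  shows "frac r s \<in> q \<longleftrightarrow> r \<in> contraction q"
proof
  assume "frac r s \<in> q"
  then have "frac s \<one> \<otimes>\<^bsub>L\<^esub> frac r s \<in> q" using L.ideal_mult_l[OF q] frac_closed W_carrier r W_one by auto
  moreover have "frac s \<one> \<otimes>\<^bsub>L\<^esub> frac r s = frac r \<one>"
    using r W_carrier W_one by (simp add: mult_frac) (intro frac_eqI, auto simp: m_ac)
  ultimately show "r \<in> contraction q" using r by (simp add: contraction_def)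
next
  assume "r \<in> contraction q"
  then show "frac r s \<in> q" using L.ideal_mult_l[OF q, of "frac r \<one>" "frac \<one> s"] frac_split[OF r] frac_closed r
    by (simp add: contraction_def)
qed

lemma contraction_prime:
  assumes q: "primeideal q L"
  shows "primeideal (contraction q) R" "contraction q \<inter> W = {}"
proof -
  note qi = L.primeideal_ideal[OF q]
  show disj: "contraction q \<inter> W = {}"
  proof (rule ccontr)
    assume "contraction q \<inter> W \<noteq> {}"
    then obtain w where w: "w \<in> W" "frac w \<one> \<in> q" by (auto simp: contraction_def)
    then have "\<one>\<^bsub>L\<^esub> \<in> q" using L.ideal_mult_r[OF qi w(2), of "frac \<one> w"] frac_unit[OF w(1)] frac_closed by simp
    then show False using L.prime_one_notin[OF q] by simp
  qed
  show "primeideal (contraction q) R"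
  proof (rule primeidealI[OF contraction_ideal[OF qi] is_cring])
    show "carrier R \<noteq> contraction q" using disj W_one by auto
    fix a b assume ab: "a \<in> carrier R" "b \<in> carrier R" "a \<otimes> b \<in> contraction q"
    then have "frac a \<one> \<otimes>\<^bsub>L\<^esub> frac b \<one> \<in> q" by (simp add: contraction_def mult_frac W_one)
    then show "a \<in> contraction q \<or> b \<in> contraction q"
      using L.prime_mult_notin[OF q, of "frac a \<one>" "frac b \<one>"] frac_closed W_one ab by (auto simp: contraction_def)
  qed
qed

lemma contraction_ext:
  assumes P: "primeideal P R" "P \<inter> W = {}" shows "contraction (ext_ideal R W P) = P"
proof -
  note Pi = primeideal_ideal[OF P(1)]
  have "r \<in> P" if "r \<in> carrier R" "w \<in> W" "w \<otimes> r \<in> P" for r w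
    using prime_mult_notin[OF P(1), of w r] that W_carrier P(2) by auto
  moreover have "\<exists>w \<in> W. w \<otimes> r \<in> P" if "r \<in> P" for r
    using that W_one ideal_mult_l[OF Pi that one_closed] by auto
  ultimately show ?thesis
    unfolding contraction_def using frac_in_ext_ideal_iff[OF Pi _ W_one] ideal_subset[OF Pi] by auto
qed

lemma ext_prime:
  assumes P: "primeideal P R" "P \<inter> W = {}" shows "primeideal (ext_ideal R W P) L"
proof (rule primeidealI[OF ext_ideal_ideal[OF primeideal_ideal[OF P(1)]] L_cring])
  note ei = ext_ideal_ideal[OF primeideal_ideal[OF P(1)]]
  note iff = frac_in_iff_contraction[OF ei, unfolded contraction_ext[OF P]]
  show "carrier L \<noteq> ext_ideal R W P"
  proof
    assume "carrier L = ext_ideal R W P"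
    then have "frac \<one> \<one> \<in> ext_ideal R W P" using frac_closed W_one by auto
    then show False using iff[OF _ W_one] prime_one_notin[OF P(1)] by simp
  qed
  fix x y assume xy: "x \<in> carrier L" "y \<in> carrier L" "x \<otimes>\<^bsub>L\<^esub> y \<in> ext_ideal R W P"
  obtain r s where r: "r \<in> carrier R" "s \<in> W" "x = frac r s" using xy(1) by (rule carrier_L_cases)
  obtain r' s' where r': "r' \<in> carrier R" "s' \<in> W" "y = frac r' s'" using xy(2) by (rule carrier_L_cases)
  have "frac (r \<otimes> r') (s \<otimes> s') \<in> ext_ideal R W P" using xy(3) r r' by (simp add: mult_frac)
  then have "r \<otimes> r' \<in> P" using iff r r' W_mult by simp
  then have "r \<in> P \<or> r' \<in> P" using prime_mult_notin[OF P(1)] r r' by auto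
  then show "x \<in> ext_ideal R W P \<or> y \<in> ext_ideal R W P" using iff r r' by auto
qed

text \<open>A fraction and its numerator differ by a unit, so an ideal of the localization is
  determined by its contraction.\<close>

lemma ideal_eq_by_contraction:
  assumes "ideal q L" "ideal q' L" "contraction q \<subseteq> contraction q'" shows "q \<subseteq> q'"
proof
  fix x assume x: "x \<in> q"
  then have "x \<in> carrier L" using L.ideal_subset[OF assms(1)] by auto
  then obtain r s where r: "r \<in> carrier R" "s \<in> W" "x = frac r s" by (rule carrier_L_cases)
  then show "x \<in> q'" using x assms frac_in_iff_contraction[OF assms(1) r(1,2)] frac_in_iff_contraction[OF assms(2) r(1,2)] by auto
qed

lemma contraction_minimal:
  assumes q: "minimal_prime L q" shows "minimal_prime R (contraction q)"
  unfolding minimal_prime_def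
proof (intro conjI allI impI)
  have qp: "primeideal q L" using q by (simp add: minimal_prime_def)
  show "primeideal (contraction q) R" by (rule contraction_prime[OF qp])
  fix Q assume Q: "primeideal Q R \<and> Q \<subseteq> contraction q"
  then have QW: "primeideal Q R" "Q \<inter> W = {}" using contraction_prime(2)[OF qp] by auto
  note eQ = ext_prime[OF QW]
  have "ext_ideal R W Q \<subseteq> q"
    by (rule ideal_eq_by_contraction[OF L.primeideal_ideal[OF eQ] L.primeideal_ideal[OF qp]])
      (use Q contraction_ext[OF QW] in simp)
  then have "ext_ideal R W Q = q" using q eQ by (simp add: minimal_prime_def)
  then show "Q = contraction q" using contraction_ext[OF QW] by simp
qed

lemma ext_minimal:
  assumes P: "minimal_prime R P" "P \<inter> W = {}" shows "minimal_prime L (ext_ideal R W P)"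
  unfolding minimal_prime_def
proof (intro conjI allI impI)
  have Pp: "primeideal P R" using P by (simp add: minimal_prime_def)
  note eP = ext_prime[OF Pp P(2)]
  show "primeideal (ext_ideal R W P) L" by (rule eP)
  fix q assume q: "primeideal q L \<and> q \<subseteq> ext_ideal R W P"
  then have "contraction q \<subseteq> P" using contraction_ext[OF Pp P(2)] by (auto simp: contraction_def)
  then have "contraction q = P" using P(1) contraction_prime(1)[of q] q by (simp add: minimal_prime_def)
  then have "ext_ideal R W P \<subseteq> q"
    using ideal_eq_by_contraction[OF L.primeideal_ideal[OF eP], of q] L.primeideal_ideal[of q] q contraction_ext[OF Pp P(2)] by simp
  then show "q = ext_ideal R W P" using q by auto
qed

lemma ring_circ_frac: assumes "c \<in> ring_circ R" shows "frac c \<one> \<in> ring_circ L"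
proof -
  have "frac c \<one> \<notin> q" if "minimal_prime L q" for q
    using contraction_minimal[OF that] assms by (auto simp: ring_circ_iff contraction_def)
  then show ?thesis using assms frac_closed W_one by (auto simp: L.ring_circ_iff ring_circ_iff)
qed

text \<open>Only minimal primes disjoint from W survive in the localization, so nothing is known
  about c modulo the others. The restriction is carried along until a factor from W can deal with
  those primes.\<close>

lemma frac_ring_circ:
  assumes "frac c t \<in> ring_circ L" "c \<in> carrier R" "t \<in> W" "minimal_prime R P" "P \<inter> W = {}" shows "c \<notin> P"
proof
  assume "c \<in> P"
  then have "frac c t \<in> ext_ideal R W P" using ext_ideal_eq[of P] assms primeideal_ideal by (auto simp: minimal_prime_def)
  then show False using ext_minimal[OF assms(4,5)] assms(1) by (auto simp: L.ring_circ_iff)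
qed

end

section \<open>Frobenius powers and tight closure under localization\<close>

locale localized_char_p = localized_ring R W + prime_char R p for R (structure) and W p
begin

lemma char_p_L: "char_p L p"
proof -
  have "add_pow L n \<one>\<^bsub>L\<^esub> = frac (add_pow R n \<one>) \<one>" for n :: nat
    by (induction n) (simp_all add: zero_L one_L add_frac W_one)
  then show ?thesis using char by (simp add: char_p_def zero_L)
qed

end

sublocale localized_char_p \<subseteq> L: prime_char "localization R W" p
  by unfold_locales (rule char_p_L)

context localized_char_p
begin

lemma frob_ideal_ext:
  assumes I: "ideal I R"
  shows "frob_ideal L q (ext_ideal R W I) = ext_ideal R W (frob_ideal R q I)"
proof
  note fi = frob_ideal_ideal[OF I, of q]
  note Ic = subsetD[OF ideal_subset[OF I]]
  show "frob_ideal L q (ext_ideal R W I) \<subseteq> ext_ideal R W (frob_ideal R q I)"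
  proof (rule L.frob_ideal_minimal[OF ext_ideal_ideal[OF fi]])
    fix x assume "x \<in> ext_ideal R W I"
    then obtain i s where "x = frac i s" "i \<in> I" "s \<in> W" by (auto simp: ext_ideal_eq[OF I])
    then have "x [^]\<^bsub>L\<^esub> q = frac (i [^] q) (s [^] q)" "i [^] q \<in> frob_ideal R q I" "s [^] q \<in> W"
      using Ic pow_mem_frob_ideal[OF I] W_pow by (simp_all add: pow_frac)
    then show "x [^]\<^bsub>L\<^esub> q \<in> ext_ideal R W (frob_ideal R q I)" unfolding ext_ideal_eq[OF fi] by blast
  qed
  note li = L.frob_ideal_ideal[OF ext_ideal_ideal[OF I], of q]
  have "frob_ideal R q I \<subseteq> contraction (frob_ideal L q (ext_ideal R W I))"
  proof (rule frob_ideal_minimal[OF contraction_ideal[OF li]])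
    fix i assume i: "i \<in> I"
    then have "frac i \<one> \<in> ext_ideal R W I" using W_one by (auto simp: ext_ideal_eq[OF I])
    then have "frac i \<one> [^]\<^bsub>L\<^esub> q \<in> frob_ideal L q (ext_ideal R W I)" by (rule L.pow_mem_frob_ideal[OF ext_ideal_ideal[OF I]])
    then show "i [^] q \<in> contraction (frob_ideal L q (ext_ideal R W I))"
      using i Ic W_one by (simp add: contraction_def pow_frac)
  qed
  then show "ext_ideal R W (frob_ideal R q I) \<subseteq> frob_ideal L q (ext_ideal R W I)"
    unfolding ext_ideal_def[of R W "frob_ideal R q I"]
    by (intro L.genideal_minimal[OF li]) (auto simp: loc_map_def contraction_def)
qed

text \<open>The inclusion that holds in every dimension: the image of a multiplier is again a
  multiplier, as minimal primes of the localization contract to minimal primes.\<close>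

lemma ext_tight_closure_subset:
  assumes I: "ideal I R"
  shows "ext_ideal R W (tight_closure R p I) \<subseteq> tight_closure L p (ext_ideal R W I)"
  unfolding ext_ideal_def[of R W "tight_closure R p I"]
proof (rule L.genideal_minimal[OF L.tight_closure_ideal[OF ext_ideal_ideal[OF I]]], rule subsetI)
  fix a assume "a \<in> loc_map R W ` tight_closure R p I"
  then obtain x c e0 where x: "a = frac x \<one>" "x \<in> carrier R" "c \<in> ring_circ R"
      "\<forall>e\<ge>e0. c \<otimes> x [^] (p ^ e) \<in> frob_ideal R (p ^ e) I"
    by (auto simp: tight_closure_def loc_map_def)
  have cc: "c \<in> carrier R" using ring_circ_closed[OF x(3)] .
  have "frac c \<one> \<otimes>\<^bsub>L\<^esub> a [^]\<^bsub>L\<^esub> (p ^ e) \<in> frob_ideal L (p ^ e) (ext_ideal R W I)" if "e \<ge> e0" for e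
  proof -
    have "frac c \<one> \<otimes>\<^bsub>L\<^esub> a [^]\<^bsub>L\<^esub> (p ^ e) = frac (c \<otimes> x [^] (p ^ e)) \<one>"
      using x(1,2) cc W_one by (simp add: pow_frac mult_frac)
    then show ?thesis unfolding frob_ideal_ext[OF I] ext_ideal_eq[OF frob_ideal_ideal[OF I]]
      using x(4) that W_one by blast
  qed
  then show "a \<in> tight_closure L p (ext_ideal R W I)"
    unfolding tight_closure_def using ring_circ_frac[OF x(3)] x(1,2) frac_closed W_one by blast
qed

text \<open>Clearing denominators costs a factor from W for each e separately, whence the function
  w. Below e0, where no membership is demanded, any element of W may serve as its value.\<close>

lemma tight_closure_extD:
  assumes I: "ideal I R" and x: "x \<in> carrier R" "s \<in> W"
    and mem: "frac x s \<in> tight_closure L p (ext_ideal R W I)"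
  shows "\<exists>c \<in> carrier R. \<exists>w e0. (\<forall>P. minimal_prime R P \<longrightarrow> P \<inter> W = {} \<longrightarrow> c \<notin> P) \<and> (\<forall>e. w e \<in> W) \<and>
    (\<forall>e\<ge>e0. c \<otimes> (w e \<otimes> x [^] (p ^ e)) \<in> frob_ideal R (p ^ e) I)"
proof -
  obtain d e0 where d: "d \<in> ring_circ L"
    "\<forall>e\<ge>e0. d \<otimes>\<^bsub>L\<^esub> frac x s [^]\<^bsub>L\<^esub> (p ^ e) \<in> frob_ideal L (p ^ e) (ext_ideal R W I)"
    using mem by (auto simp: tight_closure_def)
  obtain c t where c: "c \<in> carrier R" "t \<in> W" "d = frac c t" using L.ring_circ_closed[OF d(1)] by (rule carrier_L_cases)
  have "\<exists>w \<in> W. e \<ge> e0 \<longrightarrow> c \<otimes> (w \<otimes> x [^] (p ^ e)) \<in> frob_ideal R (p ^ e) I" for e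
  proof (cases "e \<ge> e0")
    case True
    have eq: "d \<otimes>\<^bsub>L\<^esub> frac x s [^]\<^bsub>L\<^esub> (p ^ e) = frac (c \<otimes> x [^] (p ^ e)) (t \<otimes> s [^] (p ^ e))"
      using c x W_pow by (simp add: pow_frac mult_frac)
    have "frac (c \<otimes> x [^] (p ^ e)) (t \<otimes> s [^] (p ^ e)) \<in> ext_ideal R W (frob_ideal R (p ^ e) I)"
      using d(2)[rule_format, OF True] unfolding eq frob_ideal_ext[OF I] .
    then obtain w where w: "w \<in> W" "w \<otimes> (c \<otimes> x [^] (p ^ e)) \<in> frob_ideal R (p ^ e) I"
      using frac_in_ext_ideal_iff[OF frob_ideal_ideal[OF I], of "c \<otimes> x [^] (p ^ e)" "t \<otimes> s [^] (p ^ e)"] c x W_mult W_pow by auto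
    moreover have "w \<otimes> (c \<otimes> x [^] (p ^ e)) = c \<otimes> (w \<otimes> x [^] (p ^ e))" using c x W_carrier[OF w(1)] by (simp add: m_ac)
    ultimately show ?thesis by auto
  qed (use W_one in auto)
  then obtain w where "\<forall>e. w e \<in> W \<and> (e \<ge> e0 \<longrightarrow> c \<otimes> (w e \<otimes> x [^] (p ^ e)) \<in> frob_ideal R (p ^ e) I)" by metis
  moreover have "\<forall>P. minimal_prime R P \<longrightarrow> P \<inter> W = {} \<longrightarrow> c \<notin> P"
    using frac_ring_circ[of c t] d(1) c by auto
  ultimately show ?thesis using c(1) by blast
qed

end

section \<open>Localization of tight closure in dimension at most two\<close>

lemma (in localized_ring) loc_map_hom: "loc_map R W \<in> ring_hom R L"
  by (rule ring_hom_memI) (auto simp: loc_map_def frac_closed W_one mult_frac add_frac one_L)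

lemma (in domain) fraction_field:
  defines "U \<equiv> carrier R - {\<zero>}"
  shows "field (localization R U)" "loc_map R U \<in> ring_hom R (localization R U)"
    and "\<And>r. r \<in> carrier R \<Longrightarrow> loc_map R U r = \<zero>\<^bsub>localization R U\<^esub> \<longleftrightarrow> r = \<zero>"
    and "\<And>z. z \<in> carrier (localization R U) \<Longrightarrow>
      \<exists>a \<in> carrier R. \<exists>b \<in> U. loc_map R U b \<otimes>\<^bsub>localization R U\<^esub> z = loc_map R U a"
proof -
  have "mult_system R U" unfolding U_def mult_system_def by (auto simp: integral_iff)
  then interpret F: localized_ring R U by unfold_locales
  have zero_iff: "F.frac r s = \<zero>\<^bsub>F.L\<^esub> \<longleftrightarrow> r = \<zero>" if "r \<in> carrier R" "s \<in> U" for r s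
  proof -
    have "s \<in> carrier R" using that(2) F.W_carrier by simp
    then have "F.frac r s = \<zero>\<^bsub>F.L\<^esub> \<longleftrightarrow> (\<exists>u \<in> U. u \<otimes> r = \<zero>)"
      unfolding F.zero_L using that F.W_carrier F.frac_eq_iff[OF that zero_closed F.W_one] by auto
    also have "\<dots> \<longleftrightarrow> r = \<zero>" using that(1) F.W_one F.W_carrier by (auto simp: U_def integral_iff)
    finally show ?thesis .
  qed
  show "field F.L"
  proof (rule F.L.cring_fieldI2)
    show "\<zero>\<^bsub>F.L\<^esub> \<noteq> \<one>\<^bsub>F.L\<^esub>" using zero_iff[OF one_closed F.W_one] by (auto simp: F.one_L)
    fix a assume a: "a \<in> carrier F.L" "a \<noteq> \<zero>\<^bsub>F.L\<^esub>"
    then obtain r s where r: "r \<in> carrier R" "s \<in> U" "a = F.frac r s" by (blast elim: F.carrier_L_cases)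
    then have rU: "r \<in> U" using a(2) zero_iff by (auto simp: U_def)
    have "a \<otimes>\<^bsub>F.L\<^esub> F.frac s r = \<one>\<^bsub>F.L\<^esub>"
      unfolding r(3) F.one_L using r rU F.W_carrier[OF r(2)] F.W_mult F.W_one
      by (simp add: F.mult_frac) (intro F.frac_eqI, auto simp: m_ac)
    then show "\<exists>b\<in>carrier F.L. a \<otimes>\<^bsub>F.L\<^esub> b = \<one>\<^bsub>F.L\<^esub>" using F.frac_closed[OF F.W_carrier[OF r(2)] rU] by auto
  qed
  show "loc_map R U \<in> ring_hom R F.L" by (rule F.loc_map_hom)
  show "loc_map R U r = \<zero>\<^bsub>F.L\<^esub> \<longleftrightarrow> r = \<zero>" if "r \<in> carrier R" for r
    using zero_iff[OF that F.W_one] by (simp add: loc_map_def)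
  fix z assume "z \<in> carrier F.L"
  then obtain r s where r: "r \<in> carrier R" "s \<in> U" "z = F.frac r s" by (blast elim: F.carrier_L_cases)
  have "loc_map R U s \<otimes>\<^bsub>F.L\<^esub> z = loc_map R U r"
    unfolding r(3) loc_map_def using r F.W_carrier[OF r(2)] F.W_one
    by (simp add: F.mult_frac) (intro F.frac_eqI, auto simp: m_ac)
  then show "\<exists>a \<in> carrier R. \<exists>b \<in> U. loc_map R U b \<otimes>\<^bsub>F.L\<^esub> z = loc_map R U a" using r by auto
qed

text \<open>The fraction field of R/P, built as a localization of the quotient ring. The existential
  statement keeps only what \<open>adjacent_primes\<close> asks of K and \<phi>.\<close>

lemma (in cring) residue_field:
  assumes P: "primeideal P R"
  shows "\<exists>(K :: ('a set \<times> 'a set) set ring) \<phi>. field K \<and> \<phi> \<in> ring_hom R K \<and>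
    (\<forall>r \<in> carrier R. \<phi> r = \<zero>\<^bsub>K\<^esub> \<longleftrightarrow> r \<in> P) \<and>
    (\<forall>z \<in> carrier K. \<exists>a \<in> carrier R. \<exists>b \<in> carrier R - P. \<phi> b \<otimes>\<^bsub>K\<^esub> z = \<phi> a)"
proof -
  let ?D = "R Quot P"
  interpret D: domain ?D by (rule primeideal.quotient_is_domain[OF P])
  have Pid: "ideal P R" using primeideal_ideal[OF P] .
  let ?U = "carrier ?D - {\<zero>\<^bsub>?D\<^esub>}"
  let ?K = "localization ?D ?U"
  let ?\<phi> = "loc_map ?D ?U \<circ> (+>) P"
  note hom = ideal.rcos_ring_hom[OF Pid]
  have zero: "\<zero>\<^bsub>?D\<^esub> = P" by (simp add: FactRing_def)
  have ker: "P +> r = \<zero>\<^bsub>?D\<^esub> \<longleftrightarrow> r \<in> P" if "r \<in> carrier R" for r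
    using ideal.rcos_const_imp_mem[OF Pid that] a_rcos_zero[OF Pid] zero by auto
  have surj: "\<exists>r \<in> carrier R. d = P +> r" if "d \<in> carrier ?D" for d
    using that by (auto simp: FactRing_def A_RCOSETS_def' a_r_coset_def')
  have "field ?K" by (rule D.fraction_field(1))
  moreover have "?\<phi> \<in> ring_hom R ?K" by (rule ring_hom_trans[OF hom D.fraction_field(2)])
  moreover have "\<forall>r \<in> carrier R. ?\<phi> r = \<zero>\<^bsub>?K\<^esub> \<longleftrightarrow> r \<in> P"
    using D.fraction_field(3) ring_hom_closed[OF hom] ker by simp
  moreover have "\<forall>z \<in> carrier ?K. \<exists>a \<in> carrier R. \<exists>b \<in> carrier R - P. ?\<phi> b \<otimes>\<^bsub>?K\<^esub> z = ?\<phi> a"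
  proof
    fix z assume z: "z \<in> carrier ?K"
    obtain a b where ab: "a \<in> carrier ?D" "b \<in> ?U" "loc_map ?D ?U b \<otimes>\<^bsub>?K\<^esub> z = loc_map ?D ?U a"
      using D.fraction_field(4)[OF z] by auto
    obtain a' b' where a': "a' \<in> carrier R" "a = P +> a'" "b' \<in> carrier R" "b = P +> b'" using surj[of a] surj[of b] ab(1,2) by auto
    have b'm: "b' \<in> carrier R - P" using ker[OF a'(3)] ab(2) a'(3,4) by auto
    have eq: "?\<phi> b' \<otimes>\<^bsub>?K\<^esub> z = ?\<phi> a'" using ab(3) unfolding a'(2,4) comp_apply .
    show "\<exists>a \<in> carrier R. \<exists>b \<in> carrier R - P. ?\<phi> b \<otimes>\<^bsub>?K\<^esub> z = ?\<phi> a"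
      by (rule bexI[of _ a'], rule bexI[of _ b']) (rule eq, rule b'm, rule a'(1))
  qed
  ultimately show ?thesis by blast
qed

section \<open>From local multipliers to a multiplier in W\<close>

context noetherian_char_p
begin

lemma tight_closure_mod_minimal_prime_at:
  assumes P: "primeideal P R" and Q: "primeideal Q R" "P \<subseteq> Q"
    and between: "\<And>Q'. primeideal Q' R \<Longrightarrow> P \<subset> Q' \<Longrightarrow> Q' \<subseteq> Q \<Longrightarrow> Q' = Q"
    and I: "ideal I R" and x: "x \<in> carrier R" and c: "c \<in> carrier R - P"
    and w: "\<And>e. w e \<in> carrier R - Q"
    and mem: "\<And>e. e \<ge> e0 \<Longrightarrow> c \<otimes> (w e \<otimes> x [^] (p ^ e)) \<in> frob_ideal R (p ^ e) I"
  shows "\<exists>f \<in> carrier R - Q. \<exists>c \<in> carrier R - P. \<forall>e. \<exists>i \<in> frob_ideal R (p ^ e) I. c \<otimes> (f \<otimes> x) [^] (p ^ e) \<ominus> i \<in> P"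
proof -
  obtain K :: "('a set \<times> 'a set) set ring" and \<phi> where K: "field K" "\<phi> \<in> ring_hom R K"
    "\<forall>r \<in> carrier R. \<phi> r = \<zero>\<^bsub>K\<^esub> \<longleftrightarrow> r \<in> P"
    "\<forall>z \<in> carrier K. \<exists>a \<in> carrier R. \<exists>b \<in> carrier R - P. \<phi> b \<otimes>\<^bsub>K\<^esub> z = \<phi> a"
    using residue_field[OF P] by auto
  have "adjacent_primes K R p \<phi> P Q"
    by (intro adjacent_primes.intro adjacent_primes_axioms.intro K(1) noetherian_char_p_axioms K(2) P Q between)
      (use K(3,4) in auto)
  from adjacent_primes.local_tight_closure[OF this I x c w mem] show ?thesis .
qed

text \<open>The problem is solved modulo one minimal prime at a time: below Q by the theory of
  adjacent primes, elsewhere trivially. The resulting multipliers, all outside Q, are then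
  multiplied together.\<close>

lemma nonmaximal_prime_multiplier:
  assumes dim: "\<not> prime_chain R 3" and W: "mult_system R W"
    and I: "ideal I R" and x: "x \<in> carrier R" and c: "c \<in> carrier R"
    and cP: "\<And>P. minimal_prime R P \<Longrightarrow> P \<inter> W = {} \<Longrightarrow> c \<notin> P"
    and w: "\<And>e. w e \<in> W"
    and mem: "\<And>e. e \<ge> e0 \<Longrightarrow> c \<otimes> (w e \<otimes> x [^] (p ^ e)) \<in> frob_ideal R (p ^ e) I"
    and Q: "primeideal Q R" "Q \<inter> W = {}" "\<not> maximalideal Q R"
  shows "\<exists>f \<in> carrier R - Q. f \<otimes> x \<in> tight_closure R p I"
proof -
  note fid = frob_ideal_ideal[OF I]
  have Qid: "ideal Q R" using primeideal_ideal[OF Q(1)] .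
  \<comment> \<open>G P consists of the multipliers f for which f x satisfies the tight closure
    condition modulo P. It is stable under multiplication by R, so a product of multipliers works
    modulo every P for which one of its factors does.\<close>
  define G where "G = (\<lambda>P. {f \<in> carrier R. \<exists>c \<in> carrier R - P. \<forall>e. \<exists>i \<in> frob_ideal R (p ^ e) I.
      c \<otimes> (f \<otimes> x) [^] (p ^ e) \<ominus> i \<in> P})"
  have G_mult: "g \<otimes> f \<in> G P" if P: "ideal P R" and f: "f \<in> G P" and g: "g \<in> carrier R" for f g P
  proof -
    obtain d where d: "d \<in> carrier R - P" "\<forall>e. \<exists>i \<in> frob_ideal R (p ^ e) I. d \<otimes> (f \<otimes> x) [^] (p ^ e) \<ominus> i \<in> P"
      using f by (auto simp: G_def)
    have fc: "f \<in> carrier R" using f by (simp add: G_def)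
    have "\<exists>i \<in> frob_ideal R (p ^ e) I. d \<otimes> (g \<otimes> f \<otimes> x) [^] (p ^ e) \<ominus> i \<in> P" for e
    proof -
      obtain i where i: "i \<in> frob_ideal R (p ^ e) I" "d \<otimes> (f \<otimes> x) [^] (p ^ e) \<ominus> i \<in> P" using d(2) by auto
      have ic: "i \<in> carrier R" using i(1) ideal_subset[OF fid] by auto
      have "d \<otimes> (g \<otimes> f \<otimes> x) [^] (p ^ e) \<ominus> g [^] (p ^ e) \<otimes> i = g [^] (p ^ e) \<otimes> (d \<otimes> (f \<otimes> x) [^] (p ^ e) \<ominus> i)"
        using d(1) g fc x ic by (simp add: nat_pow_distrib a_minus_def r_distr l_minus r_minus m_ac)
      then have "d \<otimes> (g \<otimes> f \<otimes> x) [^] (p ^ e) \<ominus> g [^] (p ^ e) \<otimes> i \<in> P"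
        using ideal_mult_l[OF P i(2), of "g [^] (p ^ e)"] g by simp
      then show ?thesis using ideal_mult_l[OF fid i(1), of "g [^] (p ^ e)"] g by auto
    qed
    then show ?thesis using d(1) g fc by (auto simp: G_def)
  qed
  have ex: "\<exists>f \<in> carrier R - Q. f \<in> G P" if P: "minimal_prime R P" for P
  proof (cases "P \<subseteq> Q")
    case True
    have Pp: "primeideal P R" using minimal_prime_prime[OF P] .
    \<comment> \<open>A prime strictly between P and Q, together with a maximal ideal strictly above
      Q, would form a chain of length 3.\<close>
    have btw: "Q' = Q" if Q': "primeideal Q' R" "P \<subset> Q'" "Q' \<subseteq> Q" for Q'
    proof (rule ccontr)
      assume "Q' \<noteq> Q"
      obtain M where M: "maximalideal M R" "Q \<subseteq> M"
        using proper_ideal_in_maximal[OF Qid] primeideal.I_notcarr[OF Q(1)] by metis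
      then have "Q \<subset> M" using Q(3) by auto
      have Mp: "primeideal M R" using maximalideal_prime[OF M(1)] .
      define Ps where "Ps = (\<lambda>i::nat. if i = 0 then P else if i = 1 then Q' else if i = 2 then Q else M)"
      have "prime_chain R 3" unfolding prime_chain_def
      proof (intro exI[of _ Ps] conjI allI impI)
        show "primeideal (Ps i) R" for i using Pp Q' Q(1) Mp by (simp add: Ps_def)
        fix i :: nat assume "i < 3"
        then have "i = 0 \<or> i = 1 \<or> i = 2" by auto
        then show "Ps i \<subset> Ps (Suc i)" using Q'(2,3) \<open>Q' \<noteq> Q\<close> \<open>Q \<subset> M\<close> by (auto simp: Ps_def)
      qed
      then show False using dim by simp
    qed
    have "c \<in> carrier R - P" using c cP[OF P] True Q(2) by auto
    moreover have "w e \<in> carrier R - Q" for e using w[of e] W Q(2) by (auto simp: mult_system_def)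
    ultimately obtain f where "f \<in> carrier R - Q" "\<exists>c \<in> carrier R - P. \<forall>e. \<exists>i \<in> frob_ideal R (p ^ e) I. c \<otimes> (f \<otimes> x) [^] (p ^ e) \<ominus> i \<in> P"
      using tight_closure_mod_minimal_prime_at[OF Pp Q(1) True btw I x _ _ mem] by blast
    then show ?thesis by (auto simp: G_def)
  next
    case False
    have Pid: "ideal P R" using primeideal_ideal[OF minimal_prime_prime[OF P]] .
    \<comment> \<open>An element of P outside Q makes f x vanish modulo P, so there is nothing to
      prove there.\<close>
    obtain f where f: "f \<in> P" "f \<notin> Q" using False by auto
    have fc: "f \<in> carrier R" using f ideal_subset[OF Pid] by auto
    have "\<one> \<otimes> (f \<otimes> x) [^] (p ^ e) \<ominus> \<zero> \<in> P" for e
      using ideal_minus[OF Pid ideal_pow_mem[OF Pid ideal_mult_r[OF Pid f(1) x] p_pos] ideal_zero[OF Pid]] fc x by simp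
    then have "f \<in> G P" unfolding G_def
      using fc ideal_zero[OF fid] prime_one_notin[OF minimal_prime_prime[OF P]] by (intro CollectI conjI bexI[of _ \<one>] allI bexI[of _ \<zero>]) auto
    then show ?thesis using f fc by auto
  qed
  have "\<exists>f \<in> carrier R - Q. \<forall>P \<in> F. f \<in> G P" if "finite F" "F \<subseteq> {P. minimal_prime R P}" for F
    using that
  proof (induction F rule: finite_induct)
    case empty
    then show ?case using prime_one_notin[OF Q(1)] by auto
  next
    case (insert P F)
    obtain f where f: "f \<in> carrier R - Q" "\<forall>P \<in> F. f \<in> G P" using insert.IH insert.prems by auto
    obtain g where g: "g \<in> carrier R - Q" "g \<in> G P" using ex[of P] insert.prems by auto
    have id: "ideal P' R" if "P' \<in> insert P F" for P'
      using that insert.prems primeideal_ideal[OF minimal_prime_prime] by auto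
    have "f \<otimes> g \<in> G P'" if P': "P' \<in> insert P F" for P'
    proof (cases "P' = P")
      case True
      then show ?thesis using G_mult[OF id[OF P'], of g f] g f by simp
    next
      case False
      then have "g \<otimes> f \<in> G P'" using G_mult[OF id[OF P'], of f g] g f P' by auto
      then show ?thesis using m_comm g f by simp
    qed
    then show ?case using prime_mult_notin[OF Q(1), of f g] f g by (intro bexI[of _ "f \<otimes> g"]) auto
  qed
  from this[OF finite_minimal_primes] obtain f where f: "f \<in> carrier R - Q" "\<forall>P. minimal_prime R P \<longrightarrow> f \<in> G P" by auto
  have "f \<otimes> x \<in> tight_closure R p I"
  proof (rule tight_closure_mod_minimal_primes[OF I])
    show "f \<otimes> x \<in> carrier R" using f x by simp
    fix P assume "minimal_prime R P"
    then show "\<exists>c \<in> carrier R - P. \<exists>e0. \<forall>e\<ge>e0. \<exists>i \<in> frob_ideal R (p ^ e) I. c \<otimes> (f \<otimes> x) [^] (p ^ e) \<ominus> i \<in> P"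
      using f(2) unfolding G_def by blast
  qed
  then show ?thesis using f by auto
qed

lemma tight_closure_multiplier:
  assumes dim: "\<not> prime_chain R 3" and W: "mult_system R W"
    and I: "ideal I R" and x: "x \<in> carrier R" and c0: "c0 \<in> carrier R"
    and cP: "\<And>P. minimal_prime R P \<Longrightarrow> P \<inter> W = {} \<Longrightarrow> c0 \<notin> P"
    and w: "\<And>e. w e \<in> W"
    and mem: "\<And>e. e \<ge> e0 \<Longrightarrow> c0 \<otimes> (w e \<otimes> x [^] (p ^ e)) \<in> frob_ideal R (p ^ e) I"
  shows "\<exists>v \<in> W. v \<otimes> x \<in> tight_closure R p I"
proof -
  note fid = frob_ideal_ideal[OF I]
  have Wc: "\<And>v. v \<in> W \<Longrightarrow> v \<in> carrier R" and W1: "\<one> \<in> W" and Wm: "\<And>u v. u \<in> W \<Longrightarrow> v \<in> W \<Longrightarrow> u \<otimes> v \<in> W"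
    using W by (auto simp: mult_system_def)
  define b where "b = colon R (tight_closure R p I) x"
  have bid: "ideal b R" unfolding b_def by (rule colon_ideal[OF tight_closure_ideal[OF I] x])
  have "\<exists>v \<in> W. colon R b \<one> = colon R b v" using W1 by auto
  from maximal_ideal_with[OF colon_ideal[OF bid one_closed], of "\<lambda>J. \<exists>v \<in> W. J = colon R b v", OF this]
  obtain C where C: "ideal C R" "\<exists>v \<in> W. C = colon R b v"
    "\<forall>J. ideal J R \<longrightarrow> (\<exists>v \<in> W. J = colon R b v) \<longrightarrow> C \<subseteq> J \<longrightarrow> J = C"
    by auto
  then obtain v where v: "v \<in> W" "C = colon R b v" by auto
  have vc: "v \<in> carrier R" using Wc[OF v(1)] .
  \<comment> \<open>The ideal (b : v u) contains (b : v) and belongs to the same family, so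
    maximality makes them equal. This is the W-saturation of C.\<close>
  have sat: "r \<in> C" if r: "r \<in> carrier R" and u: "u \<in> W" and ur: "u \<otimes> r \<in> C" for u r
  proof -
    have uc: "u \<in> carrier R" using Wc[OF u] .
    have "C \<subseteq> colon R b (v \<otimes> u)"
    proof
      fix s assume s: "s \<in> C"
      then have sc: "s \<in> carrier R" "s \<otimes> v \<in> b" by (auto simp: v(2) colon_def)
      then have "s \<otimes> (v \<otimes> u) \<in> b" using ideal_mult_r[OF bid sc(2) uc] vc uc by (simp add: m_assoc)
      then show "s \<in> colon R b (v \<otimes> u)" using sc by (simp add: colon_def)
    qed
    moreover have "ideal (colon R b (v \<otimes> u)) R" by (rule colon_ideal[OF bid]) (use vc uc in simp)
    ultimately have eq: "colon R b (v \<otimes> u) = C" using C(3) Wm[OF v(1) u] by auto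
    have "r \<otimes> (v \<otimes> u) = u \<otimes> r \<otimes> v" using r vc uc by (simp add: m_ac)
    then have "r \<in> colon R b (v \<otimes> u)" using ur r by (simp add: v(2) colon_def)
    then show ?thesis using eq by simp
  qed
  have bC: "b \<subseteq> C" unfolding v(2) by (rule colon_superset[OF bid vc])
  have maxW: "M \<inter> W = {}" if M: "maximalideal M R" "C \<subseteq> M" for M
  proof -
    have Mp: "primeideal M R" using maximalideal_prime[OF M(1)] .
    \<comment> \<open>To find a prime that contains C, lies inside M and misses W, avoid all
      products of an element of W with an element outside M; saturation and C \<subseteq> M keep C
      disjoint from these. Were such a prime Q not maximal, some f outside Q would lie in b, yet b
      \<subseteq> C \<subseteq> Q. Hence Q is maximal and equals M.\<close>
    define T where "T = {u \<otimes> s | u s. u \<in> W \<and> s \<in> carrier R - M}"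
    have one: "\<one> \<in> carrier R - M" using prime_one_notin[OF Mp] by simp
    have "mult_system R T" unfolding mult_system_def
    proof (intro conjI ballI)
      show "T \<subseteq> carrier R" using Wc by (auto simp: T_def)
      show "\<one> \<in> T" unfolding T_def using W1 one by (intro CollectI exI[of _ \<one>]) auto
      fix a d assume "a \<in> T" "d \<in> T"
      then obtain u s u' s' where *: "a = u \<otimes> s" "d = u' \<otimes> s'" "u \<in> W" "u' \<in> W" "s \<in> carrier R - M" "s' \<in> carrier R - M"
        by (auto simp: T_def)
      then have "a \<otimes> d = (u \<otimes> u') \<otimes> (s \<otimes> s')" using Wc by (simp add: m_ac)
      moreover have "s \<otimes> s' \<in> carrier R - M" using * prime_mult_notin[OF Mp] by auto
      ultimately show "a \<otimes> d \<in> T" unfolding T_def using Wm[OF *(3,4)] by blast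
    qed
    moreover have "C \<inter> T = {}"
    proof (rule ccontr)
      assume "C \<inter> T \<noteq> {}"
      then obtain u s where "u \<in> W" "s \<in> carrier R - M" "u \<otimes> s \<in> C" by (auto simp: T_def)
      then show False using sat[of s u] M(2) by auto
    qed
    ultimately obtain Q where Q: "primeideal Q R" "C \<subseteq> Q" "Q \<inter> T = {}" using prime_avoiding[OF C(1)] by metis
    have QW: "Q \<inter> W = {}"
    proof -
      have "u \<in> T" if "u \<in> W" for u unfolding T_def using that one Wc by (intro CollectI exI[of _ u] exI[of _ \<one>]) auto
      then show ?thesis using Q(3) by auto
    qed
    have QM: "Q \<subseteq> M"
    proof
      fix s assume s: "s \<in> Q"
      have sc: "s \<in> carrier R" using s ideal_subset[OF primeideal_ideal[OF Q(1)]] by auto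
      show "s \<in> M"
      proof (rule ccontr)
        assume "s \<notin> M"
        then have "s \<in> T" unfolding T_def using sc W1 by (intro CollectI exI[of _ \<one>] exI[of _ s]) auto
        then show False using s Q(3) by auto
      qed
    qed
    have "maximalideal Q R"
    proof (rule ccontr)
      assume nm: "\<not> maximalideal Q R"
      obtain f where f: "f \<in> carrier R - Q" "f \<otimes> x \<in> tight_closure R p I"
        using nonmaximal_prime_multiplier[OF dim W I x c0 cP w mem Q(1) QW nm] by auto
      then have "f \<in> b" by (simp add: b_def colon_def)
      then show False using f bC Q(2) by auto
    qed
    then have "Q = M"
      using maximalideal.I_maximal[of Q R M] QM primeideal_ideal[OF Mp] ideal_subset[of M] primeideal.I_notcarr[OF Mp] by auto
    then show ?thesis using QW by simp
  qed
  define u where "u = v \<otimes> x"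
  have uc: "u \<in> carrier R" using vc x by (simp add: u_def)
  obtain A where A: "A \<subseteq> carrier R" "finite A" "C = genideal R A" using finetely_gen[OF C(1)] by auto
  have AC: "A \<subseteq> C" using genideal_self[OF A(1)] A(3) by simp
  have "y \<otimes> u \<in> tight_closure R p I" if "y \<in> A" for y
  proof -
    have "y \<in> carrier R" "y \<otimes> v \<in> b" using that AC by (auto simp: v(2) colon_def)
    then show ?thesis using x vc by (simp add: b_def colon_def u_def m_assoc)
  qed
  then obtain c e1 where c: "c \<in> ring_circ R" "\<forall>a \<in> (\<lambda>y. y \<otimes> u) ` A. \<forall>e\<ge>e1. c \<otimes> a [^] (p ^ e) \<in> frob_ideal R (p ^ e) I"
    using tight_closure_uniform[OF I, of "(\<lambda>y. y \<otimes> u) ` A"] A(2) by auto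
  have cc: "c \<in> carrier R" using ring_circ_closed[OF c(1)] .
  \<comment> \<open>The multiplier c was chosen for the finitely many generators in A; Frobenius
    preimages extend its effect to all of C, with the same c and e1.\<close>
  have "C \<subseteq> {y \<in> carrier R. \<forall>e\<in>{e1..}. (c \<otimes> u [^] (p ^ e)) \<otimes> y [^] (p ^ e) \<in> frob_ideal R (p ^ e) I}"
    unfolding A(3)
  proof (rule genideal_minimal)
    show "ideal {y \<in> carrier R. \<forall>e\<in>{e1..}. (c \<otimes> u [^] (p ^ e)) \<otimes> y [^] (p ^ e) \<in> frob_ideal R (p ^ e) I} R"
      by (rule frobenius_preimage_ideal) (use cc uc fid in auto)
    show "A \<subseteq> {y \<in> carrier R. \<forall>e\<in>{e1..}. (c \<otimes> u [^] (p ^ e)) \<otimes> y [^] (p ^ e) \<in> frob_ideal R (p ^ e) I}"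
    proof (intro subsetI CollectI conjI ballI)
      fix y assume y: "y \<in> A"
      then show yc: "y \<in> carrier R" using A(1) by auto
      fix e assume "e \<in> {e1..}"
      then have "c \<otimes> (y \<otimes> u) [^] (p ^ e) \<in> frob_ideal R (p ^ e) I" using c(2) y by auto
      moreover have "c \<otimes> (y \<otimes> u) [^] (p ^ e) = (c \<otimes> u [^] (p ^ e)) \<otimes> y [^] (p ^ e)"
        using cc yc uc by (simp add: nat_pow_distrib m_ac)
      ultimately show "(c \<otimes> u [^] (p ^ e)) \<otimes> y [^] (p ^ e) \<in> frob_ideal R (p ^ e) I" by simp
    qed
  qed
  then have Cmem: "(c \<otimes> u [^] (p ^ e)) \<otimes> y [^] (p ^ e) \<in> frob_ideal R (p ^ e) I" if "y \<in> C" "e \<ge> e1" for y e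
    using that by auto
  have key: "(c \<otimes> c0) \<otimes> u [^] (p ^ e) \<in> frob_ideal R (p ^ e) I" if e: "e \<ge> max e0 e1" for e
  proof -
    define z where "z = (c \<otimes> c0) \<otimes> u [^] (p ^ e)"
    have zc: "z \<in> carrier R" using cc c0 uc by (simp add: z_def)
    let ?J = "colon R (frob_ideal R (p ^ e) I) z"
    have Jid: "ideal ?J R" by (rule colon_ideal[OF fid zc])
    have yJ: "y [^] (p ^ e) \<in> ?J" if y: "y \<in> C" for y
    proof -
      have yc: "y \<in> carrier R" using y ideal_subset[OF C(1)] by auto
      have "y [^] (p ^ e) \<otimes> z = c0 \<otimes> ((c \<otimes> u [^] (p ^ e)) \<otimes> y [^] (p ^ e))"
        unfolding z_def using yc cc c0 uc by (simp add: m_ac)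
      then show ?thesis using ideal_mult_l[OF fid Cmem[OF y] c0] e yc by (simp add: colon_def)
    qed
    have wJ: "w e \<in> ?J"
    proof -
      have wc: "w e \<in> carrier R" using Wc[OF w] .
      have "w e \<otimes> z = (c \<otimes> v [^] (p ^ e)) \<otimes> (c0 \<otimes> (w e \<otimes> x [^] (p ^ e)))"
        unfolding z_def u_def using wc cc c0 vc x by (simp add: nat_pow_distrib m_ac)
      then show ?thesis using ideal_mult_l[OF fid mem[of e], of "c \<otimes> v [^] (p ^ e)"] e cc vc wc by (simp add: colon_def)
    qed
    have "?J = carrier R"
    proof (rule ccontr)
      assume "?J \<noteq> carrier R"
      then obtain M where M: "maximalideal M R" "?J \<subseteq> M" using proper_ideal_in_maximal[OF Jid] by metis
      have "C \<subseteq> M"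
      proof
        fix y assume y: "y \<in> C"
        then show "y \<in> M" using prime_pow_notin[OF maximalideal_prime[OF M(1)], of y "p ^ e"] yJ M(2) ideal_subset[OF C(1)] by auto
      qed
      then show False using maxW[OF M(1)] wJ M(2) w[of e] by auto
    qed
    then have "\<one> \<in> ?J" by simp
    then show ?thesis using zc by (simp add: colon_def z_def)
  qed
  \<comment> \<open>The element c0 may lie in minimal primes that meet W. A factor t from W lying in
    all of these makes t u vanish modulo them, while modulo the remaining minimal primes c c0 is a
    nonzero multiplier.\<close>
  have "\<exists>t \<in> W. \<forall>J \<in> {P. minimal_prime R P \<and> P \<inter> W \<noteq> {}}. t \<in> J"
  proof (rule mult_system_common[OF W])
    show "finite {P. minimal_prime R P \<and> P \<inter> W \<noteq> {}}" using finite_minimal_primes by (rule rev_finite_subset) auto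
  qed (use primeideal_ideal[OF minimal_prime_prime] in auto)
  then obtain t where t: "t \<in> W" "\<And>P. minimal_prime R P \<Longrightarrow> P \<inter> W \<noteq> {} \<Longrightarrow> t \<in> P" by auto
  have tc: "t \<in> carrier R" using Wc[OF t(1)] .
  have "t \<otimes> u \<in> tight_closure R p I"
  proof (rule tight_closure_mod_minimal_primes[OF I])
    show "t \<otimes> u \<in> carrier R" using tc uc by simp
    fix P assume P: "minimal_prime R P"
    have Pp: "primeideal P R" using minimal_prime_prime[OF P] .
    have Pid: "ideal P R" using primeideal_ideal[OF Pp] .
    show "\<exists>c \<in> carrier R - P. \<exists>e0. \<forall>e\<ge>e0. \<exists>i \<in> frob_ideal R (p ^ e) I. c \<otimes> (t \<otimes> u) [^] (p ^ e) \<ominus> i \<in> P"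
    proof (cases "P \<inter> W = {}")
      case True
      have "c \<otimes> c0 \<in> carrier R - P" using prime_mult_notin[OF Pp cc c0] cP[OF P True] c(1) P cc c0 by (auto simp: ring_circ_iff)
      moreover have "\<exists>i \<in> frob_ideal R (p ^ e) I. (c \<otimes> c0) \<otimes> (t \<otimes> u) [^] (p ^ e) \<ominus> i \<in> P" if e: "e \<ge> max e0 e1" for e
      proof -
        have "(c \<otimes> c0) \<otimes> (t \<otimes> u) [^] (p ^ e) = t [^] (p ^ e) \<otimes> ((c \<otimes> c0) \<otimes> u [^] (p ^ e))"
          using cc c0 tc uc by (simp add: nat_pow_distrib m_ac)
        then have "(c \<otimes> c0) \<otimes> (t \<otimes> u) [^] (p ^ e) \<in> frob_ideal R (p ^ e) I"
          using ideal_mult_l[OF fid key[OF e], of "t [^] (p ^ e)"] tc by simp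
        moreover have "(c \<otimes> c0) \<otimes> (t \<otimes> u) [^] (p ^ e) \<ominus> (c \<otimes> c0) \<otimes> (t \<otimes> u) [^] (p ^ e) = \<zero>"
          using cc c0 tc uc by simp
        ultimately show ?thesis using ideal_zero[OF Pid] by metis
      qed
      ultimately show ?thesis by blast
    next
      case False
      have "t \<in> P" using t(2)[OF P False] .
      have "\<one> \<otimes> (t \<otimes> u) [^] (p ^ e) \<ominus> \<zero> \<in> P" for e
        using ideal_minus[OF Pid ideal_pow_mem[OF Pid ideal_mult_r[OF Pid \<open>t \<in> P\<close> uc] p_pos] ideal_zero[OF Pid]] tc uc by simp
      then have "\<forall>e\<ge>0. \<exists>i \<in> frob_ideal R (p ^ e) I. \<one> \<otimes> (t \<otimes> u) [^] (p ^ e) \<ominus> i \<in> P"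
        using ideal_zero[OF fid] by blast
      moreover have "\<one> \<in> carrier R - P" using prime_one_notin[OF Pp] by simp
      ultimately show ?thesis by blast
    qed
  qed
  moreover have "t \<otimes> u = (t \<otimes> v) \<otimes> x" using tc vc x by (simp add: u_def m_assoc)
  ultimately show ?thesis using Wm[OF t(1) v(1)] by auto
qed

end

theorem theorem1p1:
  fixes R :: "('a, 'b) ring_scheme" and p :: nat
  assumes "cring R" and "noetherian_ring R" and "char_p R p"
    and "krull_dim R < 2
         \<or> (local_ring R \<and> krull_dim R = 2)
         \<or> (krull_dim R = 2 \<and> (nagata_ring R \<or> (\<exists>e' c. weak_test_element R p (p ^ e') c)))"
  shows "\<forall>I W. ideal I R \<longrightarrow> mult_system R W \<longrightarrow>
           ext_ideal R W (tight_closure R p I) =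
           tight_closure (localization R W) p (ext_ideal R W I)"
proof (intro allI impI equalityI)
  interpret R: noetherian_char_p R p
    by (intro noetherian_char_p.intro noetherian_cring.intro prime_char.intro prime_char_axioms.intro assms(1-3))
  fix I W assume I: "ideal I R" and W: "mult_system R W"
  interpret RW: localized_char_p R W p
    by (intro localized_char_p.intro localized_ring.intro localized_ring_axioms.intro W R.cring_axioms R.prime_char_axioms)
  \<comment> \<open>A chain of length 3 consists of four primes; each of the three cases bounds the
    dimension by 2.\<close>
  have dim: "\<not> prime_chain R 3"
  proof
    assume "prime_chain R 3"
    then have "enat 3 \<le> krull_dim R" unfolding krull_dim_def by (intro SUP_upper) simp
    moreover have "krull_dim R \<le> 2" using assms(4) by (elim disjE conjE) (simp_all add: less_imp_le)
    then have "krull_dim R \<le> enat 2" unfolding numeral_eq_enat .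
    ultimately have "enat 3 \<le> enat 2" by (rule order_trans)
    then show False by simp
  qed
  show "ext_ideal R W (tight_closure R p I) \<subseteq> tight_closure (localization R W) p (ext_ideal R W I)"
    by (rule RW.ext_tight_closure_subset[OF I])
  show "tight_closure (localization R W) p (ext_ideal R W I) \<subseteq> ext_ideal R W (tight_closure R p I)"
  proof
    fix a assume a: "a \<in> tight_closure (localization R W) p (ext_ideal R W I)"
    then have "a \<in> carrier (localization R W)" by (simp add: tight_closure_def)
    then obtain x s where x: "x \<in> carrier R" "s \<in> W" "a = RW.frac x s" by (rule RW.carrier_L_cases)
    obtain c w e0 where c: "c \<in> carrier R" "\<forall>P. minimal_prime R P \<longrightarrow> P \<inter> W = {} \<longrightarrow> c \<notin> P" "\<forall>e. w e \<in> W"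
      "\<forall>e\<ge>e0. c \<otimes>\<^bsub>R\<^esub> (w e \<otimes>\<^bsub>R\<^esub> x [^]\<^bsub>R\<^esub> (p ^ e)) \<in> frob_ideal R (p ^ e) I"
      using RW.tight_closure_extD[OF I x(1,2)] a x(3) by blast
    have "\<exists>v \<in> W. v \<otimes>\<^bsub>R\<^esub> x \<in> tight_closure R p I"
      by (rule R.tight_closure_multiplier[OF dim W I x(1) c(1)]) (use c in auto)
    then show "a \<in> ext_ideal R W (tight_closure R p I)"
      unfolding x(3) using RW.frac_in_ext_ideal_iff[OF R.tight_closure_ideal[OF I] x(1,2)] by simp
  qed
qed

end
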